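(* If $\mathcal{A}$ is a rank-$\ell$ central arrangement of $n\ge2$ hyperplanes, then $$p_{S/I}(p,q)=\frac{1}{(n-2)!}\sum_{i=1}^{\ell}t_{i0}\binom{n-2}{i-1}p^{i-1}q^{n-1-i}+\Omega(\{p,q\}^{n-2}),$$ where $\Omega(\{p,q\}^{n-2})$ denotes a polynomial in $p$ and $q$ of total degree strictly less than $n-2$.
   Context: Let $V$ be a complex vector space of dimension $m$ and $\mathcal{A}=\{H_1,\dots,H_n\}$ a central arrangement in $V$: a set of $n$ distinct linear hyperplanes $H_i=\ker f_i$, with $f_i\in V^*$ nonzero; put $f=f_1\cdots f_n$. The rank of $\mathcal{A}$ is $\ell=\operatorname{codim}_V\bigcap_iH_i$. Let $R=\mathbb{C}[V]$ be the coordinate ring of $V$, $C=\mathbb{C}[a_1,\dots,a_n]$, and $S=R\otimes_{\mathbb{C}}C$, bigraded by degree in the $R$-variables and degree in the $C$-variables. Let $D(\mathcal{A})=\{\theta\in\operatorname{Der}_{\mathbb{C}}(R):\theta(f)\in(f)\}$ be the module of logarithmic derivations, and $\omega_{\mathbf a}=\sum_{i=1}^n a_i\frac{df_i}{f_i}$. The logarithmic ideal $I=I(\mathcal{A})\subseteq S$ is the bihomogeneous ideal generated by all contractions $\langle\theta,\omega_{\mathbf a}\rangle=\sum_i a_i\frac{\theta(f_i)}{f_i}$, $\theta\in D(\mathcal{A})$. The Hilbert polynomial $p_{S/I}$ is the polynomial with $p_{S/I}(a,b)=\dim_{\mathbb{C}}(S/I)_{a,b}$ for integers $a,b\gg0$.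 The integers $t_{ij}$ are the coefficients of $x^iy^j$ in the Tutte polynomial $T_{\mathcal{A}}(x,y)$ of the matroid of $\mathcal{A}$. With the characteristic polynomial $\chi(\mathcal{A},t)=\sum_{X\in L(\mathcal{A})}\mu(V,X)t^{\ell-\operatorname{codim}X}$ (where $L(\mathcal{A})$ is the intersection lattice ordered by reverse inclusion and $\mu$ its Möbius function), one has $T_{\mathcal{A}}(x,0)=\sum_i t_{i0}x^i=(-1)^\ell\chi(\mathcal{A},1-x)$. Conventions: the zero polynomial counts as having degree $-\infty$, and terms with $\binom{n-2}{i-1}=0$ are read as $0$.
   Formalization: The arrangement is assumed essential (the rank ℓ equals dim V); for dim V > ℓ the formula fails, e.g. for x, y, x+y in C³, where p_{S/I} has total degree 2 > n−2, and it holds there only for Boolean arrangements, where both sides vanish. *)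

theory Defs
  imports "HOL-Analysis.Analysis" "HOL-Library.Poly_Mapping" "HOL-Library.Product_Plus"
begin

section \<open>Dimension of a quotient space\<close>

text \<open>The residue classes of the finite set \<open>B \<subseteq> U\<close> form a basis of \<open>U / (U \<inter> W)\<close>: every
  class has unique coordinates with respect to them.\<close>

definition quotient_basis ::
    "('k::field \<Rightarrow> 'a::ab_group_add \<Rightarrow> 'a) \<Rightarrow> 'a set \<Rightarrow> 'a set \<Rightarrow> 'a set \<Rightarrow> bool" where
  "quotient_basis s W U B \<longleftrightarrow> finite B \<and> B \<subseteq> U \<and>
     (\<forall>u\<in>U. \<exists>!c. (\<forall>b. b \<notin> B \<longrightarrow> c b = 0) \<and> u - (\<Sum>b\<in>B. s (c b) b) \<in> W)"

definition quotient_dim ::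
    "('k::field \<Rightarrow> 'a::ab_group_add \<Rightarrow> 'a) \<Rightarrow> 'a set \<Rightarrow> 'a set \<Rightarrow> nat" where
  "quotient_dim s W U = (THE d. \<exists>B. quotient_basis s W U B \<and> card B = d)"

lemma quotient_basis_card:
  assumes "vector_space s" "module.subspace s U" "module.subspace s W" "finite X" "U \<subseteq> module.span s X"
    and B: "quotient_basis s W U B"
  shows "card B + vector_space.dim s (U \<inter> W) = vector_space.dim s U"
proof -
  interpret vs: vector_space s by fact
  have U: "vs.subspace U" and W: "vs.subspace W" using assms by auto
  obtain C where C: "C \<subseteq> U \<inter> W" "vs.independent C" "U \<inter> W \<subseteq> vs.span C" "card C = vs.dim (U \<inter> W)"
    using vs.basis_exists[of "U \<inter> W"] by metis
  have finC: "finite C"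
    using vs.independent_span_bound[OF assms(4) C(2)] C(1) assms(5) by auto
  have finB: "finite B" and BU: "B \<subseteq> U"
    and ex1: "\<And>u. u \<in> U \<Longrightarrow> \<exists>!c. (\<forall>b. b \<notin> B \<longrightarrow> c b = 0) \<and> u - (\<Sum>b\<in>B. s (c b) b) \<in> W"
    using B unfolding quotient_basis_def by auto
  have zero: "g b = 0" if "(\<Sum>b\<in>B. s (g b) b) \<in> W" "b \<in> B" for g b
  proof -
    let ?c = "\<lambda>b. if b \<in> B then g b else 0"
    have "(\<Sum>b\<in>B. s (?c b) b) = (\<Sum>b\<in>B. s (g b) b)" by (rule sum.cong) auto
    then have "0 - (\<Sum>b\<in>B. s (?c b) b) \<in> W"
      using that(1) vs.subspace_neg[OF W] by simp
    moreover have "0 - (\<Sum>b\<in>B. s ((\<lambda>_. 0) b) b) \<in> W" using vs.subspace_0[OF W] by simp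
    ultimately have W0: "0 - (\<Sum>b\<in>B. s (?c b) b) \<in> W" "0 - (\<Sum>b\<in>B. s ((\<lambda>_. 0) b) b) \<in> W"
      by blast+
    have "\<exists>c0. \<forall>c. (\<forall>b. b \<notin> B \<longrightarrow> c b = 0) \<and> 0 - (\<Sum>b\<in>B. s (c b) b) \<in> W \<longrightarrow> c = c0"
      using ex1[OF vs.subspace_0[OF U]] unfolding Ex1_def by blast
    then obtain c0 where
      "\<And>c. (\<forall>b. b \<notin> B \<longrightarrow> c b = 0) \<Longrightarrow> 0 - (\<Sum>b\<in>B. s (c b) b) \<in> W \<Longrightarrow> c = c0"
      by blast
    from this[of ?c] this[of "\<lambda>_. 0"] W0 have "?c = (\<lambda>_. 0)" by simp
    from fun_cong[OF this, of b] show ?thesis using that(2) by simp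
  qed
  have disj: "B \<inter> C = {}"
  proof (rule ccontr)
    assume "B \<inter> C \<noteq> {}"
    then obtain b where b: "b \<in> B" "b \<in> C" by auto
    have "(\<Sum>x\<in>B. s (if x = b then 1 else 0) x) = (\<Sum>x\<in>B. if x = b then x else 0)"
      by (rule sum.cong) auto
    also have "\<dots> = b" using finB b by simp
    finally show False using zero[of "\<lambda>x. if x = b then 1 else 0" b] b C(1) by auto
  qed
  have indep: "vs.independent (B \<union> C)"
  proof (rule vs.independent_if_scalars_zero)
    show "finite (B \<union> C)" using finB finC by simp
    fix g x assume g: "(\<Sum>x\<in>B \<union> C. s (g x) x) = 0" and x: "x \<in> B \<union> C"
    have split: "(\<Sum>x\<in>B. s (g x) x) + (\<Sum>x\<in>C. s (g x) x) = 0"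
      using g sum.union_disjoint[OF finB finC disj] by metis
    have "(\<Sum>x\<in>C. s (g x) x) \<in> W"
      using C(1) by (intro vs.subspace_sum[OF W] vs.subspace_scale[OF W]) auto
    then have "(\<Sum>x\<in>B. s (g x) x) \<in> W"
      using split vs.subspace_neg[OF W] by (metis add_eq_0_iff minus_equation_iff)
    then have gB: "\<And>b. b \<in> B \<Longrightarrow> g b = 0" using zero by blast
    then have "(\<Sum>x\<in>C. s (g x) x) = 0" using split by simp
    then have "\<And>x. x \<in> C \<Longrightarrow> g x = 0" using vs.independentD[OF C(2) finC order_refl, of g] by blast
    then show "g x = 0" using gB x by auto
  qed
  have "U \<subseteq> vs.span (B \<union> C)"
  proof
    fix u assume u: "u \<in> U"
    obtain c where c: "u - (\<Sum>b\<in>B. s (c b) b) \<in> W" using ex1[OF u] by blast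
    have sB: "(\<Sum>b\<in>B. s (c b) b) \<in> vs.span B" by (intro vs.span_sum vs.span_scale vs.span_base)
    have "(\<Sum>b\<in>B. s (c b) b) \<in> U"
      using BU by (intro vs.subspace_sum[OF U] vs.subspace_scale[OF U]) auto
    then have "u - (\<Sum>b\<in>B. s (c b) b) \<in> vs.span C"
      using c C(3) vs.subspace_diff[OF U u] by auto
    then have "(u - (\<Sum>b\<in>B. s (c b) b)) + (\<Sum>b\<in>B. s (c b) b) \<in> vs.span (B \<union> C)"
      using sB vs.span_mono[of B "B \<union> C"] vs.span_mono[of C "B \<union> C"] by (intro vs.span_add) auto
    then show "u \<in> vs.span (B \<union> C)" by simp
  qed
  then have "card (B \<union> C) = vs.dim U"
    using indep BU C(1) by (intro vs.basis_card_eq_dim) auto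
  then show ?thesis using C(4) card_Un_disjoint[OF finB finC disj] by simp
qed

lemma quotient_basis_exists:
  assumes "vector_space s" "module.subspace s U" "module.subspace s W" "finite X" "U \<subseteq> module.span s X"
  shows "\<exists>B. quotient_basis s W U B"
proof -
  interpret vs: vector_space s by fact
  have U: "vs.subspace U" and W: "vs.subspace W" using assms by auto
  obtain C where C: "C \<subseteq> U \<inter> W" "vs.independent C" "U \<inter> W \<subseteq> vs.span C"
    using vs.basis_exists[of "U \<inter> W"] by metis
  obtain D where D: "C \<subseteq> D" "D \<subseteq> U" "vs.independent D" "U \<subseteq> vs.span D"
    using vs.maximal_independent_subset_extend[of C U] C by auto
  have finD: "finite D"
    using vs.independent_span_bound[OF assms(4) D(3)] D(2) assms(5) by auto
  have finC: "finite C" using D(1) finD finite_subset by blast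
  define B where "B = D - C"
  have finB: "finite B" using finD B_def by simp
  have D_sum: "(\<Sum>x\<in>D. h x) = (\<Sum>x\<in>B. h x) + (\<Sum>x\<in>C. h x)" for h :: "'b \<Rightarrow> 'b"
    unfolding B_def using sum.subset_diff[OF D(1) finD] by auto
  have C_W: "(\<Sum>x\<in>C. s (g x) x) \<in> W" for g
    using C(1) by (intro vs.subspace_sum[OF W] vs.subspace_scale[OF W]) auto
  have "\<exists>!c. (\<forall>b. b \<notin> B \<longrightarrow> c b = 0) \<and> u - (\<Sum>b\<in>B. s (c b) b) \<in> W" if u: "u \<in> U" for u
  proof (rule ex_ex1I)
    obtain r where r: "u = (\<Sum>x\<in>D. s (r x) x)"
      using u D(4) vs.span_finite[OF finD] by auto
    let ?c = "\<lambda>b. if b \<in> B then r b else 0"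
    have "(\<Sum>b\<in>B. s (?c b) b) = (\<Sum>b\<in>B. s (r b) b)" by (rule sum.cong) auto
    then have "u - (\<Sum>b\<in>B. s (?c b) b) = (\<Sum>x\<in>C. s (r x) x)" using r D_sum by simp
    then show "\<exists>c. (\<forall>b. b \<notin> B \<longrightarrow> c b = 0) \<and> u - (\<Sum>b\<in>B. s (c b) b) \<in> W"
      using C_W by (intro exI[of _ ?c]) auto
  next
    fix c c' assume c: "(\<forall>b. b \<notin> B \<longrightarrow> c b = 0) \<and> u - (\<Sum>b\<in>B. s (c b) b) \<in> W"
      and c': "(\<forall>b. b \<notin> B \<longrightarrow> c' b = 0) \<and> u - (\<Sum>b\<in>B. s (c' b) b) \<in> W"
    let ?S = "\<Sum>b\<in>B. s (c b - c' b) b"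
    have "?S = (u - (\<Sum>b\<in>B. s (c' b) b)) - (u - (\<Sum>b\<in>B. s (c b) b))"
      by (simp add: vs.scale_left_diff_distrib sum_subtractf)
    then have "?S \<in> W"
      using vs.subspace_diff[OF W conjunct2[OF c'] conjunct2[OF c]] by (simp only:)
    moreover have "?S \<in> U"
      using D(2) by (intro vs.subspace_sum[OF U] vs.subspace_scale[OF U]) (auto simp: B_def)
    ultimately obtain r where r: "?S = (\<Sum>x\<in>C. s (r x) x)"
      using C(3) vs.span_finite[OF finC] by auto
    let ?g = "\<lambda>x. if x \<in> B then c x - c' x else - r x"
    have "(\<Sum>x\<in>C. s (?g x) x) = (\<Sum>x\<in>C. - s (r x) x)"
      by (rule sum.cong) (auto simp: B_def)
    moreover have "(\<Sum>x\<in>B. s (?g x) x) = ?S" by (rule sum.cong) auto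
    ultimately have "(\<Sum>x\<in>D. s (?g x) x) = 0" using D_sum r by (simp add: sum_negf)
    then have *: "\<And>x. x \<in> D \<Longrightarrow> ?g x = 0"
      using vs.independentD[OF D(3) finD order_refl, of ?g] by blast
    show "c = c'"
    proof
      fix b show "c b = c' b"
        using *[of b] c c' by (cases "b \<in> B") (auto simp: B_def)
    qed
  qed
  moreover have "B \<subseteq> U" using D(2) B_def by auto
  ultimately have "quotient_basis s W U B" unfolding quotient_basis_def using finB by simp
  then show ?thesis by blast
qed

lemma quotient_dim_add:
  assumes "vector_space s" "module.subspace s U" "module.subspace s W" "finite X" "U \<subseteq> module.span s X"
  shows "quotient_dim s W U + vector_space.dim s (U \<inter> W) = vector_space.dim s U"
proof -
  obtain B where B: "quotient_basis s W U B" using quotient_basis_exists[OF assms] by blast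
  have "quotient_dim s W U = card B"
    unfolding quotient_dim_def
  proof (rule the_equality)
    fix d assume "\<exists>B. quotient_basis s W U B \<and> card B = d"
    then obtain B' where "quotient_basis s W U B'" "card B' = d" by blast
    then show "d = card B"
      using quotient_basis_card[OF assms, of B'] quotient_basis_card[OF assms B] by simp
  qed (use B in blast)
  then show ?thesis using quotient_basis_card[OF assms B] by simp
qed


section \<open>Polynomials\<close>

text \<open>A polynomial is a finitely supported function from exponents to coefficients; the product of
  \<^typ>\<open>'a \<Rightarrow>\<^sub>0 'b\<close> is convolution. The coordinate ring of \<open>\<complex>\<^sup>m\<close> has exponents \<^typ>\<open>'m \<Rightarrow>\<^sub>0 nat\<close>.
  In the tensor product with \<open>\<complex>[a\<^sub>i : i \<in> 'n]\<close> the pair \<open>(\<alpha>, \<beta>)\<close> is the exponent of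
  \<open>x\<^sup>\<alpha> \<otimes> a\<^sup>\<beta>\<close>, and in \<open>'k bipoly\<close> the pair \<open>(i, j)\<close> is the exponent of \<open>x\<^sup>i y\<^sup>j\<close>.\<close>

type_synonym 'm coord_ring = "('m \<Rightarrow>\<^sub>0 nat) \<Rightarrow>\<^sub>0 complex"
type_synonym ('m, 'n) tensor_ring = "(('m \<Rightarrow>\<^sub>0 nat) \<times> ('n \<Rightarrow>\<^sub>0 nat)) \<Rightarrow>\<^sub>0 complex"
type_synonym 'k bipoly = "(nat \<times> nat) \<Rightarrow>\<^sub>0 'k"

definition bipoly_eval :: "'k::comm_semiring_1 bipoly \<Rightarrow> 'k \<Rightarrow> 'k \<Rightarrow> 'k" where
  "bipoly_eval P x y = (\<Sum>(i, j)\<in>Poly_Mapping.keys P. Poly_Mapping.lookup P (i, j) * x ^ i * y ^ j)"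

lemma bipoly_eq_0I:
  fixes P :: "rat bipoly"
  assumes "\<And>a b. a \<ge> N \<Longrightarrow> b \<ge> N \<Longrightarrow> bipoly_eval P (of_nat a) (of_nat b) = 0"
  shows "P = 0"
proof -
  let ?K = "Poly_Mapping.keys P"
  define M where "M = Max (insert 0 (fst ` ?K \<union> snd ` ?K))"
  have K: "?K \<subseteq> {..M} \<times> {..M}"
  proof
    fix x assume "x \<in> ?K"
    then have "fst x \<le> M" "snd x \<le> M" unfolding M_def by (auto intro!: Max_ge)
    then show "x \<in> {..M} \<times> {..M}" by (cases x) auto
  qed
  have ev: "bipoly_eval P x y = (\<Sum>i\<le>M. (\<Sum>j\<le>M. Poly_Mapping.lookup P (i,j) * y ^ j) * x ^ i)" for x y
  proof -
    have "bipoly_eval P x y = (\<Sum>(i,j)\<in>{..M} \<times> {..M}. Poly_Mapping.lookup P (i,j) * x ^ i * y ^ j)"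
      unfolding bipoly_eval_def using K by (intro sum.mono_neutral_left) (auto simp: in_keys_iff)
    also have "\<dots> = (\<Sum>i\<le>M. \<Sum>j\<le>M. Poly_Mapping.lookup P (i,j) * x ^ i * y ^ j)"
      by (simp add: sum.cartesian_product)
    also have "\<dots> = (\<Sum>i\<le>M. (\<Sum>j\<le>M. Poly_Mapping.lookup P (i,j) * y ^ j) * x ^ i)"
      by (simp add: sum_distrib_left sum_distrib_right mult_ac)
    finally show ?thesis .
  qed
  have inf: "infinite (of_nat ` {N..} :: real set)"
    by (metis finite_imageD infinite_Ici inj_of_nat inj_on_subset subset_UNIV)
  have van: "\<forall>i\<le>M. c i = 0" if van_asm: "\<And>a. a \<ge> N \<Longrightarrow> (\<Sum>i\<le>M. c i * of_nat a ^ i) = 0" for c :: "nat \<Rightarrow> rat"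
  proof (rule ccontr)
    assume "\<not> (\<forall>i\<le>M. c i = 0)"
    then obtain k where "k \<le> M" "c k \<noteq> 0" by auto
    then have "finite {z::real. (\<Sum>i\<le>M. of_rat (c i) * z ^ i) = 0}"
      by (subst polyfun_finite_roots) auto
    moreover have "(\<Sum>i\<le>M. of_rat (c i) * of_nat a ^ i) = (0::real)" if "a \<ge> N" for a
    proof -
      have "(\<Sum>i\<le>M. of_rat (c i) * of_nat a ^ i) = (of_rat (\<Sum>i\<le>M. c i * of_nat a ^ i) :: real)"
        by (simp add: of_rat_sum of_rat_mult of_rat_power)
      then show ?thesis using van_asm[OF that] by simp
    qed
    then have "of_nat ` {N..} \<subseteq> {z::real. (\<Sum>i\<le>M. of_rat (c i) * z ^ i) = 0}" by auto
    ultimately show False using inf finite_subset by blast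
  qed
  have "\<forall>i\<le>M. (\<Sum>j\<le>M. Poly_Mapping.lookup P (i,j) * of_nat b ^ j) = 0" if "b \<ge> N" for b
    by (rule van) (use assms that ev in auto)
  then have "\<forall>j\<le>M. Poly_Mapping.lookup P (i,j) = 0" if "i \<le> M" for i
    using that by (intro van) auto
  then have "Poly_Mapping.lookup P (i,j) = 0" for i j
    using K by (metis (no_types, lifting) SigmaD1 SigmaD2 atMost_iff in_keys_iff subset_iff)
  then show ?thesis by (intro poly_mapping_eqI) auto
qed

lemma bipoly_eval_diff:
  fixes P Q :: "'k::comm_ring_1 bipoly"
  shows "bipoly_eval (P - Q) x y = bipoly_eval P x y - bipoly_eval Q x y"
proof -
  let ?K = "Poly_Mapping.keys P \<union> Poly_Mapping.keys Q"
  have *: "bipoly_eval R x y = (\<Sum>(i,j)\<in>?K. Poly_Mapping.lookup R (i,j) * x ^ i * y ^ j)"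
    if "Poly_Mapping.keys R \<subseteq> ?K" for R :: "'k bipoly"
    unfolding bipoly_eval_def using that by (intro sum.mono_neutral_left) (auto simp: in_keys_iff)
  have "Poly_Mapping.keys (P - Q) \<subseteq> ?K" by (auto simp: in_keys_iff lookup_minus)
  from *[OF this] show ?thesis
    by (simp add: * lookup_minus left_diff_distrib sum_subtractf split_def)
qed

text \<open>This holds for the zero polynomial and every \<open>d\<close>, so its degree counts as \<open>-\<infinity>\<close>.\<close>

definition total_degree_less :: "'k::zero bipoly \<Rightarrow> nat \<Rightarrow> bool" where
  "total_degree_less P d \<longleftrightarrow> (\<forall>(i, j)\<in>Poly_Mapping.keys P. i + j < d)"

definition exponent_degree :: "('v \<Rightarrow>\<^sub>0 nat) \<Rightarrow> nat" where
  "exponent_degree \<alpha> = (\<Sum>v\<in>Poly_Mapping.keys \<alpha>. Poly_Mapping.lookup \<alpha> v)"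

definition tensor_scale :: "complex \<Rightarrow> ('m, 'n) tensor_ring \<Rightarrow> ('m, 'n) tensor_ring" where
  "tensor_scale c F = Poly_Mapping.single 0 c * F"

definition bigraded_part :: "nat \<Rightarrow> nat \<Rightarrow> ('m, 'n) tensor_ring set" where
  "bigraded_part p q =
     {F. \<forall>(\<alpha>, \<beta>)\<in>Poly_Mapping.keys F. exponent_degree \<alpha> = p \<and> exponent_degree \<beta> = q}"

definition coord_embed :: "'m coord_ring \<Rightarrow> ('m, 'n) tensor_ring" where
  "coord_embed P =
     (\<Sum>\<alpha>\<in>Poly_Mapping.keys P. Poly_Mapping.single (\<alpha>, 0) (Poly_Mapping.lookup P \<alpha>))"

definition weight_var :: "'n \<Rightarrow> ('m, 'n) tensor_ring" where
  "weight_var i = Poly_Mapping.single (0, Poly_Mapping.single i 1) 1"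


section \<open>Central arrangements\<close>

definition hyperplane :: "(complex ^ 'm \<Rightarrow> complex) \<Rightarrow> (complex ^ 'm) set" where
  "hyperplane h = {v. h v = 0}"

definition central_arrangement :: "('n::finite \<Rightarrow> complex ^ 'm::finite \<Rightarrow> complex) \<Rightarrow> bool" where
  "central_arrangement f \<longleftrightarrow>
     (\<forall>i. Vector_Spaces.linear (*s) (*) (f i) \<and> (\<exists>v. f i v \<noteq> 0)) \<and>
     inj (\<lambda>i. hyperplane (f i))"

definition subset_rank ::
    "('n::finite \<Rightarrow> complex ^ 'm::finite \<Rightarrow> complex) \<Rightarrow> 'n set \<Rightarrow> nat" where
  "subset_rank f X = CARD('m) - vec.dim (\<Inter>i\<in>X. hyperplane (f i))"

definition arrangement_rank :: "('n::finite \<Rightarrow> complex ^ 'm::finite \<Rightarrow> complex) \<Rightarrow> nat" where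
  "arrangement_rank f = subset_rank f UNIV"

text \<open>The matroid of the arrangement has the indices of the hyperplanes as its ground set and
  \<^const>\<open>subset_rank\<close> as its rank function.\<close>

definition tutte_polynomial ::
    "('n::finite \<Rightarrow> complex ^ 'm::finite \<Rightarrow> complex) \<Rightarrow> int bipoly" where
  "tutte_polynomial f =
     (\<Sum>X\<in>Pow UNIV.
        (Poly_Mapping.single (1, 0) 1 - 1) ^ (subset_rank f UNIV - subset_rank f X) *
        (Poly_Mapping.single (0, 1) 1 - 1) ^ (card X - subset_rank f X))"


section \<open>The logarithmic ideal\<close>

definition form_poly :: "(complex ^ 'm::finite \<Rightarrow> complex) \<Rightarrow> 'm coord_ring" where
  "form_poly h = (\<Sum>k\<in>UNIV. Poly_Mapping.single (Poly_Mapping.single k 1) (h (axis k 1)))"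

definition derivation :: "('m coord_ring \<Rightarrow> 'm coord_ring) \<Rightarrow> bool" where
  "derivation \<theta> \<longleftrightarrow>
     (\<forall>P Q. \<theta> (P + Q) = \<theta> P + \<theta> Q) \<and>
     (\<forall>c P. \<theta> (Poly_Mapping.single 0 c * P) = Poly_Mapping.single 0 c * \<theta> P) \<and>
     (\<forall>P Q. \<theta> (P * Q) = \<theta> P * Q + P * \<theta> Q)"

definition log_derivations ::
    "('n::finite \<Rightarrow> complex ^ 'm::finite \<Rightarrow> complex) \<Rightarrow> ('m coord_ring \<Rightarrow> 'm coord_ring) set" where
  "log_derivations f =
     {\<theta>. derivation \<theta> \<and> (\<Prod>i\<in>UNIV. form_poly (f i)) dvd \<theta> (\<Prod>i\<in>UNIV. form_poly (f i))}"

text \<open>A logarithmic derivation \<open>\<theta>\<close> satisfies \<open>\<theta>(f\<^sub>i) \<in> (f\<^sub>i)\<close> for every \<open>i\<close>, and the ring is a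
  domain. So there is exactly one family \<open>g\<close> as below, the family of the quotients
  \<open>g\<^sub>i = \<theta>(f\<^sub>i) / f\<^sub>i\<close>.\<close>

definition log_contractions ::
    "('n::finite \<Rightarrow> complex ^ 'm::finite \<Rightarrow> complex) \<Rightarrow> ('m, 'n) tensor_ring set" where
  "log_contractions f =
     {(\<Sum>i\<in>UNIV. weight_var i * coord_embed (g i)) | \<theta> g.
        \<theta> \<in> log_derivations f \<and> (\<forall>i. \<theta> (form_poly (f i)) = g i * form_poly (f i))}"

text \<open>The span of a set in a commutative ring, as a module over itself, is the ideal it
  generates.\<close>

definition log_ideal ::
    "('n::finite \<Rightarrow> complex ^ 'm::finite \<Rightarrow> complex) \<Rightarrow> ('m, 'n) tensor_ring set" where
  "log_ideal f = module.span (*) (log_contractions f)"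

definition is_hilbert_polynomial :: "('m, 'n) tensor_ring set \<Rightarrow> rat bipoly \<Rightarrow> bool" where
  "is_hilbert_polynomial I P \<longleftrightarrow>
     (\<exists>N. \<forall>a\<ge>N. \<forall>b\<ge>N. bipoly_eval P (of_nat a) (of_nat b) =
        of_nat (quotient_dim tensor_scale I (bigraded_part a b)))"

lemma is_hilbert_polynomial_unique:
  assumes "is_hilbert_polynomial I P" "is_hilbert_polynomial I Q"
  shows "P = Q"
proof -
  obtain N N' where
    N: "\<And>a b. a \<ge> N \<Longrightarrow> b \<ge> N \<Longrightarrow> bipoly_eval P (of_nat a) (of_nat b) =
        of_nat (quotient_dim tensor_scale I (bigraded_part a b))" and
    N': "\<And>a b. a \<ge> N' \<Longrightarrow> b \<ge> N' \<Longrightarrow> bipoly_eval Q (of_nat a) (of_nat b) =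
        of_nat (quotient_dim tensor_scale I (bigraded_part a b))"
    using assms unfolding is_hilbert_polynomial_def by blast
  have "P - Q = 0"
    by (rule bipoly_eq_0I[of "max N N'"]) (simp add: bipoly_eval_diff N N')
  then show ?thesis by simp
qed

end

theory Submission
  imports Defs "HOL-Computational_Algebra.Polynomial"
begin

text \<open>For a subspace \<open>U\<close> and a set \<open>E\<close> of indices consider the arrangement of the restrictions
  \<open>f\<^sub>i|U\<close>, \<open>i \<in> E\<close>. Both bounds on its Hilbert function \<open>h\<close> come from the same deletion-contraction
  inequality, for \<open>f\<^sub>n|U\<close> nonzero and in the span of the other forms:
  \<open>h(p, q) - h(p, q - 1)\<close> is compared with \<open>h'(p - 1, q) + h''(p, q)\<close>, where \<open>'\<close> is the deletion and
  \<open>''\<close> the restriction to the hyperplane \<open>f\<^sub>n = 0\<close>. This is the recursion \<open>T = T' + T''\<close> of the Tutte polynomial.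

  From above, divide \<open>S/I\<close> first by \<open>a\<^sub>n\<close> and then by \<open>f\<^sub>n\<close>: the ideals \<open>(I + (a\<^sub>n)) : f\<^sub>n\<close> and
  \<open>I + (a\<^sub>n, f\<^sub>n)\<close> contain the Euler and the cocircuit relations of the deletion and of the
  restriction. From below, the logarithmic ideal vanishes at the points \<open>(x, (f\<^sub>i(x) y\<^sub>i)\<^sub>i)\<close> with
  \<open>\<Sum>\<^sub>i y\<^sub>i f\<^sub>i = 0\<close>, and polynomials \<open>u\<^sub>1\<close>, \<open>u\<^sub>2\<close>, \<open>u\<^sub>3\<close> that are independent on these points for the
  arrangement, the deletion and the restriction give independent polynomials \<open>a\<^sub>n u\<^sub>1\<close>, \<open>f\<^sub>n u\<^sub>2\<close>,
  \<open>u\<^sub>3\<close>. The two bounds agree up to terms of lower order.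

  The Hilbert polynomial exists because \<open>h\<^sub>I(d) = h\<^bsub>I : z\<^esub>(d - deg z) + h\<^bsub>I + (z)\<^esub>(d)\<close> for every
  variable \<open>z\<close>: one may saturate \<open>I\<close> by one variable of each kind, and then both partial differences
  of \<open>h\<^sub>I\<close> are polynomial by induction on the number of variables.\<close>

text \<open>Logarithmic derivations are hard to follow through deletion and restriction. The
  induction therefore runs on both sides of the logarithmic ideal: above, over all graded ideals
  that contain the Euler and cocircuit relations; below, over polynomials vanishing on a
  parametrized set of points. Both sides pass to minors, and the logarithmic ideal enters only at
  the end.

  Minors are pairs of a subspace U of the fixed V and a subset E of the fixed index set, so ring and
  forms never change.

  The deletion appears at p - 1, whereas the Tutte recursion has no shift. Because the coefficients
  are nonnegative, the shift costs only a bounded translation of p: the upper bound raises p - 1 to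
  p, the lower bound is stated at p - card E. On every ray (s a, s b) both bounds have the same
  limit after division by s^(n - 2). The bounds alone do not give polynomiality, which is why the
  existence of the Hilbert polynomial is a separate argument.\<close>

lemma poly_mapping_sum_single:
  "F = (\<Sum>k\<in>Poly_Mapping.keys F. Poly_Mapping.single k (Poly_Mapping.lookup F k))"
  by (rule poly_mapping_eqI)
    (auto simp: lookup_sum lookup_single when_def in_keys_iff sum.delta')

lemma poly_mapping_single_induct [case_names zero single add]:
  fixes F :: "'a \<Rightarrow>\<^sub>0 'b::comm_monoid_add"
  assumes "P 0" "\<And>k c. P (Poly_Mapping.single k c)" "\<And>F G. P F \<Longrightarrow> P G \<Longrightarrow> P (F + G)"
  shows "P F"
proof -
  have "P (\<Sum>k\<in>K. Poly_Mapping.single k (Poly_Mapping.lookup F k))" if "finite K" for K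
    using that by (induction K) (use assms in auto)
  then show ?thesis by (subst poly_mapping_sum_single) simp
qed

section \<open>Ring homomorphisms out of monoid rings\<close>

locale poly_mapping_hom =
  fixes \<sigma> :: "'b::comm_semiring_1 \<Rightarrow> 'c::comm_semiring_1"
    and \<phi> :: "'a::comm_monoid_add \<Rightarrow> 'c"
  assumes \<sigma>_0: "\<sigma> 0 = 0" and \<sigma>_1: "\<sigma> 1 = 1" and \<sigma>_add: "\<And>a b. \<sigma> (a + b) = \<sigma> a + \<sigma> b"
    and \<sigma>_mult: "\<And>a b. \<sigma> (a * b) = \<sigma> a * \<sigma> b"
    and \<phi>_0: "\<phi> 0 = 1" and \<phi>_add: "\<And>k l. \<phi> (k + l) = \<phi> k * \<phi> l"
begin

text \<open>One construction serves four maps: evaluation of bivariate polynomials, evaluation of S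
  at points, the embedding of the coordinate ring in S, and the substitution y = 0 in the Tutte
  polynomial.\<close>

definition app :: "('a \<Rightarrow>\<^sub>0 'b) \<Rightarrow> 'c" where
  "app F = (\<Sum>k\<in>Poly_Mapping.keys F. \<sigma> (Poly_Mapping.lookup F k) * \<phi> k)"

lemma app_superset:
  "finite K \<Longrightarrow> Poly_Mapping.keys F \<subseteq> K \<Longrightarrow> app F = (\<Sum>k\<in>K. \<sigma> (Poly_Mapping.lookup F k) * \<phi> k)"
  unfolding app_def by (rule sum.mono_neutral_left) (auto simp: in_keys_iff \<sigma>_0)

lemma app_0: "app 0 = 0"
  by (simp add: app_def)

lemma app_single: "app (Poly_Mapping.single k c) = \<sigma> c * \<phi> k"
  by (subst app_superset[of "{k}"]) auto

lemma app_1: "app 1 = 1"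
  using app_single[of 0 1] by (simp add: \<sigma>_1 \<phi>_0)

lemma app_add: "app (F + G) = app F + app G"
proof -
  let ?K = "Poly_Mapping.keys F \<union> Poly_Mapping.keys G"
  have "app H = (\<Sum>k\<in>?K. \<sigma> (Poly_Mapping.lookup H k) * \<phi> k)" if "Poly_Mapping.keys H \<subseteq> ?K" for H
    using that by (intro app_superset) auto
  then show ?thesis using keys_add[of F G]
    by (simp add: lookup_add \<sigma>_add distrib_right sum.distrib)
qed

lemma app_sum: "app (sum F A) = (\<Sum>x\<in>A. app (F x))"
  by (induction A rule: infinite_finite_induct) (auto simp: app_0 app_add)

lemma app_mult: "app (F * G) = app F * app G"
proof (induction F rule: poly_mapping_single_induct)
  case (single k c)
  show ?case
    by (induction G rule: poly_mapping_single_induct)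
      (auto simp: mult_single app_single app_0 app_add distrib_left \<sigma>_mult \<phi>_add mult.assoc mult.left_commute)
qed (auto simp: app_0 app_add distrib_right)

lemma app_prod: "app (prod F A) = (\<Prod>x\<in>A. app (F x))"
  by (induction A rule: infinite_finite_induct) (auto simp: app_1 app_mult)

lemma app_power: "app (F ^ k) = app F ^ k"
  by (induction k) (auto simp: app_1 app_mult)

end

section \<open>Bigraded pieces\<close>

abbreviation cst :: "complex \<Rightarrow> ('m, 'n) tensor_ring" where
  "cst c \<equiv> Poly_Mapping.single 0 c"

lemma cst_add: "cst (a + b) = cst a + cst b" by (simp add: single_add)
lemma cst_mult: "cst (a * b) = cst a * cst b" by (simp add: mult_single)
lemma cst_uminus: "cst (- a) = - cst a" by (simp add: single_uminus)
lemma cst_diff: "cst (a - b) = cst a - cst b" by (simp add: single_diff)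

lemma exponent_degree_add: "exponent_degree (\<alpha> + \<beta>) = exponent_degree \<alpha> + exponent_degree \<beta>"
  unfolding exponent_degree_def by (rule setsum_keys_plus_distrib) auto

lemma exponent_degree_0 [simp]: "exponent_degree 0 = 0"
  by (simp add: exponent_degree_def)

lemma exponent_degree_single [simp]: "exponent_degree (Poly_Mapping.single v k) = k"
  by (simp add: exponent_degree_def)

lemma exponent_degree_eq_0_iff: "exponent_degree \<alpha> = 0 \<longleftrightarrow> \<alpha> = 0"
proof
  assume "exponent_degree \<alpha> = 0"
  then show "\<alpha> = 0"
    by (intro poly_mapping_eqI) (auto simp: exponent_degree_def in_keys_iff)
qed simp

text \<open>Integer degrees make the pieces of negative degree vanish, so that degree shifts need no side
  conditions.\<close>

definition gpart :: "int \<Rightarrow> int \<Rightarrow> ('m, 'n) tensor_ring set" where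
  "gpart p q = {F. \<forall>(\<alpha>, \<beta>)\<in>Poly_Mapping.keys F. int (exponent_degree \<alpha>) = p \<and> int (exponent_degree \<beta>) = q}"

lemma bigraded_part_eq: "bigraded_part p q = gpart (int p) (int q)"
  by (auto simp: bigraded_part_def gpart_def)

lemma gpart_0 [simp, intro]: "0 \<in> gpart p q"
  by (simp add: gpart_def)

lemma gpart_add: "F \<in> gpart p q \<Longrightarrow> G \<in> gpart p q \<Longrightarrow> F + G \<in> gpart p q"
  using keys_add[of F G] by (fastforce simp: gpart_def)

lemma gpart_mult:
  assumes "F \<in> gpart p q" "G \<in> gpart p' q'"
  shows "F * G \<in> gpart (p + p') (q + q')"
  unfolding gpart_def
proof safe
  fix \<alpha> \<beta> assume "(\<alpha>, \<beta>) \<in> Poly_Mapping.keys (F * G)"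
  then obtain a b where "a \<in> Poly_Mapping.keys F" "b \<in> Poly_Mapping.keys G" "(\<alpha>, \<beta>) = a + b"
    using keys_mult by fast
  then show "int (exponent_degree \<alpha>) = p + p'" "int (exponent_degree \<beta>) = q + q'"
    using assms by (cases a; cases b; fastforce simp: gpart_def exponent_degree_add plus_prod_def)+
qed

lemma gpart_single:
  "int (exponent_degree \<alpha>) = p \<Longrightarrow> int (exponent_degree \<beta>) = q \<Longrightarrow>
     Poly_Mapping.single (\<alpha>, \<beta>) c \<in> gpart p q"
  by (auto simp: gpart_def)

lemma gpart_cst [simp]: "cst c \<in> gpart 0 0"
  by (auto simp: gpart_def zero_prod_def)

lemma gpart_1 [simp]: "1 \<in> gpart 0 0"
  using gpart_cst[of 1] by simp

lemma gpart_scale: "F \<in> gpart p q \<Longrightarrow> cst c * F \<in> gpart p q"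
  using gpart_mult[OF gpart_cst] by fastforce

lemma gpart_uminus: "F \<in> gpart p q \<Longrightarrow> - F \<in> gpart p q"
  by (auto simp: gpart_def in_keys_iff)

lemma gpart_sum: "(\<And>x. x \<in> A \<Longrightarrow> F x \<in> gpart p q) \<Longrightarrow> sum F A \<in> gpart p q"
  by (induction A rule: infinite_finite_induct) (auto intro: gpart_add)

lemma gpart_prod: "(\<And>x. x \<in> A \<Longrightarrow> F x \<in> gpart 1 0) \<Longrightarrow> finite A \<Longrightarrow> prod F A \<in> gpart (int (card A)) 0"
proof (induction A rule: infinite_finite_induct)
  case (insert x A)
  then have "F x * prod F A \<in> gpart (1 + int (card A)) (0 + 0)" by (intro gpart_mult) auto
  then show ?case using insert by simp
qed auto

lemma gpart_neg:
  assumes "p < 0 \<or> q < 0" shows "gpart p q = {0}"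
proof (intro set_eqI iffI)
  fix F assume F: "F \<in> gpart p q"
  have "Poly_Mapping.keys F = {}"
  proof (rule ccontr)
    assume "Poly_Mapping.keys F \<noteq> {}"
    then obtain \<alpha> \<beta> where "(\<alpha>, \<beta>) \<in> Poly_Mapping.keys F" by (metis ex_in_conv surj_pair)
    then have "p \<ge> 0" "q \<ge> 0" using F by (fastforce simp: gpart_def)+
    then show False using assms by simp
  qed
  then show "F \<in> {0}" by (simp add: keys_eq_empty)
qed auto

lemma gpart_00:
  assumes "F \<in> gpart 0 0" obtains c where "F = cst c"
proof -
  have "Poly_Mapping.keys F \<subseteq> {0}"
    using assms by (force simp: gpart_def exponent_degree_eq_0_iff zero_prod_def)
  then have "F = cst (Poly_Mapping.lookup F 0)"
    by (intro poly_mapping_eqI) (auto simp: lookup_single when_def in_keys_iff)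
  then show ?thesis using that by blast
qed

lemma gpart_induct [consumes 1, case_names zero single add]:
  assumes "F \<in> gpart p q" "P 0"
    "\<And>\<alpha> \<beta> c. int (exponent_degree \<alpha>) = p \<Longrightarrow> int (exponent_degree \<beta>) = q \<Longrightarrow> P (Poly_Mapping.single (\<alpha>, \<beta>) c)"
    "\<And>F G. P F \<Longrightarrow> P G \<Longrightarrow> P (F + G)"
  shows "P F"
proof -
  have "P (\<Sum>k\<in>K. Poly_Mapping.single k (Poly_Mapping.lookup F k))"
    if "finite K" "K \<subseteq> Poly_Mapping.keys F" for K
    using that
  proof (induction K)
    case (insert k K)
    then have "P (Poly_Mapping.single k (Poly_Mapping.lookup F k))"
      using assms(1) by (cases k) (auto simp: gpart_def intro!: assms(3))
    then show ?case using insert assms(4) by simp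
  qed (use assms in auto)
  then show ?thesis by (subst poly_mapping_sum_single) simp
qed

definition coord_var :: "'m \<Rightarrow> ('m, 'n) tensor_ring" where
  "coord_var k = Poly_Mapping.single (Poly_Mapping.single k 1, 0) 1"

lemma coord_var_gpart [simp]: "coord_var k \<in> gpart 1 0"
  unfolding coord_var_def by (rule gpart_single) auto

lemma weight_var_gpart [simp]: "weight_var i \<in> gpart 0 1"
  unfolding weight_var_def by (rule gpart_single) auto

lemma exponent_split:
  assumes "exponent_degree \<alpha> > 0"
  obtains v \<alpha>' where "\<alpha> = Poly_Mapping.single v 1 + \<alpha>'" "exponent_degree \<alpha> = Suc (exponent_degree \<alpha>')"
proof -
  have "\<alpha> \<noteq> 0" using assms by auto
  then obtain v where v: "Poly_Mapping.lookup \<alpha> v \<noteq> 0" by (metis lookup_zero poly_mapping_eqI)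
  define \<alpha>' where "\<alpha>' = \<alpha> - Poly_Mapping.single v 1"
  have "\<alpha> = Poly_Mapping.single v 1 + \<alpha>'"
    unfolding \<alpha>'_def using v
    by (intro poly_mapping_eqI) (auto simp: lookup_add lookup_minus lookup_single when_def)
  moreover from this have "exponent_degree \<alpha> = Suc (exponent_degree \<alpha>')"
    by (metis exponent_degree_add exponent_degree_single plus_1_eq_Suc)
  ultimately show ?thesis using that by blast
qed

section \<open>Bases modulo a subspace\<close>

definition lincomb :: "(nat \<Rightarrow> complex) \<Rightarrow> ('m, 'n) tensor_ring list \<Rightarrow> ('m, 'n) tensor_ring" where
  "lincomb c us = (\<Sum>k<length us. cst (c k) * us ! k)"

definition span_mod :: "('m, 'n) tensor_ring set \<Rightarrow> ('m, 'n) tensor_ring list \<Rightarrow> ('m, 'n) tensor_ring set \<Rightarrow> bool" where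
  "span_mod W us U \<longleftrightarrow> (\<forall>u\<in>U. \<exists>c. u - lincomb c us \<in> W)"

definition indep_mod :: "('m, 'n) tensor_ring set \<Rightarrow> ('m, 'n) tensor_ring list \<Rightarrow> bool" where
  "indep_mod W us \<longleftrightarrow> (\<forall>c. lincomb c us \<in> W \<longrightarrow> (\<forall>k<length us. c k = 0))"

lemma lincomb_Nil [simp]: "lincomb c [] = 0"
  by (simp add: lincomb_def)

lemma lincomb_append:
  fixes us vs :: "('m, 'n) tensor_ring list"
  shows "lincomb c (us @ vs) = lincomb c us + lincomb (\<lambda>k. c (k + length us)) vs"
proof -
  have split: "(\<Sum>k<m + n. h k) = (\<Sum>k<m. h k) + (\<Sum>k<n. h (k + m))"
    for m n and h :: "nat \<Rightarrow> ('m, 'n) tensor_ring"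
    by (induction n) (auto simp: add_ac)
  have "lincomb c (us @ vs) = (\<Sum>k<length us. cst (c k) * (us @ vs) ! k)
      + (\<Sum>k<length vs. cst (c (k + length us)) * (us @ vs) ! (k + length us))"
    by (simp add: lincomb_def split)
  also have "\<dots> = lincomb c us + lincomb (\<lambda>k. c (k + length us)) vs"
    unfolding lincomb_def by (intro arg_cong2[of _ _ _ _ "(+)"] sum.cong) (auto simp: nth_append)
  finally show ?thesis .
qed

lemma lincomb_map_mult: "lincomb c (map ((*) g) us) = g * lincomb c us"
  by (simp add: lincomb_def sum_distrib_left mult_ac)

lemma lincomb_cong: "(\<And>k. k < length us \<Longrightarrow> c k = c' k) \<Longrightarrow> lincomb c us = lincomb c' us"
  by (simp add: lincomb_def)

lemma lincomb_zero: "(\<And>k. k < length us \<Longrightarrow> c k = 0) \<Longrightarrow> lincomb c us = 0"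
  by (simp add: lincomb_def)

lemma lincomb_scale: "lincomb (\<lambda>k. d * c k) us = cst d * lincomb c us"
  by (simp add: lincomb_def cst_mult sum_distrib_left mult.assoc)

lemma lincomb_gpart: "set us \<subseteq> gpart p q \<Longrightarrow> lincomb c us \<in> gpart p q"
  unfolding lincomb_def by (intro gpart_sum gpart_scale) auto

lemma append_coeffs:
  obtains e where "lincomb e (us @ vs) = lincomb c us + lincomb d vs"
proof
  let ?e = "\<lambda>k. if k < length us then c k else d (k - length us)"
  have "lincomb ?e us = lincomb c us" by (rule lincomb_cong) auto
  then show "lincomb ?e (us @ vs) = lincomb c us + lincomb d vs"
    by (simp add: lincomb_append)
qed

section \<open>Lists independent modulo a subspace and the dimension of the quotient\<close>

global_interpretation tensor: vector_space tensor_scale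
  by unfold_locales
    (auto simp: tensor_scale_def cst_add cst_mult distrib_left distrib_right mult.assoc)

lemma finite_exponents_degree: "finite {\<alpha> :: 'v::finite \<Rightarrow>\<^sub>0 nat. exponent_degree \<alpha> = d}"
proof (rule finite_imageD)
  show "inj_on Poly_Mapping.lookup {\<alpha> :: 'v \<Rightarrow>\<^sub>0 nat. exponent_degree \<alpha> = d}"
    by (simp add: inj_on_def lookup_inject)
  have le: "Poly_Mapping.lookup \<alpha> v \<le> exponent_degree \<alpha>" for \<alpha> :: "'v \<Rightarrow>\<^sub>0 nat" and v
  proof (cases "v \<in> Poly_Mapping.keys \<alpha>")
    case True
    then show ?thesis unfolding exponent_degree_def by (rule member_le_sum) simp_all
  next
    case False
    then have "Poly_Mapping.lookup \<alpha> v = 0" by (simp only: not_in_keys_iff_lookup_eq_zero)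
    then show ?thesis by simp
  qed
  have "Poly_Mapping.lookup ` {\<alpha> :: 'v \<Rightarrow>\<^sub>0 nat. exponent_degree \<alpha> = d}
      \<subseteq> {f. \<forall>v. (v \<in> UNIV \<longrightarrow> f v \<in> {..d}) \<and> (v \<notin> UNIV \<longrightarrow> f v = 0)}"
  proof (intro subsetI)
    fix f assume "f \<in> Poly_Mapping.lookup ` {\<alpha> :: 'v \<Rightarrow>\<^sub>0 nat. exponent_degree \<alpha> = d}"
    then obtain \<alpha> where "f = Poly_Mapping.lookup \<alpha>" "exponent_degree \<alpha> = d" by (rule imageE) simp
    then show "f \<in> {f. \<forall>v. (v \<in> UNIV \<longrightarrow> f v \<in> {..d}) \<and> (v \<notin> UNIV \<longrightarrow> f v = 0)}"
      using le[of \<alpha>] by simp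
  qed
  then show "finite (Poly_Mapping.lookup ` {\<alpha> :: 'v \<Rightarrow>\<^sub>0 nat. exponent_degree \<alpha> = d})"
    by (rule finite_subset) (intro finite_set_of_finite_funs finite finite_atMost)
qed

lemma gpart_finite_span:
  obtains X :: "('m::finite, 'n::finite) tensor_ring set" where "finite X" "gpart p q \<subseteq> tensor.span X"
proof -
  define K :: "(('m \<Rightarrow>\<^sub>0 nat) \<times> ('n \<Rightarrow>\<^sub>0 nat)) set"
    where "K = {\<alpha>. exponent_degree \<alpha> = nat p} \<times> {\<beta>. exponent_degree \<beta> = nat q}"
  define X :: "('m, 'n) tensor_ring set" where "X = (\<lambda>k. Poly_Mapping.single k 1) ` K"
  have "F \<in> tensor.span X" if F: "F \<in> gpart p q" for F
  proof -
    have "tensor_scale (Poly_Mapping.lookup F k) (Poly_Mapping.single k 1) \<in> tensor.span X"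
      if "k \<in> Poly_Mapping.keys F" for k
    proof -
      have "k \<in> K" using F that by (cases k) (auto simp: gpart_def K_def)
      then have "Poly_Mapping.single k 1 \<in> X" by (simp add: X_def)
      then show ?thesis by (rule tensor.span_scale[OF tensor.span_base])
    qed
    then have "(\<Sum>k\<in>Poly_Mapping.keys F. tensor_scale (Poly_Mapping.lookup F k) (Poly_Mapping.single k 1)) \<in> tensor.span X"
      by (rule tensor.span_sum)
    also have "(\<Sum>k\<in>Poly_Mapping.keys F. tensor_scale (Poly_Mapping.lookup F k) (Poly_Mapping.single k 1)) = F"
      using poly_mapping_sum_single[of F] by (simp add: tensor_scale_def mult_single)
    finally show ?thesis .
  qed
  moreover have "finite X"
    unfolding X_def K_def by (intro finite_imageI finite_cartesian_product finite_exponents_degree)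
  ultimately show ?thesis using that by blast
qed

lemma gpart_subspace: "tensor.subspace (gpart p q)"
  unfolding tensor.subspace_def tensor_scale_def by (auto intro: gpart_add gpart_scale)

lemma lincomb_set:
  assumes "distinct us"
  shows "lincomb (\<lambda>k. c (us ! k)) us = (\<Sum>b\<in>set us. tensor_scale (c b) b)"
proof -
  have "(\<Sum>b\<in>set us. tensor_scale (c b) b) = (\<Sum>k<length us. tensor_scale (c (us ! k)) (us ! k))"
    by (rule sum.reindex_bij_betw[OF bij_betw_nth[OF assms refl refl], symmetric])
  then show ?thesis by (simp add: lincomb_def tensor_scale_def)
qed

lemma indep_mod_distinct:
  assumes "indep_mod W us" "0 \<in> W"
  shows "distinct us"
proof (rule ccontr)
  assume "\<not> distinct us"
  then obtain i j where ij: "i < length us" "j < length us" "i \<noteq> j" "us ! i = us ! j"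
    by (auto simp: distinct_conv_nth)
  let ?c = "\<lambda>k. if k = i then 1 else if k = j then - 1 else 0 :: complex"
  have "lincomb ?c us = (\<Sum>k<length us. (if k = i then us ! i else 0) + (if k = j then - us ! j else 0))"
    unfolding lincomb_def using ij(3)
    by (intro sum.cong refl) (auto simp: cst_uminus)
  also have "\<dots> = 0" using ij by (simp add: sum.distrib)
  finally have "lincomb ?c us \<in> W" using assms(2) by simp
  then have "?c i = 0" using assms(1) ij(1) unfolding indep_mod_def by blast
  then show False by simp
qed

text \<open>Together with a basis of \<open>gpart p q \<inter> W\<close> the list stays linearly
  independent inside \<open>gpart p q\<close>; comparing cardinalities gives the bound.\<close>

lemma length_indep_le_quotient_dim:
  fixes W :: "('m::finite, 'n::finite) tensor_ring set"
  assumes W: "tensor.subspace W" and us: "set us \<subseteq> gpart p q" "indep_mod W us"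
  shows "length us \<le> quotient_dim tensor_scale W (gpart p q)"
proof -
  let ?G = "gpart p q :: ('m, 'n) tensor_ring set"
  obtain X :: "('m, 'n) tensor_ring set" where X: "finite X" "?G \<subseteq> tensor.span X"
    by (rule gpart_finite_span)
  obtain C where C: "C \<subseteq> ?G \<inter> W" "tensor.independent C" "?G \<inter> W \<subseteq> tensor.span C"
    "card C = tensor.dim (?G \<inter> W)"
    using tensor.basis_exists[of "?G \<inter> W"] by metis
  obtain D where D: "D \<subseteq> ?G" "tensor.independent D" "?G \<subseteq> tensor.span D" "card D = tensor.dim ?G"
    using tensor.basis_exists[of ?G] by metis
  have dist: "distinct us" by (rule indep_mod_distinct[OF us(2) tensor.subspace_0[OF W]])
  have CX: "C \<subseteq> tensor.span X" and DX: "D \<subseteq> tensor.span X" using C(1) D(1) X(2) by auto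
  have finC: "finite C" and finD: "finite D"
    using tensor.independent_span_bound[OF X(1) C(2) CX] tensor.independent_span_bound[OF X(1) D(2) DX]
    by auto
  have CW: "(\<Sum>x\<in>C. tensor_scale (g x) x) \<in> W" for g
    using C(1) by (intro tensor.subspace_sum[OF W] tensor.subspace_scale[OF W]) auto
  have zero: "g b = 0" if "(\<Sum>x\<in>set us. tensor_scale (g x) x) \<in> W" "b \<in> set us" for g b
  proof -
    have "lincomb (\<lambda>k. g (us ! k)) us \<in> W" using that(1) lincomb_set[OF dist] by metis
    then have "\<forall>k<length us. g (us ! k) = 0" using us(2) unfolding indep_mod_def by blast
    then show ?thesis using that(2) by (auto simp: in_set_conv_nth)
  qed
  have disj: "set us \<inter> C = {}"
  proof (rule ccontr)
    assume "set us \<inter> C \<noteq> {}"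
    then obtain b where b: "b \<in> set us" "b \<in> C" by auto
    have "(\<Sum>x\<in>set us. tensor_scale (if x = b then 1 else 0) x) = (\<Sum>x\<in>set us. if x = b then x else 0)"
      by (rule sum.cong) (auto simp: tensor_scale_def)
    also have "\<dots> = b" using b by simp
    finally show False using zero[of "\<lambda>x. if x = b then 1 else 0" b] b C(1) by auto
  qed
  have indep: "tensor.independent (set us \<union> C)"
  proof (rule tensor.independent_if_scalars_zero)
    show "finite (set us \<union> C)" using finC by simp
    fix g x assume g: "(\<Sum>x\<in>set us \<union> C. tensor_scale (g x) x) = 0" and x: "x \<in> set us \<union> C"
    have split: "(\<Sum>x\<in>set us. tensor_scale (g x) x) + (\<Sum>x\<in>C. tensor_scale (g x) x) = 0"
      using g by (simp only: sum.union_disjoint[OF finite_set finC disj])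
    then have "(\<Sum>x\<in>set us. tensor_scale (g x) x) = - (\<Sum>x\<in>C. tensor_scale (g x) x)"
      by (simp add: eq_neg_iff_add_eq_0)
    then have "(\<Sum>x\<in>set us. tensor_scale (g x) x) \<in> W"
      using tensor.subspace_neg[OF W CW] by simp
    then have gB: "\<And>b. b \<in> set us \<Longrightarrow> g b = 0" using zero by blast
    then have "(\<Sum>x\<in>C. tensor_scale (g x) x) = 0" using split by simp
    then have "\<And>x. x \<in> C \<Longrightarrow> g x = 0" using tensor.independentD[OF C(2) finC order_refl, of g] by blast
    then show "g x = 0" using gB x by auto
  qed
  have "set us \<union> C \<subseteq> tensor.span D" using us(1) C(1) D(3) by auto
  then have "card (set us \<union> C) \<le> card D"
    using tensor.independent_span_bound[OF finD indep] by auto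
  then have "length us + tensor.dim (?G \<inter> W) \<le> tensor.dim ?G"
    using card_Un_disjoint[OF finite_set finC disj] C(4) D(4) distinct_card[OF dist] by simp
  moreover have "quotient_dim tensor_scale W ?G + tensor.dim (?G \<inter> W) = tensor.dim ?G"
    using quotient_dim_add[OF tensor.vector_space_axioms gpart_subspace W X] .
  ultimately show ?thesis by linarith
qed

lemma quotient_dim_eqI:
  fixes W :: "('m::finite, 'n::finite) tensor_ring set"
  assumes W: "tensor.subspace W" and us: "set us \<subseteq> gpart p q" "span_mod W us (gpart p q)" "indep_mod W us"
  shows "quotient_dim tensor_scale W (gpart p q) = length us"
proof (rule antisym)
  let ?G = "gpart p q :: ('m, 'n) tensor_ring set"
  obtain X :: "('m, 'n) tensor_ring set" where X: "finite X" "?G \<subseteq> tensor.span X"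
    by (rule gpart_finite_span)
  obtain C where C: "C \<subseteq> ?G \<inter> W" "tensor.independent C" "?G \<inter> W \<subseteq> tensor.span C"
    "card C = tensor.dim (?G \<inter> W)"
    using tensor.basis_exists[of "?G \<inter> W"] by metis
  have "C \<subseteq> tensor.span X" using C(1) X(2) by auto
  then have finC: "finite C" using tensor.independent_span_bound[OF X(1) C(2)] by simp
  have "?G \<subseteq> tensor.span (C \<union> set us)"
  proof
    fix u assume u: "u \<in> ?G"
    then obtain c where "u - lincomb c us \<in> W" using us(2) unfolding span_mod_def by blast
    moreover have "u - lincomb c us \<in> ?G"
      by (rule tensor.subspace_diff[OF gpart_subspace u lincomb_gpart[OF us(1)]])
    ultimately have "u - lincomb c us \<in> tensor.span (C \<union> set us)"
      using C(3) tensor.span_mono[of C "C \<union> set us"] by blast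
    moreover have "lincomb c us \<in> tensor.span (C \<union> set us)"
      unfolding lincomb_def tensor_scale_def[symmetric]
      by (intro tensor.span_sum tensor.span_scale tensor.span_base) auto
    ultimately have "(u - lincomb c us) + lincomb c us \<in> tensor.span (C \<union> set us)"
      by (rule tensor.span_add)
    then show "u \<in> tensor.span (C \<union> set us)" by simp
  qed
  then have "tensor.dim ?G \<le> card (C \<union> set us)" by (rule tensor.dim_le_card) (use finC in simp)
  also have "\<dots> \<le> tensor.dim (?G \<inter> W) + length us"
    using card_Un_le[of C "set us"] card_length[of us] C(4) by linarith
  finally show "quotient_dim tensor_scale W ?G \<le> length us"
    using quotient_dim_add[OF tensor.vector_space_axioms gpart_subspace W X] by linarith
  show "length us \<le> quotient_dim tensor_scale W ?G"
    by (rule length_indep_le_quotient_dim[OF W us(1,3)])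
qed

text \<open>An independent list of greatest length spans, since otherwise a vector outside could be
  appended. A greatest length exists by \<open>length_indep_le_quotient_dim\<close>.\<close>

lemma quotient_dim_basis:
  fixes W :: "('m::finite, 'n::finite) tensor_ring set"
  assumes W: "tensor.subspace W"
  obtains us where "set us \<subseteq> gpart p q" "span_mod W us (gpart p q)" "indep_mod W us"
    "length us = quotient_dim tensor_scale W (gpart p q)"
proof -
  let ?P = "\<lambda>k. \<exists>us. set us \<subseteq> gpart p q \<and> indep_mod W us \<and> length us = k"
  have zero: "?P 0" by (auto simp: indep_mod_def)
  have bounded: "k \<le> quotient_dim tensor_scale W (gpart p q)" if "?P k" for k
    using that length_indep_le_quotient_dim[OF W] by auto
  have "?P (Greatest ?P)" using zero bounded by (rule GreatestI_nat)
  then obtain us where us: "set us \<subseteq> gpart p q" "indep_mod W us" "length us = Greatest ?P" by blast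
  have "span_mod W us (gpart p q)"
    unfolding span_mod_def
  proof (rule ballI, rule ccontr)
    fix u :: "('m, 'n) tensor_ring" assume u: "u \<in> gpart p q" and new: "\<nexists>c. u - lincomb c us \<in> W"
    have "indep_mod W (us @ [u])"
      unfolding indep_mod_def
    proof (intro allI impI)
      fix e k assume e: "lincomb e (us @ [u]) \<in> W" and k: "k < length (us @ [u])"
      let ?d = "e (length us)"
      have comb: "lincomb e (us @ [u]) = lincomb e us + cst ?d * u"
        unfolding lincomb_append by (simp add: lincomb_def)
      have d: "?d = 0"
      proof (rule ccontr)
        assume d0: "?d \<noteq> 0"
        have "u - lincomb (\<lambda>k. - (1 / ?d) * e k) us = cst (1 / ?d) * lincomb e us + cst (1 / ?d * ?d) * u"
          using d0 unfolding lincomb_scale by (simp add: cst_uminus)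
        also have "\<dots> = tensor_scale (1 / ?d) (lincomb e (us @ [u]))"
          unfolding comb tensor_scale_def cst_mult by (simp only: distrib_left mult.assoc)
        also have "\<dots> \<in> W" by (rule tensor.subspace_scale[OF W e])
        finally show False using new by blast
      qed
      then have "\<forall>k<length us. e k = 0" using e us(2) unfolding comb indep_mod_def by simp
      then show "e k = 0" using d k by (auto simp: less_Suc_eq)
    qed
    then have "?P (Suc (Greatest ?P))" using us(1,3) u by (intro exI[of _ "us @ [u]"]) auto
    then have "Suc (Greatest ?P) \<le> Greatest ?P" using bounded by (rule Greatest_le_nat)
    then show False by simp
  qed
  then show ?thesis using that us(1,2) quotient_dim_eqI[OF W us(1) _ us(2)] by metis
qed

section \<open>Graded ideals\<close>

type_synonym ('m, 'n) graded_family = "int \<Rightarrow> int \<Rightarrow> ('m, 'n) tensor_ring set"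

text \<open>A bihomogeneous ideal given by its pieces: \<open>adjoin\<close> and
  \<open>colon\<close> can then be formed degree by degree, without splitting elements into
  bihomogeneous parts. Scalars act through \<open>gpart 0 0\<close>.\<close>

definition graded_ideal :: "('m, 'n) graded_family \<Rightarrow> bool" where
  "graded_ideal I \<longleftrightarrow>
     (\<forall>p q. I p q \<subseteq> gpart p q \<and> 0 \<in> I p q \<and> (\<forall>u\<in>I p q. \<forall>v\<in>I p q. u + v \<in> I p q)) \<and>
     (\<forall>a b p q. \<forall>g\<in>gpart a b. \<forall>u\<in>I p q. g * u \<in> I (a + p) (b + q))"

definition adjoin :: "('m, 'n) graded_family \<Rightarrow> ('m, 'n) tensor_ring \<Rightarrow> int \<Rightarrow> int \<Rightarrow> ('m, 'n) graded_family" where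
  "adjoin I g a b = (\<lambda>p q. {w + g * s | w s. w \<in> I p q \<and> s \<in> gpart (p - a) (q - b)})"

definition colon :: "('m, 'n) graded_family \<Rightarrow> ('m, 'n) tensor_ring \<Rightarrow> int \<Rightarrow> int \<Rightarrow> ('m, 'n) graded_family" where
  "colon I g a b = (\<lambda>p q. {u \<in> gpart p q. g * u \<in> I (p + a) (q + b)})"

lemma graded_ideal_gpart: "graded_ideal I \<Longrightarrow> u \<in> I p q \<Longrightarrow> u \<in> gpart p q"
  unfolding graded_ideal_def by blast

lemma graded_ideal_0: "graded_ideal I \<Longrightarrow> 0 \<in> I p q"
  unfolding graded_ideal_def by blast

lemma graded_ideal_add: "graded_ideal I \<Longrightarrow> u \<in> I p q \<Longrightarrow> v \<in> I p q \<Longrightarrow> u + v \<in> I p q"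
  unfolding graded_ideal_def by blast

lemma graded_ideal_mult: "graded_ideal I \<Longrightarrow> g \<in> gpart a b \<Longrightarrow> u \<in> I p q \<Longrightarrow> g * u \<in> I (a + p) (b + q)"
  unfolding graded_ideal_def by blast

lemma graded_ideal_mult':
  "graded_ideal I \<Longrightarrow> g \<in> gpart a b \<Longrightarrow> u \<in> I p q \<Longrightarrow> a + p = p' \<Longrightarrow> b + q = q' \<Longrightarrow> g * u \<in> I p' q'"
  using graded_ideal_mult by blast

lemma graded_ideal_cst: "graded_ideal I \<Longrightarrow> u \<in> I p q \<Longrightarrow> cst c * u \<in> I p q"
  using graded_ideal_mult[OF _ gpart_cst] by fastforce

lemma graded_ideal_uminus: "graded_ideal I \<Longrightarrow> u \<in> I p q \<Longrightarrow> - u \<in> I p q"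
  using graded_ideal_cst[of I u p q "-1"] by (simp add: cst_uminus)

lemma graded_ideal_diff: "graded_ideal I \<Longrightarrow> u \<in> I p q \<Longrightarrow> v \<in> I p q \<Longrightarrow> u - v \<in> I p q"
  using graded_ideal_add[of I u p q "- v"] graded_ideal_uminus[of I v p q] by simp

lemma graded_ideal_sum: "graded_ideal I \<Longrightarrow> (\<And>x. x \<in> A \<Longrightarrow> F x \<in> I p q) \<Longrightarrow> sum F A \<in> I p q"
  by (induction A rule: infinite_finite_induct) (auto intro: graded_ideal_add graded_ideal_0)

lemma graded_ideal_subspace: "graded_ideal I \<Longrightarrow> tensor.subspace (I p q)"
  unfolding tensor.subspace_def tensor_scale_def
  by (auto intro: graded_ideal_add graded_ideal_0 graded_ideal_cst)

lemma graded_ideal_adjoin: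
  fixes I :: "('m, 'n) graded_family"
  assumes I: "graded_ideal I" and g: "g \<in> gpart a b"
  shows "graded_ideal (adjoin I g a b)"
  unfolding graded_ideal_def
proof (intro conjI allI ballI)
  fix p q
  show "adjoin I g a b p q \<subseteq> gpart p q"
  proof
    fix u assume "u \<in> adjoin I g a b p q"
    then obtain w s where u: "u = w + g * s" "w \<in> I p q" "s \<in> gpart (p - a) (q - b)"
      unfolding adjoin_def by blast
    show "u \<in> gpart p q" using gpart_add[OF graded_ideal_gpart[OF I u(2)]] gpart_mult[OF g u(3)] u(1) by simp
  qed
  show "0 \<in> adjoin I g a b p q"
    unfolding adjoin_def using graded_ideal_0[OF I] by (auto intro!: exI[of _ 0])
  fix u v assume "u \<in> adjoin I g a b p q" "v \<in> adjoin I g a b p q"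
  then obtain w s w' s' where u: "u = w + g * s" "w \<in> I p q" "s \<in> gpart (p - a) (q - b)"
    and v: "v = w' + g * s'" "w' \<in> I p q" "s' \<in> gpart (p - a) (q - b)"
    unfolding adjoin_def by blast
  have "u + v = (w + w') + g * (s + s')" using u v by (simp add: algebra_simps)
  then show "u + v \<in> adjoin I g a b p q"
    unfolding adjoin_def using graded_ideal_add[OF I u(2) v(2)] gpart_add[OF u(3) v(3)] by blast
next
  fix a' b' p q and h u :: "('m, 'n) tensor_ring" assume h: "h \<in> gpart a' b'" and "u \<in> adjoin I g a b p q"
  then obtain w s where u: "u = w + g * s" "w \<in> I p q" "s \<in> gpart (p - a) (q - b)"
    unfolding adjoin_def by blast
  have "h * u = h * w + g * (h * s)" using u by (simp add: algebra_simps)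
  moreover have "h * s \<in> gpart (a' + p - a) (b' + q - b)" using gpart_mult[OF h u(3)] by (simp add: algebra_simps)
  ultimately show "h * u \<in> adjoin I g a b (a' + p) (b' + q)"
    unfolding adjoin_def using graded_ideal_mult[OF I h u(2)] by blast
qed

lemma graded_ideal_colon:
  fixes I :: "('m, 'n) graded_family"
  assumes I: "graded_ideal I"
  shows "graded_ideal (colon I g a b)"
  unfolding graded_ideal_def
proof (intro conjI allI ballI)
  fix p q
  show "colon I g a b p q \<subseteq> gpart p q" "0 \<in> colon I g a b p q"
    unfolding colon_def using graded_ideal_0[OF I] by auto
  fix u v assume "u \<in> colon I g a b p q" "v \<in> colon I g a b p q"
  then show "u + v \<in> colon I g a b p q"
    unfolding colon_def using graded_ideal_add[OF I] by (auto simp: distrib_left intro: gpart_add)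
next
  fix a' b' p q and h u :: "('m, 'n) tensor_ring" assume h: "h \<in> gpart a' b'" and u: "u \<in> colon I g a b p q"
  then have "h * (g * u) \<in> I (a' + (p + a)) (b' + (q + b))"
    unfolding colon_def using graded_ideal_mult[OF I h] by blast
  then show "h * u \<in> colon I g a b (a' + p) (b' + q)"
    unfolding colon_def using gpart_mult[OF h] u by (simp add: colon_def mult.left_commute add.assoc)
qed

lemma adjoin_superset: "I \<le> adjoin I g a b"
  unfolding adjoin_def le_fun_def by (force intro: exI[of _ 0])

lemma adjoin_mono: "I \<le> I' \<Longrightarrow> adjoin I g a b \<le> adjoin I' g a b"
  unfolding adjoin_def le_fun_def by blast

lemma adjoin_mem:
  assumes "graded_ideal I" "g \<in> gpart a b"
  shows "g \<in> adjoin I g a b a b"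
proof -
  have "g = 0 + g * 1" "1 \<in> gpart (a - a) (b - b)" by simp_all
  then show ?thesis unfolding adjoin_def using graded_ideal_0[OF assms(1)] by blast
qed

lemma colon_superset:
  assumes "graded_ideal I" "g \<in> gpart a b"
  shows "I \<le> colon I g a b"
  unfolding colon_def le_fun_def using graded_ideal_gpart[OF assms(1)] graded_ideal_mult'[OF assms]
  by (auto simp: add.commute)

lemma colon_mono: "I \<le> I' \<Longrightarrow> colon I g a b \<le> colon I' g a b"
  unfolding colon_def le_fun_def by blast

section \<open>Hilbert functions of graded ideals\<close>

definition hdim :: "('m, 'n) graded_family \<Rightarrow> int \<Rightarrow> int \<Rightarrow> nat" where
  "hdim I p q = quotient_dim tensor_scale (I p q) (gpart p q)"

text \<open>The exact sequence 0 -> S/(I : g) -> S/I -> S/(I + (g)) -> 0 with first map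
  multiplication by g. A basis modulo I is g times a basis modulo I : g, followed by a basis modulo
  I + (g).\<close>

lemma hdim_split:
  fixes I :: "('m::finite, 'n::finite) graded_family"
  assumes I: "graded_ideal I" and g: "g \<in> gpart a b"
  shows "hdim I p q = hdim (colon I g a b) (p - a) (q - b) + hdim (adjoin I g a b) p q"
proof -
  note col = graded_ideal_colon[OF I, of g a b] and adj = graded_ideal_adjoin[OF I g]
  obtain us where us: "set us \<subseteq> gpart (p - a) (q - b)"
      "span_mod (colon I g a b (p - a) (q - b)) us (gpart (p - a) (q - b))"
      "indep_mod (colon I g a b (p - a) (q - b)) us"
      "length us = hdim (colon I g a b) (p - a) (q - b)"
    using quotient_dim_basis[OF graded_ideal_subspace[OF col]] unfolding hdim_def by metis
  obtain vs where vs: "set vs \<subseteq> gpart p q"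
      "span_mod (adjoin I g a b p q) vs (gpart p q)" "indep_mod (adjoin I g a b p q) vs"
      "length vs = hdim (adjoin I g a b) p q"
    using quotient_dim_basis[OF graded_ideal_subspace[OF adj]] unfolding hdim_def by metis
  let ?ws = "map ((*) g) us @ vs"
  have "set ?ws \<subseteq> gpart p q" using us(1) vs(1) gpart_mult[OF g] by fastforce
  moreover have "span_mod (I p q) ?ws (gpart p q)"
    unfolding span_mod_def
  proof
    fix u :: "('m, 'n) tensor_ring" assume "u \<in> gpart p q"
    then obtain d where "u - lincomb d vs \<in> adjoin I g a b p q" using vs(2) unfolding span_mod_def by blast
    then obtain w s where w: "u - lincomb d vs = w + g * s" "w \<in> I p q" "s \<in> gpart (p - a) (q - b)"
      unfolding adjoin_def by blast
    then obtain c where "s - lincomb c us \<in> colon I g a b (p - a) (q - b)"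
      using us(2) unfolding span_mod_def by blast
    then have c: "g * (s - lincomb c us) \<in> I p q" unfolding colon_def by simp
    obtain e where "lincomb e ?ws = lincomb c (map ((*) g) us) + lincomb d vs" by (rule append_coeffs)
    then have "u - lincomb e ?ws = w + g * (s - lincomb c us)"
      using w(1) by (simp add: lincomb_map_mult algebra_simps)
    then show "\<exists>e. u - lincomb e ?ws \<in> I p q" using graded_ideal_add[OF I w(2) c] by metis
  qed
  moreover have "indep_mod (I p q) ?ws"
    unfolding indep_mod_def
  proof (intro allI impI)
    fix e k assume "lincomb e ?ws \<in> I p q" and k: "k < length ?ws"
    let ?d = "\<lambda>k. e (k + length us)"
    have *: "g * lincomb e us + lincomb ?d vs \<in> I p q"
      using \<open>lincomb e ?ws \<in> I p q\<close> by (simp add: lincomb_append lincomb_map_mult)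
    have "lincomb ?d vs = (g * lincomb e us + lincomb ?d vs) + g * (- lincomb e us)" by simp
    moreover have "- lincomb e us \<in> gpart (p - a) (q - b)" by (intro gpart_uminus lincomb_gpart us)
    ultimately have "lincomb ?d vs \<in> adjoin I g a b p q" unfolding adjoin_def using * by blast
    then have d: "?d j = 0" if "j < length vs" for j using vs(3) that unfolding indep_mod_def by blast
    then have "lincomb ?d vs = 0" by (intro lincomb_zero) auto
    then have "lincomb e us \<in> colon I g a b (p - a) (q - b)"
      using * lincomb_gpart[OF us(1)] unfolding colon_def by simp
    then have e: "\<forall>j<length us. e j = 0" using us(3) unfolding indep_mod_def by blast
    show "e k = 0"
      using e d[of "k - length us"] k by (cases "k < length us") auto
  qed
  ultimately have "hdim I p q = length ?ws"
    unfolding hdim_def using quotient_dim_eqI[OF graded_ideal_subspace[OF I]] by blast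
  then show ?thesis using us(4) vs(4) by simp
qed

lemma hdim_mono:
  fixes I :: "('m::finite, 'n::finite) graded_family"
  assumes "graded_ideal I" "graded_ideal I'" "I \<le> I'"
  shows "hdim I' p q \<le> hdim I p q"
proof -
  obtain us where us: "set us \<subseteq> gpart p q" "indep_mod (I' p q) us" "length us = hdim I' p q"
    using quotient_dim_basis[OF graded_ideal_subspace[OF assms(2)]] unfolding hdim_def by metis
  have "indep_mod (I p q) us" using us(2) assms(3) unfolding indep_mod_def le_fun_def by blast
  from length_indep_le_quotient_dim[OF graded_ideal_subspace[OF assms(1)] us(1) this] us(3)
  show ?thesis by (simp add: hdim_def)
qed

lemma hdim_full:
  fixes I :: "('m::finite, 'n::finite) graded_family"
  assumes "graded_ideal I" "gpart p q \<subseteq> I p q"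
  shows "hdim I p q = 0"
proof -
  have "span_mod (I p q) [] (gpart p q)" "indep_mod (I p q) []"
    using assms(2) by (auto simp: span_mod_def indep_mod_def)
  then show ?thesis
    using quotient_dim_eqI[OF graded_ideal_subspace[OF assms(1)], where us = "[]"] by (simp add: hdim_def)
qed

lemma gpart_subset_coord_vars:
  fixes I :: "('m, 'n) graded_family"
  assumes I: "graded_ideal I" and var: "\<And>k. coord_var k \<in> I 1 0" and p: "p > 0"
  shows "gpart p q \<subseteq> I p q"
proof
  fix F :: "('m, 'n) tensor_ring" assume "F \<in> gpart p q"
  then show "F \<in> I p q"
  proof (induction rule: gpart_induct)
    case (single \<alpha> \<beta> c)
    obtain k \<alpha>' where \<alpha>: "\<alpha> = Poly_Mapping.single k 1 + \<alpha>'" "exponent_degree \<alpha> = Suc (exponent_degree \<alpha>')"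
      by (rule exponent_split[of \<alpha>]) (use single p in auto)
    have "Poly_Mapping.single (\<alpha>, \<beta>) c = Poly_Mapping.single (\<alpha>', \<beta>) c * coord_var k"
      by (simp add: coord_var_def mult_single \<alpha>(1) add.commute)
    also have "\<dots> \<in> I p q"
      by (rule graded_ideal_mult'[OF I gpart_single[OF refl refl] var]) (use single \<alpha>(2) in auto)
    finally show ?case .
  qed (auto intro: graded_ideal_0[OF I] graded_ideal_add[OF I])
qed

lemma gpart_subset_weight_vars:
  fixes I :: "('m, 'n) graded_family"
  assumes I: "graded_ideal I" and var: "\<And>k. weight_var k \<in> I 0 1" and p: "q > 0"
  shows "gpart p q \<subseteq> I p q"
proof
  fix F :: "('m, 'n) tensor_ring" assume "F \<in> gpart p q"
  then show "F \<in> I p q"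
  proof (induction rule: gpart_induct)
    case (single \<alpha> \<beta> c)
    obtain k \<beta>' where \<beta>: "\<beta> = Poly_Mapping.single k 1 + \<beta>'" "exponent_degree \<beta> = Suc (exponent_degree \<beta>')"
      by (rule exponent_split[of \<beta>]) (use single p in auto)
    have "Poly_Mapping.single (\<alpha>, \<beta>) c = Poly_Mapping.single (\<alpha>, \<beta>') c * weight_var k"
      by (simp add: weight_var_def mult_single \<beta>(1) add.commute)
    also have "\<dots> \<in> I p q"
      by (rule graded_ideal_mult'[OF I gpart_single[OF refl refl] var]) (use single \<beta>(2) in auto)
    finally show ?case .
  qed (auto intro: graded_ideal_0[OF I] graded_ideal_add[OF I])
qed

section \<open>Noetherianity\<close>

definition var :: "'m + 'n \<Rightarrow> ('m, 'n) tensor_ring" where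
  "var v = (case v of Inl k \<Rightarrow> coord_var k | Inr i \<Rightarrow> weight_var i)"

definition xdeg :: "'m + 'n \<Rightarrow> int" where "xdeg v = (case v of Inl _ \<Rightarrow> 1 | Inr _ \<Rightarrow> 0)"
definition adeg :: "'m + 'n \<Rightarrow> int" where "adeg v = (case v of Inl _ \<Rightarrow> 0 | Inr _ \<Rightarrow> 1)"

lemma var_gpart: "var v \<in> gpart (xdeg v) (adeg v)"
  by (cases v) (auto simp: var_def xdeg_def adeg_def)

abbreviation vcolon :: "'m + 'n \<Rightarrow> ('m, 'n) graded_family \<Rightarrow> ('m, 'n) graded_family" where
  "vcolon v I \<equiv> colon I (var v) (xdeg v) (adeg v)"

abbreviation vadjoin :: "'m + 'n \<Rightarrow> ('m, 'n) graded_family \<Rightarrow> ('m, 'n) graded_family" where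
  "vadjoin v I \<equiv> adjoin I (var v) (xdeg v) (adeg v)"

text \<open>Graded ideals of the polynomial ring in the variables Z, realized inside S by killing
  all other variables. \<open>vadjoin v\<close> removes v from Z, which makes an induction on the
  number of variables possible in one fixed ring.\<close>

definition ideals_over :: "('m + 'n) set \<Rightarrow> ('m, 'n) graded_family set" where
  "ideals_over Z = {I. graded_ideal I \<and> (\<forall>v. v \<notin> Z \<longrightarrow> var v \<in> I (xdeg v) (adeg v))}"

lemma ideals_over_vcolon: "I \<in> ideals_over Z \<Longrightarrow> vcolon v I \<in> ideals_over Z"
  unfolding ideals_over_def using graded_ideal_colon[of I] colon_superset[OF _ var_gpart[of v], of I]
  unfolding le_fun_def by blast

lemma ideals_over_vadjoin: "I \<in> ideals_over Z \<Longrightarrow> vadjoin v I \<in> ideals_over (Z - {v})"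
  unfolding ideals_over_def using graded_ideal_adjoin[OF _ var_gpart[of v], of I]
    adjoin_superset[of I "var v" "xdeg v" "adeg v"] adjoin_mem[OF _ var_gpart[of v], of I]
  unfolding le_fun_def by blast

lemma ideals_over_vcolon_funpow: "I \<in> ideals_over Z \<Longrightarrow> (vcolon v ^^ t) I \<in> ideals_over Z"
  by (induction t) (auto intro: ideals_over_vcolon)

lemma vcolon_superset: "I \<in> ideals_over Z \<Longrightarrow> I \<le> vcolon v I"
  unfolding ideals_over_def using colon_superset[OF _ var_gpart[of v]] by blast

lemma vcolon_funpow_mono: "I \<le> I' \<Longrightarrow> (vcolon v ^^ t) I \<le> (vcolon v ^^ t) I'"
  by (induction t) (auto intro: colon_mono)

text \<open>The point is that S does not depend on t. The diagonal is constant from some T on; for t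
  at least T the entry is squeezed between \<open>L T T\<close> and a later diagonal entry, and the
  finitely many t below T are treated one by one.\<close>

lemma double_sequence_stabilizes:
  fixes L :: "nat \<Rightarrow> nat \<Rightarrow> 'x::order"
  assumes acc: "\<And>f :: nat \<Rightarrow> 'x. mono f \<Longrightarrow> range f \<subseteq> G \<Longrightarrow> \<exists>k. \<forall>n\<ge>k. f n = f k"
    and G: "\<And>s t. L s t \<in> G"
    and mono: "\<And>s s' t t'. s \<le> s' \<Longrightarrow> t \<le> t' \<Longrightarrow> L s t \<le> L s' t'"
  shows "\<exists>S. \<forall>s\<ge>S. \<forall>t. L s t = L S t"
proof -
  have "\<exists>k. \<forall>n\<ge>k. L n n = L k k"
    by (rule acc) (auto intro!: monoI mono G)
  then obtain T where T: "\<And>n. n \<ge> T \<Longrightarrow> L n n = L T T" by blast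
  have "\<forall>t. \<exists>k. \<forall>s\<ge>k. L s t = L k t"
    by (intro allI acc) (auto intro!: monoI mono G)
  then obtain K where K: "\<And>t s. s \<ge> K t \<Longrightarrow> L s t = L (K t) t" by metis
  define S where "S = T + (\<Sum>t<T. K t)"
  have "L s t = L S t" if "s \<ge> S" for s t
  proof (cases "t < T")
    case True
    then have "K t \<le> (\<Sum>t<T. K t)" by (intro member_le_sum) auto
    then have "s \<ge> K t" "S \<ge> K t" using that by (auto simp: S_def)
    then show ?thesis using K[of t s] K[of t S] by simp
  next
    case False
    have "L r t = L T T" if r: "r \<ge> S" for r
    proof (rule order_antisym)
      have "L r t \<le> L (max r t) (max r t)" by (rule mono) auto
      also have "\<dots> = L T T" using r by (intro T) (auto simp: S_def)
      finally show "L r t \<le> L T T" .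
      show "L T T \<le> L r t" using r False by (intro mono) (auto simp: S_def)
    qed
    then show ?thesis using that by simp
  qed
  then show ?thesis by blast
qed

text \<open>\<open>(vcolon v ^^ t) I\<close> is I : v^t. Modulo v, an element u of I' : v^t agrees
  with some w of I : v^t, and u - w = v s with s in I' : v^(t+1) of total degree one less. The
  induction on the degree therefore runs for all t simultaneously.\<close>

lemma ideals_over_leI:
  fixes I I' :: "('m, 'n) graded_family"
  assumes I: "I \<in> ideals_over Z" and I': "I' \<in> ideals_over Z" and le: "I \<le> I'"
    and eq: "\<And>t. vadjoin v ((vcolon v ^^ t) I') = vadjoin v ((vcolon v ^^ t) I)"
  shows "I' \<le> I"
proof -
  have gr: "graded_ideal ((vcolon v ^^ t) I)" "graded_ideal ((vcolon v ^^ t) I')" for t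
    using ideals_over_vcolon_funpow I I' unfolding ideals_over_def by blast+
  have key: "u \<in> (vcolon v ^^ t) I p q" if "p + q < int d" "u \<in> (vcolon v ^^ t) I' p q" for d t p q u
    using that
  proof (induction d arbitrary: t p q u)
    case 0
    then have "gpart p q = ({0} :: ('m, 'n) tensor_ring set)" by (intro gpart_neg) auto
    then have "u = 0" using graded_ideal_gpart[OF gr(2) 0(2)] by simp
    then show ?case using graded_ideal_0[OF gr(1)] by simp
  next
    case (Suc d)
    have "u \<in> vadjoin v ((vcolon v ^^ t) I') p q"
      using adjoin_superset Suc.prems(2) unfolding le_fun_def by blast
    then obtain w s where w: "u = w + var v * s" "w \<in> (vcolon v ^^ t) I p q"
      and s: "s \<in> gpart (p - xdeg v) (q - adeg v)"
      unfolding eq unfolding adjoin_def by blast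
    have "w \<in> (vcolon v ^^ t) I' p q" using vcolon_funpow_mono[OF le] w(2) unfolding le_fun_def by blast
    then have "var v * s \<in> (vcolon v ^^ t) I' p q"
      using graded_ideal_diff[OF gr(2) Suc.prems(2)] w(1) by fastforce
    then have "s \<in> (vcolon v ^^ Suc t) I' (p - xdeg v) (q - adeg v)"
      using s by (simp add: colon_def)
    moreover have "p - xdeg v + (q - adeg v) < int d"
      using Suc.prems(1) by (cases v) (auto simp: xdeg_def adeg_def)
    ultimately have "s \<in> (vcolon v ^^ Suc t) I (p - xdeg v) (q - adeg v)" by (intro Suc.IH)
    then have "var v * s \<in> (vcolon v ^^ t) I p q" by (simp add: colon_def)
    then show ?case using graded_ideal_add[OF gr(1) w(2)] w(1) by simp
  qed
  show ?thesis
  proof (rule le_funI, rule le_funI, rule subsetI)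
    fix p q u assume "u \<in> I' p q"
    then show "u \<in> I p q"
      using key[where p = p and q = q and d = "nat (p + q + 1)" and t = 0 and u = u] by simp
  qed
qed

text \<open>These ideals contain everything of positive degree, so only degree \<open>(0, 0)\<close> can distinguish
  two of them.\<close>

lemma ideals_over_empty:
  assumes I: "I \<in> ideals_over {}" and I': "I' \<in> ideals_over {}" and 1: "1 \<in> I' 0 0 \<Longrightarrow> 1 \<in> I 0 0"
  shows "I' \<le> I"
proof -
  have gr: "graded_ideal I" "graded_ideal I'" and v: "var v \<in> I (xdeg v) (adeg v)" for v
    using I I' unfolding ideals_over_def by blast+
  have x: "coord_var k \<in> I 1 0" and a: "weight_var i \<in> I 0 1" for k i
    using v[of "Inl k"] v[of "Inr i"] by (auto simp: var_def xdeg_def adeg_def)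
  have "u \<in> I p q" if u: "u \<in> I' p q" for p q u
  proof -
    have ug: "u \<in> gpart p q" using graded_ideal_gpart[OF gr(2) u] .
    consider "p > 0" | "q > 0" | "p < 0 \<or> q < 0" | "p = 0" "q = 0" by linarith
    then show ?thesis
    proof cases
      case 1
      then show ?thesis using gpart_subset_coord_vars[OF gr(1) x] ug by blast
    next
      case 2
      then show ?thesis using gpart_subset_weight_vars[OF gr(1) a] ug by blast
    next
      case 3
      have "u = 0" using ug unfolding gpart_neg[OF 3] by simp
      then show ?thesis using graded_ideal_0[OF gr(1)] by simp
    next
      case 4
      then obtain c where c: "u = cst c" using gpart_00 ug by metis
      show ?thesis
      proof (cases "c = 0")
        case True
        then show ?thesis using c graded_ideal_0[OF gr(1)] by simp
      next
        case False
        have "cst (1 / c) * u \<in> I' 0 0" using graded_ideal_cst[OF gr(2) u] 4 by simp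
        then have "1 \<in> I' 0 0" using c False by (simp add: mult_single)
        then have "cst c * 1 \<in> I 0 0" using 1 graded_ideal_cst[OF gr(1)] by blast
        then show ?thesis using c 4 by simp
      qed
    qed
  qed
  then show ?thesis unfolding le_fun_def by blast
qed

text \<open>A graded form of Hilbert's basis theorem. The layers (f s : v^t) + (v) involve one
  variable less, grow in both s and t, and determine \<open>f s\<close> within the chain by
  \<open>ideals_over_leI\<close>.\<close>

lemma ideals_over_acc:
  fixes f :: "nat \<Rightarrow> ('m, 'n) graded_family"
  assumes "finite Z" "mono f" "range f \<subseteq> ideals_over Z"
  shows "\<exists>k. \<forall>n\<ge>k. f n = f k"
  using assms
proof (induction Z arbitrary: f rule: finite_induct)
  case empty
  have over: "f n \<in> ideals_over {}" for n using empty by blast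
  have mono: "f m \<le> f n" if "m \<le> n" for m n using empty(1) that by (rule monoD)
  \<comment> \<open>Either no member of the chain contains 1, or k is the index of one that
    does.\<close>
  obtain k where k: "\<And>n. 1 \<in> f n 0 0 \<Longrightarrow> 1 \<in> f k 0 0"
    by metis
  have "f n = f k" if "n \<ge> k" for n
    using ideals_over_empty[OF over over k] mono[OF that] by (intro order_antisym) auto
  then show ?case by blast
next
  case (insert v Z)
  have over: "f n \<in> ideals_over (insert v Z)" for n using insert.prems by blast
  have mono: "f m \<le> f n" if "m \<le> n" for m n using insert.prems(1) that by (rule monoD)
  define L where "L s t = vadjoin v ((vcolon v ^^ t) (f s))" for s t
  have "\<exists>S. \<forall>s\<ge>S. \<forall>t. L s t = L S t"
  proof (rule double_sequence_stabilizes[where G = "ideals_over Z"])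
    show "\<exists>k. \<forall>n\<ge>k. g n = g k" if "mono g" "range g \<subseteq> ideals_over Z" for g :: "nat \<Rightarrow> ('m, 'n) graded_family"
      using insert.IH that by blast
    show "L s t \<in> ideals_over Z" for s t
      using ideals_over_vadjoin[where v = v, OF ideals_over_vcolon_funpow[OF over]] insert.hyps(2)
      unfolding L_def by simp
    fix s s' t t' :: nat assume "s \<le> s'" "t \<le> t'"
    have "(vcolon v ^^ t) (f s') \<le> (vcolon v ^^ t') (f s')"
      using \<open>t \<le> t'\<close>
    proof (induction rule: dec_induct)
      case (step n)
      then show ?case
        using vcolon_superset[OF ideals_over_vcolon_funpow[OF over]] by (auto intro: order_trans)
    qed simp
    then show "L s t \<le> L s' t'"
      unfolding L_def using vcolon_funpow_mono[OF mono[OF \<open>s \<le> s'\<close>], where v = v and t = t]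
      by (intro adjoin_mono) (auto intro: order_trans)
  qed
  then obtain S where S: "\<And>s t. s \<ge> S \<Longrightarrow> L s t = L S t" by blast
  have "f n = f S" if "n \<ge> S" for n
    using ideals_over_leI[OF over over mono[OF that], where v = v] S[OF that] mono[OF that]
    unfolding L_def by (intro order_antisym) auto
  then show ?case by blast
qed

lemma vcolon_saturates:
  fixes I :: "('m, 'n) graded_family"
  assumes "finite Z" "I \<in> ideals_over Z"
  obtains t where "vcolon v ((vcolon v ^^ t) I) = (vcolon v ^^ t) I"
proof -
  have "\<exists>k. \<forall>n\<ge>k. (vcolon v ^^ n) I = (vcolon v ^^ k) I"
  proof (rule ideals_over_acc[OF assms(1)])
    show "mono (\<lambda>n. (vcolon v ^^ n) I)"
      using vcolon_superset[OF ideals_over_vcolon_funpow[OF assms(2)]]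
      by (intro mono_iff_le_Suc[THEN iffD2]) simp
    show "range (\<lambda>n. (vcolon v ^^ n) I) \<subseteq> ideals_over Z"
      using ideals_over_vcolon_funpow[OF assms(2)] by blast
  qed
  then obtain k where "\<And>n. n \<ge> k \<Longrightarrow> (vcolon v ^^ n) I = (vcolon v ^^ k) I" by blast
  from this[of "Suc k"] show ?thesis using that[of k] by simp
qed

section \<open>The Hilbert polynomial of a graded ideal\<close>

context
  fixes x y :: "'k::comm_ring_1"
begin

interpretation bp: poly_mapping_hom "\<lambda>c :: 'k. c" "\<lambda>(i, j). x ^ i * y ^ j"
  by unfold_locales (auto simp: power_add split_def zero_prod_def plus_prod_def mult_ac)

lemma bipoly_eval_conv_app: "bipoly_eval P x y = bp.app P"
  unfolding bipoly_eval_def bp.app_def by (rule sum.cong) (auto simp: mult.assoc)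

lemma bipoly_eval_0 [simp]: "bipoly_eval (0 :: 'k bipoly) x y = 0"
  by (simp add: bipoly_eval_conv_app bp.app_0)

lemma bipoly_eval_add: "bipoly_eval (P + Q) x y = bipoly_eval P x y + bipoly_eval Q x y"
  by (simp add: bipoly_eval_conv_app bp.app_add)

lemma bipoly_eval_mult: "bipoly_eval (P * Q) x y = bipoly_eval P x y * bipoly_eval Q x y"
  by (simp add: bipoly_eval_conv_app bp.app_mult)

lemma bipoly_eval_sum: "bipoly_eval (sum P A) x y = (\<Sum>a\<in>A. bipoly_eval (P a) x y)"
  by (simp add: bipoly_eval_conv_app bp.app_sum)

lemma bipoly_eval_single: "bipoly_eval (Poly_Mapping.single (i, j) c) x y = c * x ^ i * y ^ j"
  by (simp add: bipoly_eval_conv_app bp.app_single mult.assoc)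

end

section \<open>Polynomial functions of two variables and their antidifferences\<close>

definition bipoly_fun :: "(rat \<Rightarrow> rat \<Rightarrow> rat) \<Rightarrow> bool" where
  "bipoly_fun f \<longleftrightarrow> (\<exists>P. \<forall>x y. f x y = bipoly_eval P x y)"

lemma bipoly_fun_const: "bipoly_fun (\<lambda>x y. c)"
  unfolding bipoly_fun_def by (rule exI[of _ "Poly_Mapping.single (0, 0) c"]) (simp add: bipoly_eval_single)

lemma bipoly_fun_x: "bipoly_fun (\<lambda>x y. x)"
  unfolding bipoly_fun_def by (rule exI[of _ "Poly_Mapping.single (1, 0) 1"]) (simp add: bipoly_eval_single)

lemma bipoly_fun_y: "bipoly_fun (\<lambda>x y. y)"
  unfolding bipoly_fun_def by (rule exI[of _ "Poly_Mapping.single (0, 1) 1"]) (simp add: bipoly_eval_single)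

lemma bipoly_fun_add: "bipoly_fun f \<Longrightarrow> bipoly_fun g \<Longrightarrow> bipoly_fun (\<lambda>x y. f x y + g x y)"
  unfolding bipoly_fun_def by (metis bipoly_eval_add)

lemma bipoly_fun_mult: "bipoly_fun f \<Longrightarrow> bipoly_fun g \<Longrightarrow> bipoly_fun (\<lambda>x y. f x y * g x y)"
  unfolding bipoly_fun_def by (metis bipoly_eval_mult)

lemma bipoly_fun_diff: "bipoly_fun f \<Longrightarrow> bipoly_fun g \<Longrightarrow> bipoly_fun (\<lambda>x y. f x y - g x y)"
  unfolding bipoly_fun_def by (metis bipoly_eval_diff)

lemma bipoly_fun_power: "bipoly_fun f \<Longrightarrow> bipoly_fun (\<lambda>x y. f x y ^ k)"
  by (induction k) (auto intro: bipoly_fun_const bipoly_fun_mult)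

lemma bipoly_fun_sum: "(\<And>a. a \<in> A \<Longrightarrow> bipoly_fun (f a)) \<Longrightarrow> bipoly_fun (\<lambda>x y. \<Sum>a\<in>A. f a x y)"
  by (induction A rule: infinite_finite_induct) (auto intro: bipoly_fun_const bipoly_fun_add)

lemma bipoly_fun_compose:
  assumes "bipoly_fun f" and u: "bipoly_fun u" and v: "bipoly_fun v"
  shows "bipoly_fun (\<lambda>x y. f (u x y) (v x y))"
proof -
  obtain P where P: "f = bipoly_eval P" using assms(1) unfolding bipoly_fun_def by blast
  have "bipoly_fun (\<lambda>x y. bipoly_eval P (u x y) (v x y))"
  proof (induction P rule: poly_mapping_single_induct)
    case (single k c)
    obtain i j where "k = (i, j)" by (cases k)
    then show ?case
      by (auto simp: bipoly_eval_single intro!: bipoly_fun_mult bipoly_fun_power bipoly_fun_const u v)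
  qed (auto simp: bipoly_eval_add intro: bipoly_fun_const bipoly_fun_add)
  then show ?thesis by (simp add: P)
qed

text \<open>The difference of x^(i+1) is (i+1) x^i plus lower powers, whose antidifferences
  \<open>A k\<close> are known by induction; subtracting them and dividing by i+1 gives the
  witness.\<close>

lemma power_antidifference:
  "\<exists>f. bipoly_fun f \<and> (\<forall>x y. f (x + 1) y - f x y = x ^ i)"
proof (induction i rule: less_induct)
  case (less i)
  then obtain A where A: "\<And>k. k < i \<Longrightarrow> bipoly_fun (A k)"
    "\<And>k x y. k < i \<Longrightarrow> A k (x + 1) y - A k x y = x ^ k" by metis
  let ?f = "\<lambda>x y. (x ^ Suc i - (\<Sum>k<i. of_nat (Suc i choose k) * A k x y)) * (1 / of_nat (Suc i))"
  have "?f (x + 1) y - ?f x y = x ^ i" for x y :: rat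
  proof -
    have "(\<Sum>k<i. of_nat (Suc i choose k) * A k (x + 1) y) - (\<Sum>k<i. of_nat (Suc i choose k) * A k x y)
        = (\<Sum>k<i. of_nat (Suc i choose k) * x ^ k)"
      using A(2) by (simp flip: sum_subtractf right_diff_distrib)
    moreover have "(x + 1) ^ Suc i = (\<Sum>k\<le>Suc i. of_nat (Suc i choose k) * x ^ k)"
      using binomial_ring[of x 1 "Suc i"] by simp
    moreover have "\<dots> = (\<Sum>k<i. of_nat (Suc i choose k) * x ^ k) + of_nat (Suc i) * x ^ i + x ^ Suc i"
      by (simp add: lessThan_Suc_atMost[symmetric] del: of_nat_Suc)
    ultimately have "(x + 1) ^ Suc i - (\<Sum>k<i. of_nat (Suc i choose k) * A k (x + 1) y)
        - (x ^ Suc i - (\<Sum>k<i. of_nat (Suc i choose k) * A k x y)) = of_nat (Suc i) * x ^ i"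
      by (simp only: algebra_simps)
    then show ?thesis by (simp only: left_diff_distrib[symmetric]) simp
  qed
  moreover have "bipoly_fun ?f"
    by (intro bipoly_fun_mult bipoly_fun_diff bipoly_fun_power bipoly_fun_sum bipoly_fun_const bipoly_fun_x A(1)) auto
  ultimately show ?case by blast
qed

lemma bipoly_fun_antidifference_x:
  assumes "bipoly_fun f"
  obtains g where "bipoly_fun g" "\<And>x y. g (x + 1) y - g x y = f x y"
proof -
  obtain P where P: "f = bipoly_eval P" using assms unfolding bipoly_fun_def by blast
  have "\<exists>g. bipoly_fun g \<and> (\<forall>x y. g (x + 1) y - g x y = bipoly_eval P x y)"
  proof (induction P rule: poly_mapping_single_induct)
    case zero
    show ?case using bipoly_fun_const[of 0] by auto
  next
    case (single k c)
    obtain i j where k: "k = (i, j)" by (cases k)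
    obtain A where A: "bipoly_fun A" "\<And>x y. A (x + 1) y - A x y = x ^ i"
      using power_antidifference by blast
    have "bipoly_fun (\<lambda>x y. A x y * (c * y ^ j))"
      by (intro bipoly_fun_mult bipoly_fun_power bipoly_fun_const bipoly_fun_y A(1))
    moreover have "A (x + 1) y * (c * y ^ j) - A x y * (c * y ^ j) = bipoly_eval (Poly_Mapping.single k c) x y" for x y
      unfolding left_diff_distrib[symmetric] A(2) by (simp add: k bipoly_eval_single)
    ultimately show ?case by blast
  next
    case (add P Q)
    then obtain g h where "bipoly_fun g" "bipoly_fun h"
      "\<And>x y. g (x + 1) y - g x y = bipoly_eval P x y" "\<And>x y. h (x + 1) y - h x y = bipoly_eval Q x y" by blast
    then show ?case
      by (intro exI[of _ "\<lambda>x y. g x y + h x y"]) (auto intro!: bipoly_fun_add simp: bipoly_eval_add add_diff_add)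
  qed
  then show ?thesis using that P by blast
qed

lemma bipoly_fun_swap: "bipoly_fun f \<Longrightarrow> bipoly_fun (\<lambda>x y. f y x)"
  by (rule bipoly_fun_compose[OF _ bipoly_fun_y bipoly_fun_x])

lemma bipoly_fun_antidifference_y:
  assumes "bipoly_fun f"
  obtains g where "bipoly_fun g" "\<And>x y. g x (y + 1) - g x y = f x y"
proof -
  obtain g where "bipoly_fun g" "\<And>x y. g (x + 1) y - g x y = f y x"
    using bipoly_fun_antidifference_x[OF bipoly_fun_swap[OF assms]] by blast
  then show ?thesis using that[of "\<lambda>x y. g y x"] bipoly_fun_swap by blast
qed

definition eventually_bipoly :: "(int \<Rightarrow> int \<Rightarrow> nat) \<Rightarrow> bool" where
  "eventually_bipoly h \<longleftrightarrow> (\<exists>f N. bipoly_fun f \<and> (\<forall>p\<ge>N. \<forall>q\<ge>N. of_nat (h p q) = f (of_int p) (of_int q)))"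

lemma eventually_bipoly_eventually_0: "(\<And>p q. p > 0 \<Longrightarrow> q > 0 \<Longrightarrow> h p q = 0) \<Longrightarrow> eventually_bipoly h"
  unfolding eventually_bipoly_def by (intro exI[of _ "\<lambda>x y. 0"] exI[of _ 1]) (auto intro: bipoly_fun_const)

lemma eventually_bipoly_shift_add:
  assumes "eventually_bipoly h1" "eventually_bipoly h2" and h: "\<And>p q. h p q = h1 (p - a) (q - b) + h2 p q"
    and ab: "a \<ge> 0" "b \<ge> 0"
  shows "eventually_bipoly h"
proof -
  obtain f1 N1 where f1: "bipoly_fun f1" "\<And>p q. p \<ge> N1 \<Longrightarrow> q \<ge> N1 \<Longrightarrow> of_nat (h1 p q) = f1 (of_int p) (of_int q)"
    using assms(1) unfolding eventually_bipoly_def by blast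
  obtain f2 N2 where f2: "bipoly_fun f2" "\<And>p q. p \<ge> N2 \<Longrightarrow> q \<ge> N2 \<Longrightarrow> of_nat (h2 p q) = f2 (of_int p) (of_int q)"
    using assms(2) unfolding eventually_bipoly_def by blast
  let ?f = "\<lambda>x y. f1 (x - of_int a) (y - of_int b) + f2 x y"
  have "bipoly_fun ?f"
    by (intro bipoly_fun_add bipoly_fun_compose[OF f1(1)] bipoly_fun_diff bipoly_fun_x bipoly_fun_y bipoly_fun_const f2(1))
  moreover have "of_nat (h p q) = ?f (of_int p) (of_int q)"
    if "p \<ge> max N1 N2 + a + b" "q \<ge> max N1 N2 + a + b" for p q
    using that ab f1(2)[of "p - a" "q - b"] f2(2)[of p q] by (simp add: h)
  ultimately show ?thesis unfolding eventually_bipoly_def by blast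
qed

text \<open>Summation of h1 in p determines h up to a function of q alone, and summation of h2 along
  the line p = N determines that function.\<close>

lemma eventually_bipoly_of_differences:
  assumes "eventually_bipoly h1" "eventually_bipoly h2"
    and h1: "\<And>p q. h p q = h (p - 1) q + h1 p q" and h2: "\<And>p q. h p q = h p (q - 1) + h2 p q"
  shows "eventually_bipoly h"
proof -
  obtain f1 N1 where f1: "bipoly_fun f1" "\<And>p q. p \<ge> N1 \<Longrightarrow> q \<ge> N1 \<Longrightarrow> of_nat (h1 p q) = f1 (of_int p) (of_int q)"
    using assms(1) unfolding eventually_bipoly_def by blast
  obtain f2 N2 where f2: "bipoly_fun f2" "\<And>p q. p \<ge> N2 \<Longrightarrow> q \<ge> N2 \<Longrightarrow> of_nat (h2 p q) = f2 (of_int p) (of_int q)"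
    using assms(2) unfolding eventually_bipoly_def by blast
  define N where "N = max N1 N2"
  \<comment> \<open>\<open>h1\<close> is a backward difference and A inverts a forward one, hence
    the argument x + 1.\<close>
  obtain A where A: "bipoly_fun A" "\<And>x y. A (x + 1) y - A x y = f1 (x + 1) y"
    using bipoly_fun_antidifference_x[OF bipoly_fun_compose[OF f1(1) bipoly_fun_add[OF bipoly_fun_x bipoly_fun_const] bipoly_fun_y]]
    by blast
  \<comment> \<open>The forward difference in q of h - A on the line p = N. It does not involve x,
    so the value 0 put for x in B below is an arbitrary choice.\<close>
  let ?d = "\<lambda>x y. f2 (of_int N) (y + 1) - (A (of_int N) (y + 1) - A (of_int N) y)"
  have "bipoly_fun ?d"
    by (intro bipoly_fun_diff bipoly_fun_compose[OF f2(1)] bipoly_fun_compose[OF A(1)] bipoly_fun_add bipoly_fun_y bipoly_fun_const)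
  then obtain B where B: "bipoly_fun B" "\<And>x y. B x (y + 1) - B x y = ?d x y"
    using bipoly_fun_antidifference_y by blast
  define g where "g p q = of_nat (h p q) - A (of_int p) (of_int q)" for p q
  have g: "g p q = g N q" if "p \<ge> N" "q \<ge> N" for p q
    using that(1)
  proof (induction p rule: int_ge_induct)
    case (step p)
    have "of_nat (h (p + 1) q) = of_nat (h p q) + f1 (of_int p + 1) (of_int q)"
      using h1[of "p + 1" q] f1(2)[of "p + 1" q] step(1) that(2) by (simp add: N_def)
    also have "f1 (of_int p + 1) (of_int q) = A (of_int p + 1) (of_int q) - A (of_int p) (of_int q)"
      by (simp add: A(2))
    finally show ?case using step(2) by (simp add: g_def)
  qed simp
  have g': "g N q - B 0 (of_int q) = g N N - B 0 (of_int N)" if "q \<ge> N" for q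
    using that
  proof (induction q rule: int_ge_induct)
    case (step q)
    have "of_nat (h N (q + 1)) = of_nat (h N q) + f2 (of_int N) (of_int q + 1)"
      using h2[of N "q + 1"] f2(2)[of N "q + 1"] step(1) by (simp add: N_def)
    moreover have "B 0 (of_int q + 1) = B 0 (of_int q) + ?d 0 (of_int q)"
      using B(2)[of 0 "of_int q"] by simp
    ultimately show ?case using step(2) by (simp add: g_def)
  qed simp
  define C where "C = g N N - B 0 (of_int N)"
  have "bipoly_fun (\<lambda>x y. A x y + B 0 y + C)"
    by (intro bipoly_fun_add A(1) bipoly_fun_compose[OF B(1)] bipoly_fun_const bipoly_fun_y)
  moreover have "of_nat (h p q) = A (of_int p) (of_int q) + B 0 (of_int q) + C" if "p \<ge> N" "q \<ge> N" for p q
    using g[OF that] g'[OF that(2)] unfolding C_def g_def by simp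
  ultimately show ?thesis unfolding eventually_bipoly_def by blast
qed

section \<open>Polynomial growth by induction on the set of variables\<close>

lemma eventually_bipoly_hdim_if_vcolon:
  fixes I :: "('m::finite, 'n::finite) graded_family"
  assumes "I \<in> ideals_over Z" "eventually_bipoly (hdim (vadjoin v I))" "eventually_bipoly (hdim (vcolon v I))"
  shows "eventually_bipoly (hdim I)"
proof (rule eventually_bipoly_shift_add[OF assms(3,2)])
  show "hdim I p q = hdim (vcolon v I) (p - xdeg v) (q - adeg v) + hdim (vadjoin v I) p q" for p q
    using hdim_split[OF _ var_gpart] assms(1) unfolding ideals_over_def by blast
qed (cases v; simp add: xdeg_def adeg_def)+

text \<open>Each step back from I : v^(t+1) to I : v^t adds only the Hilbert function of an ideal
  with v adjoined, hence of an ideal over Z - {v}.\<close>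

lemma eventually_bipoly_hdim_if_vcolon_funpow:
  fixes I :: "('m::finite, 'n::finite) graded_family"
  assumes "I \<in> ideals_over Z" "\<And>J. J \<in> ideals_over (Z - {v}) \<Longrightarrow> eventually_bipoly (hdim J)"
    "eventually_bipoly (hdim ((vcolon v ^^ t) I))"
  shows "eventually_bipoly (hdim I)"
  using assms(3)
proof (induction t)
  case (Suc t)
  show ?case
  proof (rule Suc.IH, rule eventually_bipoly_hdim_if_vcolon[OF ideals_over_vcolon_funpow[OF assms(1)]])
    show "eventually_bipoly (hdim (vadjoin v ((vcolon v ^^ t) I)))"
      by (intro assms(2) ideals_over_vadjoin ideals_over_vcolon_funpow assms(1))
    show "eventually_bipoly (hdim (vcolon v ((vcolon v ^^ t) I)))" using Suc.prems by simp
  qed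
qed simp

text \<open>Ensures that saturating by a second variable does not destroy the saturation by the
  first.\<close>

lemma vcolon_commute: "vcolon v (vcolon w I) = vcolon w (vcolon v I)"
  using gpart_mult[OF var_gpart[of v]] gpart_mult[OF var_gpart[of w]]
  by (intro ext set_eqI) (auto simp: colon_def mult.left_commute add_ac)

lemma ideals_over_graded: "I \<in> ideals_over Z \<Longrightarrow> graded_ideal I"
  by (simp add: ideals_over_def)

lemma ideals_over_var: "I \<in> ideals_over Z \<Longrightarrow> v \<notin> Z \<Longrightarrow> var v \<in> I (xdeg v) (adeg v)"
  by (simp add: ideals_over_def)

lemma eventually_bipoly_hdim_ideals_over:
  fixes I :: "('m::finite, 'n::finite) graded_family"
  assumes "I \<in> ideals_over Z"
  shows "eventually_bipoly (hdim I)"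
  using finite[of Z] assms
proof (induction Z arbitrary: I rule: finite_psubset_induct)
  case (psubset Z)
  have IH: "eventually_bipoly (hdim J)" if "J \<in> ideals_over (Z - {v})" "v \<in> Z" for J and v
    using psubset.IH[OF _ that(1)] that(2) by blast
  consider "\<forall>k. Inl k \<notin> Z" | "\<forall>i. Inr i \<notin> Z" | "\<exists>k. Inl k \<in> Z" "\<exists>i. Inr i \<in> Z" by auto
  then show ?case
  proof cases
    \<comment> \<open>Without coordinate variables everything of positive degree in x lies in I, so
      the Hilbert polynomial is 0. The next case is the same for the weights.\<close>
    case 1
    have "coord_var k \<in> I 1 0" for k
      using ideals_over_var[OF psubset.prems, of "Inl k"] 1 by (simp add: var_def xdeg_def adeg_def)
    then show ?thesis
      by (intro eventually_bipoly_eventually_0 hdim_full gpart_subset_coord_vars ideals_over_graded[OF psubset.prems])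
  next
    case 2
    have "weight_var k \<in> I 0 1" for k
      using ideals_over_var[OF psubset.prems, of "Inr k"] 2 by (simp add: var_def xdeg_def adeg_def)
    then show ?thesis
      by (intro eventually_bipoly_eventually_0 hdim_full gpart_subset_weight_vars ideals_over_graded[OF psubset.prems])
  next
    case 3
    then obtain k i where ki: "Inl k \<in> Z" "Inr i \<in> Z" by auto
    let ?v = "Inl k" and ?w = "Inr i"
    obtain t where t: "vcolon ?v ((vcolon ?v ^^ t) I) = (vcolon ?v ^^ t) I"
      by (rule vcolon_saturates[OF psubset.hyps psubset.prems])
    define J where "J = (vcolon ?v ^^ t) I"
    have J: "J \<in> ideals_over Z" unfolding J_def by (rule ideals_over_vcolon_funpow[OF psubset.prems])
    obtain s where s: "vcolon ?w ((vcolon ?w ^^ s) J) = (vcolon ?w ^^ s) J"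
      by (rule vcolon_saturates[OF psubset.hyps J])
    define M where "M = (vcolon ?w ^^ s) J"
    have M: "M \<in> ideals_over Z" unfolding M_def by (rule ideals_over_vcolon_funpow[OF J])
    have "vcolon ?v ((vcolon ?w ^^ r) J) = (vcolon ?w ^^ r) J" for r
    proof (induction r)
      case 0
      show ?case using t by (simp add: J_def)
    next
      case (Suc r)
      then show ?case by (simp add: vcolon_commute[where v = ?v])
    qed
    then have Mv: "vcolon ?v M = M" and Mw: "vcolon ?w M = M" using s by (auto simp: M_def)
    have "eventually_bipoly (hdim M)"
    proof (rule eventually_bipoly_of_differences)
      show "eventually_bipoly (hdim (vadjoin ?v M))" by (rule IH[OF ideals_over_vadjoin[OF M] ki(1)])
      show "eventually_bipoly (hdim (vadjoin ?w M))" by (rule IH[OF ideals_over_vadjoin[OF M] ki(2)])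
      \<comment> \<open>As M : v = M, the colon term of \<open>hdim_split\<close> is the Hilbert
        function of M itself, shifted by the degree of v.\<close>
      show "hdim M p q = hdim M (p - 1) q + hdim (vadjoin ?v M) p q" for p q
        using hdim_split[OF ideals_over_graded[OF M] var_gpart[of ?v], of p q] Mv by (simp add: xdeg_def adeg_def)
      show "hdim M p q = hdim M p (q - 1) + hdim (vadjoin ?w M) p q" for p q
        using hdim_split[OF ideals_over_graded[OF M] var_gpart[of ?w], of p q] Mw by (simp add: xdeg_def adeg_def)
    qed
    then have "eventually_bipoly (hdim ((vcolon ?w ^^ s) J))" by (simp only: M_def)
    with J have "eventually_bipoly (hdim J)"
      using eventually_bipoly_hdim_if_vcolon_funpow[where v = ?w and I = J and Z = Z and t = s] IH[where v = ?w, OF _ ki(2)]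
      by blast
    then have "eventually_bipoly (hdim ((vcolon ?v ^^ t) I))" by (simp only: J_def)
    with psubset.prems show ?thesis
      using eventually_bipoly_hdim_if_vcolon_funpow[where v = ?v and I = I and Z = Z and t = t] IH[where v = ?v, OF _ ki(1)]
      by blast
  qed
qed

lemma eventually_bipoly_hdim:
  fixes I :: "('m::finite, 'n::finite) graded_family"
  assumes "graded_ideal I"
  shows "eventually_bipoly (hdim I)"
  by (rule eventually_bipoly_hdim_ideals_over[of I UNIV]) (use assms in \<open>simp add: ideals_over_def\<close>)

section \<open>Deletion and contraction\<close>

definition linform :: "(complex ^ 'm::finite \<Rightarrow> complex) \<Rightarrow> bool" where
  "linform h \<longleftrightarrow> (\<forall>x y. h (x + y) = h x + h y) \<and> (\<forall>c x. h (c *s x) = c * h x)"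

lemma linform_add: "linform h \<Longrightarrow> h (x + y) = h x + h y"
  and linform_scale: "linform h \<Longrightarrow> h (c *s x) = c * h x"
  by (auto simp: linform_def)

lemma linform_0: "linform h \<Longrightarrow> h 0 = 0"
  using linform_scale[of h 0 0] by simp

lemma linform_uminus: "linform h \<Longrightarrow> h (- x) = - h x"
  using linform_scale[of h "-1" x] by simp

lemma linform_diff: "linform h \<Longrightarrow> h (x - y) = h x - h y"
  using linform_add[of h x "- y"] linform_uminus[of h y] by simp

lemma linform_component: "linform (\<lambda>x. x $ k)"
  by (simp add: linform_def)

lemma linform_combination: "linform g \<Longrightarrow> linform h \<Longrightarrow> linform (\<lambda>x. g x - c * h x)"
  by (simp add: linform_def algebra_simps)

lemma subspace_kernel:
  assumes "vec.subspace U" "linform h"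
  shows "vec.subspace {x \<in> U. h x = 0}"
  using assms by (auto simp: vec.subspace_def linform_0 linform_add linform_scale)

lemma dim_kernel:
  assumes U: "vec.subspace U" and h: "linform h" and u: "u \<in> U" "h u \<noteq> 0"
  shows "vec.dim U = Suc (vec.dim {x \<in> U. h x = 0})"
proof -
  let ?W = "{x \<in> U. h x = 0}"
  have W: "vec.subspace ?W" by (rule subspace_kernel[OF U h])
  have "U \<subseteq> vec.span (insert u ?W)"
  proof
    fix x assume x: "x \<in> U"
    let ?c = "h x / h u"
    have "x - ?c *s u \<in> ?W"
      using x u U by (simp add: linform_diff[OF h] linform_scale[OF h] vec.subspace_diff vec.subspace_scale)
    then have "(x - ?c *s u) + ?c *s u \<in> vec.span (insert u ?W)"
      by (intro vec.span_add vec.span_scale vec.span_base) auto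
    then show "x \<in> vec.span (insert u ?W)" by simp
  qed
  moreover have "insert u ?W \<subseteq> U" using u by auto
  ultimately have "vec.span (insert u ?W) = U" using vec.span_minimal[OF _ U] by blast
  then have "vec.dim U = vec.dim (insert u ?W)" by (metis vec.dim_span)
  moreover have "u \<notin> vec.span ?W" using vec.span_minimal[OF order_refl W] u by blast
  ultimately show ?thesis by (simp add: vec.dim_insert)
qed

lemma linform_multiple:
  assumes U: "vec.subspace U" and g: "linform g" "linform h" and van: "\<And>x. x \<in> U \<Longrightarrow> h x = 0 \<Longrightarrow> g x = 0"
  obtains c where "\<And>x. x \<in> U \<Longrightarrow> g x = c * h x"
proof (cases "\<exists>u\<in>U. h u \<noteq> 0")
  case True
  then obtain u where u: "u \<in> U" "h u \<noteq> 0" by blast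
  have "g x = (g u / h u) * h x" if x: "x \<in> U" for x
  proof -
    have "x - (h x / h u) *s u \<in> U" using x u U by (simp add: vec.subspace_diff vec.subspace_scale)
    moreover have "h (x - (h x / h u) *s u) = 0" using u by (simp add: linform_diff[OF g(2)] linform_scale[OF g(2)])
    ultimately have "g (x - (h x / h u) *s u) = 0" by (rule van)
    then show ?thesis by (simp add: linform_diff[OF g(1)] linform_scale[OF g(1)])
  qed
  then show ?thesis by (rule that)
next
  case False
  then have "g x = 0 * h x" if "x \<in> U" for x using van that by simp
  then show ?thesis by (rule that)
qed

definition cut_out :: "('n \<Rightarrow> complex ^ 'm::finite \<Rightarrow> complex) \<Rightarrow> (complex ^ 'm) set \<Rightarrow> 'n set \<Rightarrow> (complex ^ 'm) set" where
  "cut_out f U Y = {x \<in> U. \<forall>i\<in>Y. f i x = 0}"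

text \<open>The number of monomials of degree \<open>p\<close> in \<open>d\<close> variables; truncated subtraction makes this
  right for \<open>d = 0\<close> as well.\<close>

definition monomial_count :: "nat \<Rightarrow> nat \<Rightarrow> nat" where
  "monomial_count d p = (p + d - 1) choose p"

lemma monomial_count_0 [simp]: "monomial_count d 0 = 1" "monomial_count 0 (Suc p) = 0"
  by (auto simp: monomial_count_def)

lemma monomial_count_Suc: "monomial_count (Suc d) (Suc p) = monomial_count (Suc d) p + monomial_count d (Suc p)"
  by (simp add: monomial_count_def)

lemma monomial_count_Suc_left: "monomial_count (Suc d) p = (p + d) choose d"
  using binomial_symmetric[of p "p + d"] by (simp add: monomial_count_def)

lemma monomial_count_mono: "d \<le> d' \<Longrightarrow> monomial_count d p \<le> monomial_count d' p"
  unfolding monomial_count_def by (intro binomial_right_mono) auto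

text \<open>The leading part and the error term of the Hilbert function, in the shape in which the
  deletion-contraction recursion holds exactly.\<close>

definition main_term :: "nat \<Rightarrow> (nat \<Rightarrow> int) \<Rightarrow> nat \<Rightarrow> nat \<Rightarrow> int" where
  "main_term n t p q = (\<Sum>k<n - 1. t (Suc k) * int ((p + k) choose k) * int (monomial_count q (n - 2 - k)))"

definition err_term :: "nat \<Rightarrow> nat \<Rightarrow> nat \<Rightarrow> nat" where
  "err_term n p q = (if n < 3 then 0 else (p + q + n - 3) choose (n - 3))"

text \<open>Pascal's rule for \<open>monomial_count\<close> in every summand. The summand k = n - 1
  of \<open>main_term (Suc n)\<close> does not depend on q and occurs equally on both sides.\<close>

lemma main_term_Suc:
  assumes "n > 0"
  shows "main_term (Suc n) t p (Suc q) = main_term (Suc n) t p q + main_term n t p (Suc q)"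
proof -
  obtain m where m: "n = Suc m" using assms by (cases n) auto
  have "main_term (Suc n) t p r = (\<Sum>k<m. t (Suc k) * int ((p + k) choose k) * int (monomial_count r (m - k)))
      + t (Suc m) * int ((p + m) choose m)" for r
    by (simp add: main_term_def m)
  moreover have "monomial_count (Suc q) (m - k) = monomial_count q (m - k) + monomial_count (Suc q) (m - 1 - k)" if "k < m" for k
    using that monomial_count_Suc[of q "m - 1 - k"] by (simp add: Suc_diff_Suc)
  then have "(\<Sum>k<m. t (Suc k) * int ((p + k) choose k) * int (monomial_count (Suc q) (m - k)))
      = (\<Sum>k<m. t (Suc k) * int ((p + k) choose k) * int (monomial_count q (m - k)))
       + (\<Sum>k<m. t (Suc k) * int ((p + k) choose k) * int (monomial_count (Suc q) (m - 1 - k)))"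
    by (simp add: distrib_left flip: sum.distrib)
  ultimately show ?thesis by (simp add: main_term_def m)
qed

text \<open>In zero variables there is only the constant monomial, so only the last summand
  survives.\<close>

lemma main_term_0:
  assumes "n > 0"
  shows "main_term (Suc n) t p 0 = t n * int ((p + (n - 1)) choose (n - 1))"
proof -
  obtain m where m: "n = Suc m" using assms by (cases n) auto
  have "(\<Sum>k<m. t (Suc k) * int ((p + k) choose k) * int (monomial_count 0 (m - k))) = 0"
  proof (rule sum.neutral, safe)
    fix k assume "k < m"
    then obtain j where "m - k = Suc j" by (metis Suc_diff_Suc)
    then show "t (Suc k) * int ((p + k) choose k) * int (monomial_count 0 (m - k)) = 0" by simp
  qed
  then show ?thesis by (simp add: main_term_def m)
qed

lemma main_term_add: "main_term n (\<lambda>k. t k + t' k) p q = main_term n t p q + main_term n t' p q"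
  by (simp add: main_term_def algebra_simps sum.distrib)

lemma main_term_eq_0: "(\<And>k. 0 < k \<Longrightarrow> k < n \<Longrightarrow> t k = 0) \<Longrightarrow> main_term n t p q = 0"
  unfolding main_term_def by (intro sum.neutral) auto

text \<open>Absorbs the shift of p between the deletion and the restriction; this is where the
  nonnegativity of the Tutte coefficients enters.\<close>

lemma main_term_mono:
  assumes "\<And>k. t k \<ge> 0" "p \<le> p'"
  shows "main_term n t p q \<le> main_term n t p' q"
  unfolding main_term_def
proof (intro sum_mono mult_mono mult_left_mono)
  fix k
  show "int ((p + k) choose k) \<le> int ((p' + k) choose k)"
    using assms(2) by (simp add: binomial_right_mono)
qed (use assms in auto)

text \<open>For n >= 3, \<open>err_term n p q\<close> counts the monomials of degree p + q in n - 2
  variables. It has degree n - 3 and, by Pascal's rule, obeys the recursion of the leading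
  term.\<close>

lemma err_term_Suc: "err_term (Suc n) p (Suc q) = err_term (Suc n) p q + err_term n p (Suc q)"
proof (cases "n < 3")
  case True
  then show ?thesis by (cases "n = 2") (auto simp: err_term_def)
next
  case False
  then obtain k where "n = 3 + k" using le_Suc_ex[of 3 n] by auto
  then show ?thesis by (simp add: err_term_def)
qed

lemma err_term_mono: "p \<le> p' \<Longrightarrow> err_term n p q \<le> err_term n p' q"
  unfolding err_term_def by (auto intro: binomial_right_mono)

text \<open>A subspace whose dimension is at least two below n contributes at q = 0 only to the
  error.\<close>

lemma monomial_count_le_err_term:
  assumes "d + 2 \<le> n" "p > 0"
  shows "monomial_count d p \<le> err_term n p 0"
proof (cases "d = 0")
  case True
  then show ?thesis using assms(2) by (cases p) auto
next
  case False
  then obtain k where k: "n = Suc (Suc (Suc k))" using assms(1) by (metis add_2_eq_Suc' Suc_le_D Suc_le_mono not0_implies_Suc)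
  have "monomial_count d p \<le> monomial_count (Suc k) p" using assms(1) k by (intro monomial_count_mono) auto
  then show ?thesis by (simp add: monomial_count_Suc_left err_term_def k)
qed

section \<open>Arrangements on subspaces and their polynomial T(x, 0)\<close>

locale forms =
  fixes f :: "'n::finite \<Rightarrow> complex ^ 'm::finite \<Rightarrow> complex"
  assumes lin: "linform (f i)"
begin

lemma subspace_cut: "vec.subspace U \<Longrightarrow> vec.subspace (cut_out f U Y)"
  by (auto simp: cut_out_def vec.subspace_def linform_0[OF lin] linform_add[OF lin] linform_scale[OF lin])

lemma cut_subset: "cut_out f U Y \<subseteq> U"
  by (auto simp: cut_out_def)

lemma cut_empty [simp]: "cut_out f U {} = U"
  by (simp add: cut_out_def)

lemma cut_insert: "cut_out f U (insert i Y) = {x \<in> cut_out f U Y. f i x = 0}"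
  by (auto simp: cut_out_def)

lemma cut_cut: "cut_out f (cut_out f U {i}) Y = cut_out f U (insert i Y)"
  by (auto simp: cut_out_def)

lemma dim_cut_insert:
  assumes "vec.subspace U" "x \<in> cut_out f U Y" "f i x \<noteq> 0"
  shows "vec.dim (cut_out f U Y) = Suc (vec.dim (cut_out f U (insert i Y)))"
  unfolding cut_insert by (rule dim_kernel[OF subspace_cut[OF assms(1)] lin assms(2,3)])

lemma dim_cut_insert_le:
  assumes "vec.subspace U"
  shows "vec.dim (cut_out f U Y) \<le> Suc (vec.dim (cut_out f U (insert i Y)))"
proof (cases "\<exists>x\<in>cut_out f U Y. f i x \<noteq> 0")
  case True
  then show ?thesis using dim_cut_insert[OF assms] by auto
next
  case False
  then have "cut_out f U (insert i Y) = cut_out f U Y" unfolding cut_insert by auto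
  then show ?thesis by simp
qed

lemma dim_cut_Un_le:
  assumes "vec.subspace U"
  shows "vec.dim (cut_out f U Y) \<le> vec.dim (cut_out f U (Y \<union> Z)) + card Z"
  using finite[of Z]
proof (induction Z rule: finite_induct)
  case (insert i Z)
  then show ?case using dim_cut_insert_le[OF assms, of "Y \<union> Z" i] by simp
qed simp

lemma dim_le_card:
  assumes "vec.subspace U" "cut_out f U E = {0}"
  shows "vec.dim U \<le> card E"
  using dim_cut_Un_le[OF assms(1), of "{}" E] assms(2) by simp

text \<open>If the forms of E have only 0 as common zero in U, this is T(x, 0) = (-1)^r chi(1 - x)
  of the forms restricted to U, with r = dim U and chi given by Whitney's sum over subsets. The sum
  involves no differences of ranks and makes sense for loops and repeated forms.\<close>

definition tpoly :: "(complex ^ 'm) set \<Rightarrow> 'n set \<Rightarrow> int poly" where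
  "tpoly U E = (-1) ^ vec.dim U * (\<Sum>Y\<in>Pow E. (-1) ^ card Y * [:1, -1:] ^ vec.dim (cut_out f U Y))"

lemma sum_Pow_insert:
  fixes F :: "'n set \<Rightarrow> 'x::comm_monoid_add"
  assumes "i \<in> E"
  shows "(\<Sum>Y\<in>Pow E. F Y) = (\<Sum>Y\<in>Pow (E - {i}). F Y) + (\<Sum>Y\<in>Pow (E - {i}). F (insert i Y))"
proof -
  have "Pow E = Pow (E - {i}) \<union> insert i ` Pow (E - {i})"
    using assms Pow_insert[of i "E - {i}"] by (simp add: insert_absorb)
  moreover have "Pow (E - {i}) \<inter> insert i ` Pow (E - {i}) = {}" by auto
  moreover have "inj_on (insert i) (Pow (E - {i}))" by (auto simp: inj_on_def)
  ultimately show ?thesis by (simp add: sum.union_disjoint sum.reindex)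
qed

lemma card_insert_Pow: "Y \<in> Pow (E - {i}) \<Longrightarrow> card (insert i (Y :: 'n set)) = Suc (card Y)"
  by (subst card_insert_disjoint) auto

text \<open>The subsets with and without the loop cancel in pairs.\<close>

lemma tpoly_loop:
  assumes "i \<in> E" "\<And>x. x \<in> U \<Longrightarrow> f i x = 0"
  shows "tpoly U E = 0"
proof -
  have "cut_out f U (insert i Y) = cut_out f U Y" for Y
    using assms(2) by (auto simp: cut_out_def)
  then have "(\<Sum>Y\<in>Pow (E - {i}). (-1) ^ card (insert i Y) * [:1, -1:] ^ vec.dim (cut_out f U (insert i Y)))
      = (\<Sum>Y\<in>Pow (E - {i}). - ((-1) ^ card Y * [:1, -1:] ^ vec.dim (cut_out f U Y) :: int poly))"
    by (intro sum.cong refl) (simp add: card_insert_Pow del: Pow_iff)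
  then show ?thesis unfolding tpoly_def sum_Pow_insert[OF assms(1)] by (simp add: sum_negf)
qed

text \<open>Subsets containing i carry one more sign, which the drop of the dimension from U to the
  hyperplane absorbs. Coloops are included.\<close>

lemma tpoly_deletion_contraction:
  assumes "vec.subspace U" "i \<in> E" "x \<in> U" "f i x \<noteq> 0"
  shows "tpoly U E = tpoly U (E - {i}) + tpoly (cut_out f U {i}) (E - {i})"
proof -
  have d: "vec.dim U = Suc (vec.dim (cut_out f U {i}))"
    using dim_cut_insert[OF assms(1), of x "{}" i] assms(3,4) by simp
  have "(\<Sum>Y\<in>Pow (E - {i}). (-1) ^ card (insert i Y) * [:1, -1:] ^ vec.dim (cut_out f U (insert i Y)))
      = (\<Sum>Y\<in>Pow (E - {i}). - ((-1) ^ card Y * [:1, -1:] ^ vec.dim (cut_out f (cut_out f U {i}) Y) :: int poly))"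
    by (intro sum.cong refl) (simp add: card_insert_Pow cut_cut del: Pow_iff)
  then show ?thesis
    unfolding tpoly_def sum_Pow_insert[OF assms(2)] by (simp add: sum_negf d algebra_simps)
qed

text \<open>When all subsets are independent the sum is the expansion of the product of the factors
  -1 + (1 - x), that is, of (-x)^r.\<close>

lemma tpoly_boolean:
  assumes "\<And>Y. Y \<subseteq> E \<Longrightarrow> vec.dim (cut_out f U Y) + card Y = vec.dim U" "card E = vec.dim U"
  shows "tpoly U E = monom 1 (vec.dim U)"
proof -
  have "(\<Sum>Y\<in>Pow E. (-1) ^ card Y * [:1, -1:] ^ vec.dim (cut_out f U Y))
      = (\<Sum>Y\<in>Pow E. (\<Prod>i\<in>Y. -1) * (\<Prod>i\<in>E - Y. [:1, -1:]) :: int poly)"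
  proof (intro sum.cong refl)
    fix Y assume Y: "Y \<in> Pow E"
    then have "vec.dim (cut_out f U Y) = card (E - Y)"
      using assms(1)[of Y] assms(2) by (simp add: card_Diff_subset)
    then show "(-1) ^ card Y * [:1, -1:] ^ vec.dim (cut_out f U Y)
      = (\<Prod>i\<in>Y. -1) * (\<Prod>i\<in>E - Y. [:1, -1:] :: int poly)" by simp
  qed
  also have "\<dots> = (\<Prod>i\<in>E. -1 + [:1, -1:])" by (rule prod_add[symmetric]) simp
  also have "\<dots> = (-1 * monom 1 1) ^ vec.dim U"
    by (simp add: assms(2) one_pCons monom_Suc monom_0)
  finally show ?thesis
    unfolding tpoly_def by (simp add: monom_power flip: power_mult_distrib)
qed

lemma coeff_tpoly_eq_0:
  assumes "vec.subspace U" "k > vec.dim U"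
  shows "coeff (tpoly U E) k = 0"
proof -
  have "degree (\<Sum>Y\<in>Pow E. (-1) ^ card Y * [:1, -1:] ^ vec.dim (cut_out f U Y) :: int poly) \<le> vec.dim U"
  proof (rule degree_sum_le)
    fix Y
    have "degree ((-1) ^ card Y * [:1, -1:] ^ vec.dim (cut_out f U Y) :: int poly) \<le> vec.dim (cut_out f U Y)"
      using degree_power_le[of "[:1, -1:] :: int poly" "vec.dim (cut_out f U Y)"]
      by (cases "even (card Y)") auto
    also have "\<dots> \<le> vec.dim U" by (rule vec.dim_subset[OF cut_subset])
    finally show "degree ((-1) ^ card Y * [:1, -1:] ^ vec.dim (cut_out f U Y) :: int poly) \<le> vec.dim U" .
  qed simp
  then have "degree (tpoly U E) \<le> vec.dim U"
    unfolding tpoly_def by (cases "even (vec.dim U)") auto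
  then show ?thesis using assms(2) by (intro coeff_eq_0) linarith
qed

text \<open>In \<open>regular\<close> the element i is neither a loop nor a coloop, so that both
  minors still cut out 0. Two loops are treated separately because they push the rank far enough
  below the number of forms. What remains in \<open>coloops\<close> are coloops and at most one
  loop.\<close>

lemma deletion_contraction_induct [consumes 2, case_names regular loops coloops]:
  assumes "vec.subspace U" "cut_out f U E = {0}"
    and A: "\<And>U E i x. vec.subspace U \<Longrightarrow> cut_out f U E = {0} \<Longrightarrow> i \<in> E \<Longrightarrow> x \<in> U \<Longrightarrow> f i x \<noteq> 0 \<Longrightarrow>
      cut_out f U (E - {i}) = {0} \<Longrightarrow> cut_out f (cut_out f U {i}) (E - {i}) = {0} \<Longrightarrow>
      P U (E - {i}) \<Longrightarrow> P (cut_out f U {i}) (E - {i}) \<Longrightarrow> P U E"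
    and B: "\<And>U E i j. vec.subspace U \<Longrightarrow> cut_out f U E = {0} \<Longrightarrow> i \<in> E \<Longrightarrow> j \<in> E - {i} \<Longrightarrow>
      (\<And>x. x \<in> U \<Longrightarrow> f i x = 0) \<Longrightarrow> (\<And>x. x \<in> U \<Longrightarrow> f j x = 0) \<Longrightarrow> cut_out f U (E - {i, j}) = {0} \<Longrightarrow>
      P U (E - {i}) \<Longrightarrow> P U E"
    and C: "\<And>U E. vec.subspace U \<Longrightarrow> cut_out f U E = {0} \<Longrightarrow>
      (\<And>i x. i \<in> E \<Longrightarrow> x \<in> U \<Longrightarrow> f i x \<noteq> 0 \<Longrightarrow> \<exists>v\<in>U. f i v \<noteq> 0 \<and> (\<forall>j\<in>E - {i}. f j v = 0)) \<Longrightarrow>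
      (\<And>i j. i \<in> E \<Longrightarrow> j \<in> E \<Longrightarrow> (\<And>x. x \<in> U \<Longrightarrow> f i x = 0) \<Longrightarrow> (\<And>x. x \<in> U \<Longrightarrow> f j x = 0) \<Longrightarrow> i = j) \<Longrightarrow> P U E"
  shows "P U E"
  using assms(1,2)
proof (induction "card E" arbitrary: U E rule: less_induct)
  case less
  have smaller: "card (E - {i}) < card E" if "i \<in> E" for i
    using that by (intro psubset_card_mono) auto
  show ?case
  proof (cases "\<exists>i\<in>E. (\<exists>x\<in>U. f i x \<noteq> 0) \<and> cut_out f U (E - {i}) = {0}")
    case True
    then obtain i x where i: "i \<in> E" "x \<in> U" "f i x \<noteq> 0" "cut_out f U (E - {i}) = {0}" by blast
    have E: "cut_out f (cut_out f U {i}) (E - {i}) = {0}"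
      using less.prems(2) i(1) by (simp add: cut_cut insert_absorb)
    show ?thesis
      by (rule A[OF less.prems i E less.hyps[OF smaller[OF i(1)] less.prems(1) i(4)]
            less.hyps[OF smaller[OF i(1)] subspace_cut[OF less.prems(1)] E]])
  next
    case not_regular: False
    show ?thesis
    proof (cases "\<exists>i\<in>E. \<exists>j\<in>E - {i}. (\<forall>x\<in>U. f i x = 0) \<and> (\<forall>x\<in>U. f j x = 0)")
      case True
      then obtain i j where ij: "i \<in> E" "j \<in> E - {i}" "\<And>x. x \<in> U \<Longrightarrow> f i x = 0" "\<And>x. x \<in> U \<Longrightarrow> f j x = 0"
        by blast
      then have "cut_out f U (E - {i}) = cut_out f U E" "cut_out f U (E - {i, j}) = cut_out f U E"
        by (auto simp: cut_out_def) 
      then show ?thesis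
        using B[OF less.prems ij] less.hyps[OF smaller[OF ij(1)] less.prems(1)] less.prems(2) by simp
    next
      case False
      show ?thesis
      proof (rule C[OF less.prems])
        fix i x assume i: "i \<in> E" "x \<in> U" "f i x \<noteq> 0"
        have "0 \<in> cut_out f U (E - {i})" using subspace_cut[OF less.prems(1)] vec.subspace_0 by blast
        then obtain v where v: "v \<in> cut_out f U (E - {i})" "v \<noteq> 0" using not_regular i by blast
        then have "f i v \<noteq> 0" using less.prems(2) by (auto simp: cut_out_def)
        then show "\<exists>v\<in>U. f i v \<noteq> 0 \<and> (\<forall>j\<in>E - {i}. f j v = 0)" using v(1) by (auto simp: cut_out_def)
      next
        fix i j assume "i \<in> E" "j \<in> E" "\<And>x. x \<in> U \<Longrightarrow> f i x = 0" "\<And>x. x \<in> U \<Longrightarrow> f j x = 0"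
        then show "i = j" using False by blast
      qed
    qed
  qed
qed

text \<open>A loop makes the polynomial vanish; without loops the forms are linear coordinates on
  U.\<close>

lemma tpoly_coloops:
  assumes U: "vec.subspace U" "cut_out f U E = {0}"
    and coloop: "\<And>i x. i \<in> E \<Longrightarrow> x \<in> U \<Longrightarrow> f i x \<noteq> 0 \<Longrightarrow> \<exists>v\<in>U. f i v \<noteq> 0 \<and> (\<forall>j\<in>E - {i}. f j v = 0)"
  shows "tpoly U E = 0 \<or> tpoly U E = monom 1 (card E)"
proof (cases "\<exists>i\<in>E. \<forall>x\<in>U. f i x = 0")
  case True
  then obtain i where "i \<in> E" "\<forall>x\<in>U. f i x = 0" by auto
  then show ?thesis using tpoly_loop[of i E U] by simp
next
  case False
  have *: "vec.dim (cut_out f U Y) + card Y = vec.dim U" if "Y \<subseteq> E" for Y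
    using finite[of Y] that
  proof (induction Y rule: finite_induct)
    case (insert i Y)
    then have i: "i \<in> E" by simp
    then obtain x where "x \<in> U" "f i x \<noteq> 0" using False by auto
    from coloop[OF i this] obtain v where v: "v \<in> U" "f i v \<noteq> 0" "\<forall>j\<in>E - {i}. f j v = 0" by auto
    then have "v \<in> cut_out f U Y" using insert by (auto simp: cut_out_def)
    then show ?case using dim_cut_insert[OF U(1) _ v(2)] insert by simp
  qed simp
  from *[of E] have "card E = vec.dim U" using U(2) by simp
  then show ?thesis using tpoly_boolean[OF *] by simp
qed

lemma coeff_tpoly_nonneg:
  assumes "vec.subspace U" "cut_out f U E = {0}"
  shows "coeff (tpoly U E) k \<ge> 0"
  using assms
proof (induction rule: deletion_contraction_induct)
  case (regular U E i x)
  then show ?case using tpoly_deletion_contraction by simp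
next
  case (loops U E i j)
  then show ?case using tpoly_loop[of i E U] by simp
next
  case (coloops U E)
  then show ?case using tpoly_coloops[of U E] by auto
qed

text \<open>By \<open>main_term_0\<close> this coefficient is all that the leading term sees at q =
  0. If dim U = card E - 1, the forms of E - {i} are coordinates on U, so the deletion gives x^(dim
  U) and the restriction only lower powers.\<close>

lemma coeff_tpoly_top:
  assumes U: "vec.subspace U" "cut_out f U (E - {i}) = {0}" and i: "i \<in> E" "x \<in> U" "f i x \<noteq> 0"
  shows "coeff (tpoly U E) (card (E - {i})) = (if vec.dim U = card (E - {i}) then 1 else 0)"
proof (cases "vec.dim U = card (E - {i})")
  case True
  have d: "vec.dim U = Suc (vec.dim (cut_out f U {i}))"
    using dim_cut_insert[OF U(1), of x "{}" i] i(2,3) by simp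
  have "vec.dim (cut_out f U Y) + card Y = vec.dim U" if Y: "Y \<subseteq> E - {i}" for Y
  proof -
    have "vec.dim U \<le> vec.dim (cut_out f U Y) + card Y"
      using dim_cut_Un_le[OF U(1), of "{}" Y] by simp
    moreover have "vec.dim (cut_out f U Y) \<le> card (E - {i} - Y)"
      using dim_cut_Un_le[OF U(1), of Y "E - {i} - Y"] U(2) Y by (simp add: Un_absorb1)
    moreover have "card (E - {i} - Y) + card Y = card (E - {i})"
      using card_Diff_subset[OF finite Y] card_mono[OF finite Y] by simp
    ultimately show ?thesis using True by linarith
  qed
  then have "tpoly U (E - {i}) = monom 1 (vec.dim U)" using tpoly_boolean True by metis
  moreover have "coeff (tpoly (cut_out f U {i}) (E - {i})) (vec.dim U) = 0"
    using coeff_tpoly_eq_0[OF subspace_cut[OF U(1)]] d by simp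
  ultimately show ?thesis
    using tpoly_deletion_contraction[OF U(1) i] True by simp
next
  case False
  then show ?thesis using coeff_tpoly_eq_0[OF U(1)] dim_le_card[OF U] by simp
qed

end

section \<open>The upper bound\<close>

definition linpoly :: "(complex ^ 'm::finite \<Rightarrow> complex) \<Rightarrow> ('m, 'n) tensor_ring" where
  "linpoly h = (\<Sum>k\<in>UNIV. cst (h (axis k 1)) * coord_var k)"

lemma linpoly_gpart [simp]: "linpoly h \<in> gpart 1 0"
  unfolding linpoly_def by (intro gpart_sum gpart_scale coord_var_gpart)

lemma linpoly_component: "linpoly (\<lambda>x. x $ k) = coord_var k"
proof -
  have "linpoly (\<lambda>x. x $ k) = (\<Sum>l\<in>UNIV. if l = k then coord_var k else 0)"
    unfolding linpoly_def by (intro sum.cong refl) (auto simp: axis_def)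
  then show ?thesis by simp
qed

lemma linpoly_combination: "linpoly g = linpoly (\<lambda>x. g x - c * h x) + linpoly h * cst c"
  unfolding linpoly_def
  by (simp add: cst_diff cst_mult sum_distrib_left sum_distrib_right algebra_simps flip: sum.distrib)

text \<open>Encodes the passage from V to U inside the fixed ring S: modulo I the coordinates
  satisfy all linear relations that hold on U.\<close>

definition contains_annihilator :: "('m::finite, 'n) graded_family \<Rightarrow> (complex ^ 'm) set \<Rightarrow> bool" where
  "contains_annihilator I U \<longleftrightarrow> (\<forall>h. linform h \<longrightarrow> (\<forall>x\<in>U. h x = 0) \<longrightarrow> linpoly h \<in> I 1 0)"

lemma contains_annihilator_mono: "contains_annihilator I U \<Longrightarrow> I \<le> I' \<Longrightarrow> contains_annihilator I' U"
  unfolding contains_annihilator_def le_fun_def by blast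

lemma contains_annihilator_adjoin:
  assumes I: "graded_ideal I" "contains_annihilator I U" and U: "vec.subspace U" and h: "linform h"
  shows "contains_annihilator (adjoin I (linpoly h) 1 0) {x \<in> U. h x = 0}"
  unfolding contains_annihilator_def
proof (intro allI impI)
  fix g assume g: "linform g" "\<forall>x\<in>{x \<in> U. h x = 0}. g x = 0"
  show "linpoly g \<in> adjoin I (linpoly h) 1 0 1 0"
  proof -
    obtain c where "\<And>x. x \<in> U \<Longrightarrow> g x = c * h x"
      by (rule linform_multiple[OF U g(1) h]) (use g(2) in auto)
    then have "linpoly (\<lambda>x. g x - c * h x) \<in> I 1 0"
      using I(2) linform_combination[OF g(1) h] unfolding contains_annihilator_def by simp
    moreover have "linpoly g = linpoly (\<lambda>x. g x - c * h x) + linpoly h * cst c" by (rule linpoly_combination)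
    moreover have "cst c \<in> gpart (1 - 1) (0 - 0)" by simp
    ultimately show ?thesis unfolding adjoin_def by blast
  qed
qed

lemma hdim_00_le:
  fixes I :: "('m::finite, 'n::finite) graded_family"
  assumes I: "graded_ideal I"
  shows "hdim I 0 0 \<le> 1"
proof (cases "1 \<in> I 0 0")
  case True
  have "u \<in> I 0 0" if u: "u \<in> gpart 0 0" for u
  proof -
    obtain c where "u = cst c" using u by (rule gpart_00)
    then show ?thesis using graded_ideal_cst[OF I True, of c] by simp
  qed
  then have "hdim I 0 0 = 0" by (intro hdim_full[OF I] subsetI)
  then show ?thesis by simp
next
  case False
  have "span_mod (I 0 0) [1] (gpart 0 0)"
    unfolding span_mod_def
  proof
    fix u :: "('m, 'n) tensor_ring" assume "u \<in> gpart 0 0"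
    then obtain c where "u = cst c" by (rule gpart_00)
    then have "u - lincomb (\<lambda>_. c) [1] = 0" by (simp add: lincomb_def)
    then show "\<exists>c. u - lincomb c [1] \<in> I 0 0" using graded_ideal_0[OF I] by metis
  qed
  moreover have "indep_mod (I 0 0) [1]"
    unfolding indep_mod_def
  proof (intro allI impI)
    fix c k assume c: "lincomb c [1] \<in> I 0 0" and k: "k < length [1 :: ('m, 'n) tensor_ring]"
    have "c 0 = 0"
    proof (rule ccontr)
      assume c0: "c 0 \<noteq> 0"
      have "cst (1 / c 0) * lincomb c [1] \<in> I 0 0" by (rule graded_ideal_cst[OF I c])
      then show False using False c0 by (simp add: lincomb_def mult_single)
    qed
    then show "c k = 0" using k by simp
  qed
  ultimately have "hdim I 0 0 = length [1 :: ('m, 'n) tensor_ring]"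
    unfolding hdim_def using quotient_dim_eqI[OF graded_ideal_subspace[OF I], where us = "[1]"] by simp
  then show ?thesis by simp
qed

text \<open>In weight degree 0 the quotient is an image of the coordinate ring of U. Dividing by a
  coordinate that is not zero on U reproduces the recursion of
  \<open>monomial_count\<close>.\<close>

lemma hdim_q0_le:
  fixes I :: "('m::finite, 'n::finite) graded_family"
  assumes "graded_ideal I" "vec.subspace U" "contains_annihilator I U"
  shows "hdim I (int p) 0 \<le> monomial_count (vec.dim U) p"
  using assms
proof (induction "vec.dim U + p" arbitrary: U I p rule: less_induct)
  case less
  note I = less.prems(1) and U = less.prems(2) and ann = less.prems(3)
  show ?case
  proof (cases p)
    case 0
    then show ?thesis using hdim_00_le[OF I] by simp
  next
    case (Suc r)
    show ?thesis
    proof (cases "U = {0}")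
      case True
      have "coord_var k \<in> I 1 0" for k
        using ann linform_component[of k] True unfolding contains_annihilator_def linpoly_component[symmetric] by auto
      then have "gpart (int p) 0 \<subseteq> I (int p) 0" by (intro gpart_subset_coord_vars[OF I]) (simp_all add: Suc)
      then show ?thesis using hdim_full[OF I] by simp
    next
      case False
      then obtain u where u: "u \<in> U" "u \<noteq> 0" using vec.subspace_0[OF U] by blast
      then obtain k where k: "u $ k \<noteq> 0" by (auto simp: vec_eq_iff)
      let ?h = "\<lambda>x :: complex ^ 'm. x $ k" and ?g = "linpoly (\<lambda>x :: complex ^ 'm. x $ k) :: ('m, 'n) tensor_ring"
      let ?W = "{x \<in> U. ?h x = 0}"
      have d: "vec.dim U = Suc (vec.dim ?W)" by (rule dim_kernel[OF U linform_component u(1) k])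
      have "hdim I (int p) 0 = hdim (colon I ?g 1 0) (int p - 1) (0 - 0) + hdim (adjoin I ?g 1 0) (int p) 0"
        by (rule hdim_split[OF I linpoly_gpart])
      also have "hdim (colon I ?g 1 0) (int p - 1) (0 - 0) \<le> hdim I (int p - 1) (0 - 0)"
        by (intro hdim_mono I graded_ideal_colon colon_superset linpoly_gpart)
      also have "hdim I (int p - 1) (0 - 0) = hdim I (int r) 0" by (simp add: Suc)
      also have "\<dots> \<le> monomial_count (vec.dim U) r" by (rule less.hyps[OF _ less.prems]) (simp add: Suc)
      also have "hdim (adjoin I ?g 1 0) (int p) 0 \<le> monomial_count (vec.dim ?W) p"
        by (rule less.hyps[OF _ graded_ideal_adjoin[OF I linpoly_gpart] subspace_kernel[OF U linform_component]
            contains_annihilator_adjoin[OF I ann U linform_component]]) (simp add: d)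
      finally show ?thesis by (simp add: d Suc monomial_count_Suc)
    qed
  qed
qed

section \<open>Euler and cocircuit relations under deletion and contraction\<close>

context forms
begin

definition support :: "'n set \<Rightarrow> complex ^ 'm \<Rightarrow> 'n set" where
  "support E v = {i \<in> E. f i v \<noteq> 0}"

text \<open>The contraction of the derivation (product of the \<open>f j\<close> over the support of
  v) times d/dv. The support is the set of forms not vanishing at v, that is, a union of cocircuits
  of the matroid.\<close>

definition cocircuit :: "'n set \<Rightarrow> complex ^ 'm \<Rightarrow> ('m, 'n) tensor_ring" where
  "cocircuit E v = (\<Sum>i\<in>support E v. cst (f i v) * (weight_var i * (\<Prod>j\<in>support E v - {i}. linpoly (f j))))"

lemma weight_prod_gpart:
  "i \<in> S \<Longrightarrow> weight_var i * (\<Prod>j\<in>S - {i}. linpoly (f j)) \<in> gpart (int (card (S :: 'n set)) - 1) 1"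
  using gpart_mult[OF weight_var_gpart gpart_prod[of "S - {i}" "\<lambda>j. linpoly (f j)"], of i]
    card_Suc_Diff1[of S i] by (simp add: of_nat_diff)

lemma cocircuit_gpart: "cocircuit E v \<in> gpart (int (card (support E v)) - 1) 1"
  unfolding cocircuit_def by (intro gpart_sum gpart_scale weight_prod_gpart)

text \<open>The Euler relation and the cocircuit relations already cut out the right leading part.\<close>

definition admissible :: "('m, 'n) graded_family \<Rightarrow> (complex ^ 'm) set \<Rightarrow> 'n set \<Rightarrow> bool" where
  "admissible I U E \<longleftrightarrow> graded_ideal I \<and> contains_annihilator I U \<and>
     (\<forall>i. i \<notin> E \<longrightarrow> weight_var i \<in> I 0 1) \<and> (\<Sum>i\<in>E. weight_var i) \<in> I 0 1 \<and>
     (\<forall>v\<in>U. cocircuit E v \<in> I (int (card (support E v)) - 1) 1)"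

lemma admissible_weight_adjoin:
  assumes "admissible I U E" "i \<in> E"
  defines "J \<equiv> adjoin I (weight_var i) 0 1"
  shows "graded_ideal J" "contains_annihilator J U" "\<And>j. j \<notin> E - {i} \<Longrightarrow> weight_var j \<in> J 0 1"
    "(\<Sum>j\<in>E - {i}. weight_var j) \<in> J 0 1"
    "\<And>v. v \<in> U \<Longrightarrow> cocircuit E v \<in> J (int (card (support E v)) - 1) 1"
proof -
  have I: "graded_ideal I" and ann: "contains_annihilator I U"
    and out: "\<And>j. j \<notin> E \<Longrightarrow> weight_var j \<in> I 0 1" and euler: "(\<Sum>i\<in>E. weight_var i) \<in> I 0 1"
    and coc: "\<And>v. v \<in> U \<Longrightarrow> cocircuit E v \<in> I (int (card (support E v)) - 1) 1"
    using assms(1) unfolding admissible_def by auto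
  have le: "I \<le> J" unfolding J_def by (rule adjoin_superset)
  have wi: "weight_var i \<in> J 0 1" unfolding J_def by (rule adjoin_mem[OF I weight_var_gpart])
  show J: "graded_ideal J" unfolding J_def by (rule graded_ideal_adjoin[OF I weight_var_gpart])
  show "contains_annihilator J U" using contains_annihilator_mono[OF ann le] .
  show "weight_var j \<in> J 0 1" if "j \<notin> E - {i}" for j
    using that out[of j] le wi unfolding le_fun_def by blast
  have "(\<Sum>j\<in>E. weight_var j) \<in> J 0 1" using euler le unfolding le_fun_def by blast
  moreover have "(\<Sum>j\<in>E - {i}. weight_var j) = (\<Sum>j\<in>E. weight_var j) - (weight_var i :: ('m, 'n) tensor_ring)"
    using sum.remove[OF finite assms(2), of "weight_var :: 'n \<Rightarrow> ('m, 'n) tensor_ring"] by simp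
  ultimately show "(\<Sum>j\<in>E - {i}. weight_var j) \<in> J 0 1" using graded_ideal_diff[OF J _ wi] by metis
  show "cocircuit E v \<in> J (int (card (support E v)) - 1) 1" if "v \<in> U" for v
    using coc[OF that] le unfolding le_fun_def by blast
qed

lemma support_delete: "f i v = 0 \<Longrightarrow> support (E - {i}) v = support E v"
  by (auto simp: support_def)

lemma cocircuit_delete: "f i v = 0 \<Longrightarrow> cocircuit (E - {i}) v = cocircuit E v"
  by (simp add: cocircuit_def support_delete)

text \<open>Modulo the weight of i, the relation of E is \<open>f i\<close> times the relation of E
  - {i}. This is why the deletion calls for a colon by \<open>f i\<close>.\<close>

lemma cocircuit_split:
  assumes "i \<in> E" "f i v \<noteq> 0"
  shows "cocircuit E v = cst (f i v) * (weight_var i * (\<Prod>j\<in>support E v - {i}. linpoly (f j)))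
    + linpoly (f i) * cocircuit (E - {i}) v"
proof -
  let ?S = "support E v"
  have i: "i \<in> ?S" using assms by (simp add: support_def)
  have S': "support (E - {i}) v = ?S - {i}" by (auto simp: support_def)
  have "(\<Prod>k\<in>?S - {j}. linpoly (f k)) = linpoly (f i) * (\<Prod>k\<in>?S - {i} - {j}. linpoly (f k) :: ('m, 'n) tensor_ring)"
    if "j \<in> ?S - {i}" for j
  proof -
    have "?S - {j} - {i} = ?S - {i} - {j}" by auto
    then show ?thesis using prod.remove[of "?S - {j}" i "\<lambda>k. linpoly (f k)"] that i by auto
  qed
  then show ?thesis
    unfolding cocircuit_def S' sum.remove[OF finite i] sum_distrib_left
    by (intro arg_cong2[of _ _ _ _ "(+)"] refl sum.cong) (auto simp: mult_ac)
qed

lemma admissible_delete: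
  assumes "admissible I U E" "i \<in> E"
  shows "admissible (colon (adjoin I (weight_var i) 0 1) (linpoly (f i)) 1 0) U (E - {i})"
proof -
  define J where "J = adjoin I (weight_var i) 0 1"
  define K where "K = colon J (linpoly (f i)) 1 0"
  note J = admissible_weight_adjoin[OF assms, folded J_def]
  have le: "J \<le> K" unfolding K_def by (rule colon_superset[OF J(1) linpoly_gpart])
  have K: "graded_ideal K" unfolding K_def by (rule graded_ideal_colon[OF J(1)])
  have "cocircuit (E - {i}) v \<in> K (int (card (support (E - {i}) v)) - 1) 1" if v: "v \<in> U" for v
  proof (cases "f i v = 0")
    case True
    then show ?thesis
      using J(5)[OF v] le unfolding cocircuit_delete[OF True] support_delete[OF True] le_fun_def by blast
  next
    case False
    let ?S = "support E v"
    have "i \<in> ?S" using False assms(2) by (simp add: support_def)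
    moreover have S': "support (E - {i}) v = ?S - {i}" by (auto simp: support_def)
    ultimately have card: "int (card ?S) - 1 = int (card (support (E - {i}) v))"
      using card_Suc_Diff1[of ?S i] by simp
    have "(\<Prod>j\<in>?S - {i}. linpoly (f j)) * weight_var i \<in> J (int (card (?S - {i})) + 0) (0 + 1)"
      using J(3)[of i] by (intro graded_ideal_mult[OF J(1)] gpart_prod linpoly_gpart) auto
    then have "cst (f i v) * (weight_var i * (\<Prod>j\<in>?S - {i}. linpoly (f j))) \<in> J (int (card ?S) - 1) 1"
      unfolding card S' by (intro graded_ideal_cst[OF J(1)]) (simp add: mult.commute)
    from graded_ideal_diff[OF J(1) J(5)[OF v] this]
    have "linpoly (f i) * cocircuit (E - {i}) v \<in> J (int (card (support (E - {i}) v))) 1"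
      unfolding cocircuit_split[OF assms(2) False] card by simp
    then show ?thesis unfolding K_def colon_def using cocircuit_gpart[of "E - {i}" v] by simp
  qed
  moreover have "contains_annihilator K U" by (rule contains_annihilator_mono[OF J(2) le])
  ultimately have "admissible K U (E - {i})"
    unfolding admissible_def using K J(3,4) le unfolding le_fun_def by blast
  then show ?thesis by (simp add: K_def J_def)
qed

text \<open>A vector on the hyperplane does not have i in its support, so its relation is the same
  for E and E - {i}; only the linear forms vanishing on U change, and \<open>f i\<close> supplies
  the new ones.\<close>

lemma admissible_contract:
  assumes "admissible I U E" "i \<in> E" "vec.subspace U"
  shows "admissible (adjoin (adjoin I (weight_var i) 0 1) (linpoly (f i)) 1 0) (cut_out f U {i}) (E - {i})"
proof -
  define J where "J = adjoin I (weight_var i) 0 1"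
  define K where "K = adjoin J (linpoly (f i)) 1 0"
  note J = admissible_weight_adjoin[OF assms(1,2), folded J_def]
  have le: "J \<le> K" unfolding K_def by (rule adjoin_superset)
  have K: "graded_ideal K" unfolding K_def by (rule graded_ideal_adjoin[OF J(1) linpoly_gpart])
  have "cocircuit (E - {i}) v \<in> K (int (card (support (E - {i}) v)) - 1) 1" if "v \<in> cut_out f U {i}" for v
  proof -
    have v: "v \<in> U" "f i v = 0" using that by (auto simp: cut_out_def)
    then show ?thesis
      using J(5)[OF v(1)] le unfolding cocircuit_delete[OF v(2)] support_delete[OF v(2)] le_fun_def by blast
  qed
  moreover have "contains_annihilator K (cut_out f U {i})"
    using contains_annihilator_adjoin[OF J(1,2) assms(3) lin[of i]] by (simp add: K_def cut_out_def)
  ultimately have "admissible K (cut_out f U {i}) (E - {i})"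
    unfolding admissible_def using K J(3,4) le unfolding le_fun_def by blast
  then show ?thesis by (simp add: K_def J_def)
qed

lemma admissible_loop:
  assumes "admissible I U E" "i \<in> E" "\<And>x. x \<in> U \<Longrightarrow> f i x = 0"
  shows "admissible (adjoin I (weight_var i) 0 1) U (E - {i})"
proof -
  note J = admissible_weight_adjoin[OF assms(1,2)]
  have "cocircuit (E - {i}) v \<in> adjoin I (weight_var i) 0 1 (int (card (support (E - {i}) v)) - 1) 1"
    if v: "v \<in> U" for v
    using J(5)[OF v] assms(3)[OF v] by (simp add: cocircuit_delete support_delete)
  then show ?thesis unfolding admissible_def using J by blast
qed

lemma hdim_adjoin_weight_le:
  fixes I :: "('m, 'n) graded_family"
  assumes "graded_ideal I"
  shows "hdim I p (int (Suc q)) \<le> hdim I p (int q) + hdim (adjoin I (weight_var i) 0 1) p (int (Suc q))"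
proof -
  have "hdim I p (int (Suc q)) = hdim (colon I (weight_var i) 0 1) (p - 0) (int (Suc q) - 1)
      + hdim (adjoin I (weight_var i) 0 1) p (int (Suc q))"
    by (rule hdim_split[OF assms weight_var_gpart])
  also have "hdim (colon I (weight_var i) 0 1) (p - 0) (int (Suc q) - 1) \<le> hdim I (p - 0) (int (Suc q) - 1)"
    by (intro hdim_mono assms graded_ideal_colon colon_superset weight_var_gpart)
  finally show ?thesis by simp
qed

text \<open>A coloop i has a vector with support {i}, whose cocircuit relation is a multiple of the
  weight of i. The weight of a single remaining loop then lies in I by the Euler relation, so no
  weights survive.\<close>

lemma hdim_coloops:
  assumes adm: "admissible I U E"
    and coloop: "\<And>i x. i \<in> E \<Longrightarrow> x \<in> U \<Longrightarrow> f i x \<noteq> 0 \<Longrightarrow> \<exists>v\<in>U. f i v \<noteq> 0 \<and> (\<forall>j\<in>E - {i}. f j v = 0)"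
    and loop: "\<And>i j. i \<in> E \<Longrightarrow> j \<in> E \<Longrightarrow> (\<And>x. x \<in> U \<Longrightarrow> f i x = 0) \<Longrightarrow> (\<And>x. x \<in> U \<Longrightarrow> f j x = 0) \<Longrightarrow> i = j"
    and q: "q > 0"
  shows "hdim I p q = 0"
proof -
  have I: "graded_ideal I" and out: "\<And>j. j \<notin> E \<Longrightarrow> weight_var j \<in> I 0 1"
    and euler: "(\<Sum>i\<in>E. weight_var i) \<in> I 0 1"
    and coc: "\<And>v. v \<in> U \<Longrightarrow> cocircuit E v \<in> I (int (card (support E v)) - 1) 1"
    using adm unfolding admissible_def by auto
  have nonloop: "weight_var i \<in> I 0 1" if i: "i \<in> E" "x \<in> U" "f i x \<noteq> 0" for i x
  proof -
    obtain v where v: "v \<in> U" "f i v \<noteq> 0" "\<forall>j\<in>E - {i}. f j v = 0" using coloop[OF i] by blast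
    then have S: "support E v = {i}" using i(1) by (auto simp: support_def)
    have "cst (f i v) * weight_var i \<in> I 0 1" using coc[OF v(1)] by (simp add: cocircuit_def S)
    then have "cst (1 / f i v) * (cst (f i v) * weight_var i) \<in> I 0 1" by (rule graded_ideal_cst[OF I])
    then show ?thesis using v(2) by (simp add: mult_single flip: mult.assoc)
  qed
  have "weight_var i \<in> I 0 1" for i
  proof (cases "i \<in> E \<and> (\<forall>x\<in>U. f i x = 0)")
    case True
    have "weight_var j \<in> I 0 1" if "j \<in> E - {i}" for j
      using nonloop[of j] loop[of i j] that True by blast
    then have "(\<Sum>j\<in>E - {i}. weight_var j) \<in> I 0 1" by (intro graded_ideal_sum[OF I])
    then have "(\<Sum>j\<in>E. weight_var j) - (\<Sum>j\<in>E - {i}. weight_var j) \<in> I 0 1"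
      using graded_ideal_diff[OF I euler] by blast
    moreover have "(\<Sum>j\<in>E. weight_var j) - (\<Sum>j\<in>E - {i}. weight_var j) = (weight_var i :: ('m, 'n) tensor_ring)"
      using True sum.remove[OF finite, of i E "weight_var :: 'n \<Rightarrow> ('m, 'n) tensor_ring"] by simp
    ultimately show ?thesis by simp
  next
    case False
    then show ?thesis using out nonloop by blast
  qed
  then show ?thesis using hdim_full[OF I gpart_subset_weight_vars[OF I _ q]] by simp
qed

text \<open>An inner induction on q turns the inequality for h(p, q) - h(p, q - 1) into a bound and
  starts at q = 0. The condition \<open>card E \<le> p\<close> survives the passage to p - 1 for the
  deletion; \<open>q > 0\<close> comes from \<open>hdim_coloops\<close>.\<close>

lemma hdim_upper_bound:
  assumes "vec.subspace U" "cut_out f U E = {0}"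
  shows "\<exists>c. \<forall>I p q. admissible I U E \<longrightarrow> card E \<le> p \<longrightarrow> q > 0 \<longrightarrow>
    int (hdim I (int p) (int q)) \<le> main_term (card E) (coeff (tpoly U E)) p q + int c * int (err_term (card E) p q)"
  using assms
proof (induction rule: deletion_contraction_induct)
  case (regular U E i x)
  define n where "n = card (E - {i})"
  have card: "card E = Suc n" using regular.hyps(3) card_Suc_Diff1[of E i] by (simp add: n_def)
  have "x \<noteq> 0" using regular.hyps(5) linform_0[OF lin] by auto
  then have "E - {i} \<noteq> {}" using regular.hyps(4,6) cut_empty[of U] by (metis singletonD)
  then have n: "n > 0" by (simp add: n_def card_gt_0_iff)
  let ?t = "coeff (tpoly U E)" and ?t1 = "coeff (tpoly U (E - {i}))"
    and ?t2 = "coeff (tpoly (cut_out f U {i}) (E - {i}))"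
  have t: "?t = (\<lambda>k. ?t1 k + ?t2 k)"
    using tpoly_deletion_contraction[OF regular.hyps(1,3,4,5)] by (simp add: fun_eq_iff)
  obtain c1 where c1: "\<And>I p q. admissible I U (E - {i}) \<Longrightarrow> n \<le> p \<Longrightarrow> q > 0 \<Longrightarrow>
    int (hdim I (int p) (int q)) \<le> main_term n ?t1 p q + int c1 * int (err_term n p q)"
    using regular.IH(1) unfolding n_def by blast
  obtain c2 where c2: "\<And>I p q. admissible I (cut_out f U {i}) (E - {i}) \<Longrightarrow> n \<le> p \<Longrightarrow> q > 0 \<Longrightarrow>
    int (hdim I (int p) (int q)) \<le> main_term n ?t2 p q + int c2 * int (err_term n p q)"
    using regular.IH(2) unfolding n_def by blast
  \<comment> \<open>The summand 1 pays for the start q = 0, the others for the errors of the two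
    minors.\<close>
  define c where "c = Suc (c1 + c2)"
  have "int (hdim I (int p) (int q)) \<le> main_term (Suc n) ?t p q + int c * int (err_term (Suc n) p q)"
    if adm: "admissible I U E" and p: "Suc n \<le> p" for I p q
  proof (induction q)
    case 0
    have I: "graded_ideal I" "contains_annihilator I U" using adm by (auto simp: admissible_def)
    have le: "hdim I (int p) 0 \<le> monomial_count (vec.dim U) p" by (rule hdim_q0_le[OF I(1) regular.hyps(1) I(2)])
    have m0: "main_term (Suc n) ?t p 0 = (if vec.dim U = n then 1 else 0) * int ((p + (n - 1)) choose (n - 1))"
      unfolding main_term_0[OF n] using coeff_tpoly_top[OF regular.hyps(1,6,3,4,5)] by (simp add: n_def)
    \<comment> \<open>Since E - {i} cuts out 0, dim U is at most n. Equality gives exactly the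
      leading term at q = 0; a smaller dimension fits into the error.\<close>
    show ?case
    proof (cases "vec.dim U = n")
      case True
      obtain d where "n = Suc d" using n by (cases n) auto
      then have "int (hdim I (int p) 0) \<le> main_term (Suc n) ?t p 0"
        using le True m0 by (simp add: monomial_count_Suc_left)
      moreover have "0 \<le> int c * int (err_term (Suc n) p 0)" by simp
      ultimately show ?thesis unfolding of_nat_0 by linarith
    next
      case False
      then have "vec.dim U + 2 \<le> Suc n" using dim_le_card[OF regular.hyps(1,6)] by (simp add: n_def)
      then have "monomial_count (vec.dim U) p \<le> err_term (Suc n) p 0" using p by (intro monomial_count_le_err_term) auto
      also have "\<dots> \<le> c * err_term (Suc n) p 0" by (simp add: c_def)
      finally have "int (hdim I (int p) 0) \<le> int c * int (err_term (Suc n) p 0)"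
        using le by (metis of_nat_le_iff of_nat_mult order_trans)
      then show ?thesis using False m0 by simp
    qed
  next
    case (Suc q)
    have I: "graded_ideal I" using adm by (auto simp: admissible_def)
    let ?J = "adjoin I (weight_var i) 0 1"
    have J: "graded_ideal ?J" by (rule graded_ideal_adjoin[OF I weight_var_gpart])
    have "hdim I (int p) (int (Suc q)) \<le> hdim I (int p) (int q) + hdim ?J (int p) (int (Suc q))"
      by (rule hdim_adjoin_weight_le[OF I])
    also have "hdim ?J (int p) (int (Suc q)) = hdim (colon ?J (linpoly (f i)) 1 0) (int p - 1) (int (Suc q) - 0)
      + hdim (adjoin ?J (linpoly (f i)) 1 0) (int p) (int (Suc q))"
      by (rule hdim_split[OF J linpoly_gpart])
    also have "int p - 1 = int (p - 1)" using p by simp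
    also have "int (Suc q) - 0 = int (Suc q)" by simp
    finally have "int (hdim I (int p) (int (Suc q))) \<le> int (hdim I (int p) (int q))
        + int (hdim (colon ?J (linpoly (f i)) 1 0) (int (p - 1)) (int (Suc q)))
        + int (hdim (adjoin ?J (linpoly (f i)) 1 0) (int p) (int (Suc q)))"
      by linarith
    moreover have "int (hdim (colon ?J (linpoly (f i)) 1 0) (int (p - 1)) (int (Suc q)))
        \<le> main_term n ?t1 (p - 1) (Suc q) + int c1 * int (err_term n (p - 1) (Suc q))"
      using p by (intro c1 admissible_delete adm regular.hyps(3)) auto
    moreover have "main_term n ?t1 (p - 1) (Suc q) \<le> main_term n ?t1 p (Suc q)"
      by (intro main_term_mono coeff_tpoly_nonneg regular.hyps) auto
    moreover have "int c1 * int (err_term n (p - 1) (Suc q)) \<le> int c1 * int (err_term n p (Suc q))"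
      by (intro mult_left_mono) (auto intro: err_term_mono)
    moreover have "int (hdim (adjoin ?J (linpoly (f i)) 1 0) (int p) (int (Suc q)))
        \<le> main_term n ?t2 p (Suc q) + int c2 * int (err_term n p (Suc q))"
      using p by (intro c2 admissible_contract adm regular.hyps(1,3)) auto
    moreover have "main_term (Suc n) ?t p (Suc q)
        = main_term (Suc n) ?t p q + (main_term n ?t1 p (Suc q) + main_term n ?t2 p (Suc q))"
      unfolding main_term_Suc[OF n] by (simp add: t main_term_add)
    moreover have "int c * int (err_term (Suc n) p (Suc q))
        = int c * int (err_term (Suc n) p q) + int c * int (err_term n p (Suc q))"
      by (simp add: err_term_Suc distrib_left)
    moreover have "int c1 * int (err_term n p (Suc q)) + int c2 * int (err_term n p (Suc q))
        \<le> int c * int (err_term n p (Suc q))"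
      by (simp add: c_def distrib_right)
    ultimately show ?case using Suc.IH by linarith
  qed
  then show ?case unfolding card by blast
next
  case (loops U E i j)
  define n where "n = card (E - {i})"
  have card: "card E = Suc n" using loops.hyps(3) card_Suc_Diff1[of E i] by (simp add: n_def)
  have n: "n > 0" using loops.hyps(4) by (auto simp: n_def card_gt_0_iff)
  have t: "tpoly U E = 0" "tpoly U (E - {i}) = 0"
    using tpoly_loop[OF loops.hyps(3,5)] tpoly_loop[OF loops.hyps(4,6)] by auto
  \<comment> \<open>Two loops leave n - 1 forms to cut out 0. Hence already the start q = 0 is an
    error term, in agreement with a vanishing \<open>tpoly\<close>.\<close>
  have dim: "vec.dim U + 2 \<le> Suc n"
  proof -
    have "card (E - {i, j}) + 1 = n"
      using loops.hyps(4) card_Suc_Diff1[of "E - {i}" j] unfolding n_def Diff_insert2[of E i "{j}"] by auto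
    then show ?thesis using dim_le_card[OF loops.hyps(1,7)] by simp
  qed
  obtain c where c: "\<And>I p q. admissible I U (E - {i}) \<Longrightarrow> n \<le> p \<Longrightarrow> q > 0 \<Longrightarrow>
    int (hdim I (int p) (int q)) \<le> int c * int (err_term n p q)"
    using loops.IH unfolding n_def t by (auto simp: main_term_def)
  have "hdim I (int p) (int q) \<le> Suc c * err_term (Suc n) p q"
    if adm: "admissible I U E" and p: "Suc n \<le> p" for I p q
  proof (induction q)
    case 0
    have I: "graded_ideal I" "contains_annihilator I U" using adm by (auto simp: admissible_def)
    have "hdim I (int p) 0 \<le> monomial_count (vec.dim U) p" by (rule hdim_q0_le[OF I(1) loops.hyps(1) I(2)])
    also have "\<dots> \<le> err_term (Suc n) p 0" using p dim by (intro monomial_count_le_err_term) auto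
    finally show ?case by simp
  next
    case (Suc q)
    have I: "graded_ideal I" using adm by (auto simp: admissible_def)
    let ?J = "adjoin I (weight_var i) 0 1"
    have "admissible ?J U (E - {i})" by (rule admissible_loop[OF adm loops.hyps(3,5)])
    then have "int (hdim ?J (int p) (int (Suc q))) \<le> int c * int (err_term n p (Suc q))"
      using p by (intro c) auto
    then have "hdim ?J (int p) (int (Suc q)) \<le> c * err_term n p (Suc q)" by (metis of_nat_le_iff of_nat_mult)
    then have "hdim I (int p) (int (Suc q)) \<le> Suc c * err_term (Suc n) p q + c * err_term n p (Suc q)"
      using hdim_adjoin_weight_le[OF I, of "int p" q i] Suc.IH by linarith
    then show ?case by (simp add: err_term_Suc distrib_left)
  qed
  note bound = this
  have "int (hdim I (int p) (int q)) \<le> main_term (Suc n) (coeff (tpoly U E)) p q + int (Suc c) * int (err_term (Suc n) p q)"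
    if "admissible I U E" "Suc n \<le> p" for I p q
  proof -
    have "int (hdim I (int p) (int q)) \<le> int (Suc c * err_term (Suc n) p q)"
      using bound[OF that] by (simp only: of_nat_le_iff)
    then show ?thesis unfolding t by (simp add: main_term_def distrib_right)
  qed
  then show ?case unfolding card by blast
next
  case (coloops U E)
  have "tpoly U E = 0 \<or> tpoly U E = monom 1 (card E)"
    by (rule tpoly_coloops[OF coloops(1,2)]) (erule (2) coloops(3))
  \<comment> \<open>\<open>main_term\<close> reads only the coefficients 1 to n - 1, so the monomial
    x^n of independent forms does not show.\<close>
  then have main: "main_term (card E) (coeff (tpoly U E)) p q = 0" for p q
    by (intro main_term_eq_0) auto
  have "hdim I p q = 0" if "admissible I U E" "q > 0" for I p q
  proof (rule hdim_coloops[OF that(1) _ _ that(2)])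
    fix i x assume "i \<in> E" "x \<in> U" "f i x \<noteq> 0"
    then show "\<exists>v\<in>U. f i v \<noteq> 0 \<and> (\<forall>j\<in>E - {i}. f j v = 0)" by (rule coloops(3))
  next
    fix i j assume "i \<in> E" "j \<in> E" "\<And>x. x \<in> U \<Longrightarrow> f i x = 0" "\<And>x. x \<in> U \<Longrightarrow> f j x = 0"
    then show "i = j" by (rule coloops(4))
  qed
  then show ?case by (simp add: main)
qed

end

section \<open>The lower bound\<close>

context
  fixes x :: "complex ^ 'm::finite" and a :: "'n::finite \<Rightarrow> complex"
begin

interpretation ev: poly_mapping_hom "\<lambda>c :: complex. c"
  "\<lambda>(\<alpha>, \<beta>). (\<Prod>k\<in>UNIV. x $ k ^ Poly_Mapping.lookup \<alpha> k) * (\<Prod>i\<in>UNIV. a i ^ Poly_Mapping.lookup \<beta> i)"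
  by unfold_locales
    (auto simp: split_def zero_prod_def plus_prod_def lookup_add power_add prod.distrib mult_ac)

definition tensor_eval :: "('m, 'n) tensor_ring \<Rightarrow> complex" where
  "tensor_eval = ev.app"

lemmas tensor_eval_0 = ev.app_0[folded tensor_eval_def]
  and tensor_eval_1 = ev.app_1[folded tensor_eval_def]
  and tensor_eval_add = ev.app_add[folded tensor_eval_def]
  and tensor_eval_mult = ev.app_mult[folded tensor_eval_def]
  and tensor_eval_sum = ev.app_sum[folded tensor_eval_def]
  and tensor_eval_prod = ev.app_prod[folded tensor_eval_def]

lemma tensor_eval_expand: "tensor_eval F = (\<Sum>k\<in>Poly_Mapping.keys F. Poly_Mapping.lookup F k *
    ((\<Prod>l\<in>UNIV. x $ l ^ Poly_Mapping.lookup (fst k) l) * (\<Prod>i\<in>UNIV. a i ^ Poly_Mapping.lookup (snd k) i)))"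
  unfolding tensor_eval_def ev.app_def by (simp add: split_def)

lemma tensor_eval_cst: "tensor_eval (cst c) = c"
  unfolding tensor_eval_def by (simp add: ev.app_single zero_prod_def)

lemma tensor_eval_coord_var: "tensor_eval (coord_var k) = x $ k"
proof -
  have "(\<Prod>l\<in>UNIV. x $ l ^ Poly_Mapping.lookup (Poly_Mapping.single k 1) l) = (\<Prod>l\<in>UNIV. if l = k then x $ k else 1)"
    by (intro prod.cong) (auto simp: lookup_single when_def)
  then show ?thesis
    unfolding tensor_eval_def coord_var_def by (simp add: ev.app_single)
qed

lemma tensor_eval_weight_var: "tensor_eval (weight_var i) = a i"
proof -
  have "(\<Prod>l\<in>UNIV. a l ^ Poly_Mapping.lookup (Poly_Mapping.single i 1) l) = (\<Prod>l\<in>UNIV. if l = i then a i else 1)"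
    by (intro prod.cong) (auto simp: lookup_single when_def)
  then show ?thesis
    unfolding tensor_eval_def weight_var_def by (simp add: ev.app_single)
qed

end

lemma linform_sum: "linform h \<Longrightarrow> h (sum g A) = (\<Sum>k\<in>A. h (g k))"
  by (induction A rule: infinite_finite_induct) (auto simp: linform_0 linform_add)

lemma linform_expand:
  assumes "linform h"
  shows "h x = (\<Sum>k\<in>UNIV. h (axis k 1) * x $ k)"
proof -
  have "h x = h (\<Sum>k\<in>UNIV. x $ k *s axis k 1)" by (simp add: basis_expansion)
  also have "\<dots> = (\<Sum>k\<in>UNIV. h (axis k 1) * x $ k)"
    by (simp add: linform_sum[OF assms] linform_scale[OF assms] mult.commute)
  finally show ?thesis .
qed

lemma tensor_eval_linpoly: "linform h \<Longrightarrow> tensor_eval x a (linpoly h) = h x"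
  using linform_expand[of h x]
  by (simp add: linpoly_def tensor_eval_sum tensor_eval_mult tensor_eval_cst tensor_eval_coord_var)

lemmas tensor_eval_simps = tensor_eval_0 tensor_eval_1 tensor_eval_add tensor_eval_mult tensor_eval_sum
  tensor_eval_prod tensor_eval_cst tensor_eval_coord_var tensor_eval_weight_var

lemma isCont_tensor_eval:
  fixes X :: "complex \<Rightarrow> complex ^ 'm::finite" and A :: "complex \<Rightarrow> 'n::finite \<Rightarrow> complex"
  assumes "\<And>k. isCont (\<lambda>t. X t $ k) t" "\<And>i. isCont (\<lambda>t. A t i) t"
  shows "isCont (\<lambda>t. tensor_eval (X t) (A t) F) t"
  unfolding tensor_eval_expand by (intro continuous_intros assms)

text \<open>Stands in for cancellation in a domain: if the product of G with an affine function of
  nonzero slope vanishes, then G vanishes off the single root of that function, and at 0 by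
  continuity.\<close>

lemma zero_by_continuity:
  fixes G :: "complex \<Rightarrow> complex"
  assumes "isCont G 0" "b \<noteq> 0" "\<And>t. a + t * b \<noteq> 0 \<Longrightarrow> G t = 0"
  shows "G 0 = 0"
proof -
  have "\<forall>\<^sub>F t in at 0. t \<noteq> - a / b" by (rule eventually_neq_at_within)
  then have "\<forall>\<^sub>F t in at 0. G t = 0"
  proof (rule eventually_mono)
    fix t assume "t \<noteq> - a / b"
    then have "a + t * b \<noteq> 0" using assms(2) by (auto simp: field_simps add_eq_0_iff)
    then show "G t = 0" by (rule assms(3))
  qed
  then have "(G \<longlongrightarrow> 0) (at 0)" by (rule tendsto_eventually)
  moreover have "(G \<longlongrightarrow> G 0) (at 0)" using assms(1) by (simp add: isCont_def)
  ultimately show ?thesis using LIM_unique by blast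
qed

text \<open>Reverses the recursion of \<open>hdim_q0_le\<close>: polynomials independent on the
  hyperplane x_k = 0 of U, together with x_k times polynomials independent on U.\<close>

lemma independent_polynomials_on_subspace:
  assumes "vec.subspace U"
  shows "\<exists>us :: ('m::finite, 'n::finite) tensor_ring list. set us \<subseteq> gpart (int p) 0 \<and>
    length us = monomial_count (vec.dim U) p \<and> indep_mod {F. \<forall>x\<in>U. tensor_eval x (\<lambda>_. 0) F = 0} us"
  using assms
proof (induction "vec.dim U + p" arbitrary: U p rule: less_induct)
  case less
  note U = less.prems
  have U0: "0 \<in> U" by (rule vec.subspace_0[OF U])
  show ?case
  proof (cases p)
    case 0
    have "indep_mod {F. \<forall>x\<in>U. tensor_eval x (\<lambda>_. 0) F = 0} [1 :: ('m, 'n) tensor_ring]"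
      using U0 by (auto simp: indep_mod_def lincomb_def tensor_eval_simps)
    then show ?thesis using 0 by (intro exI[of _ "[1]"]) auto
  next
    case (Suc r)
    show ?thesis
    proof (cases "U = {0}")
      case True
      then show ?thesis using Suc by (intro exI[of _ "[]"]) (auto simp: indep_mod_def)
    next
      case False
      then obtain u where u: "u \<in> U" "u \<noteq> 0" using U0 by blast
      then obtain k where k: "u $ k \<noteq> 0" by (auto simp: vec_eq_iff)
      let ?h = "\<lambda>x :: complex ^ 'm. x $ k"
      let ?W = "{x \<in> U. ?h x = 0}"
      have d: "vec.dim U = Suc (vec.dim ?W)" by (rule dim_kernel[OF U linform_component u(1) k])
      obtain us :: "('m, 'n) tensor_ring list" where us: "set us \<subseteq> gpart (int r) 0" "length us = monomial_count (vec.dim U) r"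
        "indep_mod {F. \<forall>x\<in>U. tensor_eval x (\<lambda>_. 0) F = 0} us"
        using less.hyps[of U r] U Suc by auto
      obtain vs :: "('m, 'n) tensor_ring list" where vs: "set vs \<subseteq> gpart (int p) 0" "length vs = monomial_count (vec.dim ?W) p"
        "indep_mod {F. \<forall>x\<in>?W. tensor_eval x (\<lambda>_. 0) F = 0} vs"
        using less.hyps[OF _ subspace_kernel[OF U linform_component], of k p] d by auto
      let ?ws = "map ((*) (coord_var k)) us @ vs"
      have "coord_var k * g \<in> gpart (int p) 0" if "g \<in> set us" for g
        using gpart_mult[OF coord_var_gpart, of g "int r" 0 k] us(1) that Suc by auto
      then have "set ?ws \<subseteq> gpart (int p) 0" using vs(1) by auto
      moreover have "length ?ws = monomial_count (vec.dim U) p" using us(2) vs(2) by (simp add: d Suc monomial_count_Suc)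
      moreover have "indep_mod {F. \<forall>x\<in>U. tensor_eval x (\<lambda>_. 0) F = 0} ?ws"
        unfolding indep_mod_def
      proof (intro allI impI)
        fix e j assume e: "lincomb e ?ws \<in> {F. \<forall>x\<in>U. tensor_eval x (\<lambda>_. 0) F = 0}" and j: "j < length ?ws"
        let ?e = "\<lambda>l. e (l + length us)"
        have sum0: "x $ k * tensor_eval x (\<lambda>_. 0) (lincomb e us) + tensor_eval x (\<lambda>_. 0) (lincomb ?e vs) = 0"
          if "x \<in> U" for x
          using e that by (simp add: lincomb_append lincomb_map_mult tensor_eval_simps)
        have "lincomb ?e vs \<in> {F. \<forall>x\<in>?W. tensor_eval x (\<lambda>_. 0) F = 0}"
        proof (intro CollectI ballI)
          fix x assume "x \<in> ?W"
          then show "tensor_eval x (\<lambda>_. 0) (lincomb ?e vs) = 0" using sum0[of x] by simp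
        qed
        then have ve: "?e l = 0" if "l < length vs" for l using vs(3) that unfolding indep_mod_def by blast
        then have "lincomb ?e vs = 0" by (intro lincomb_zero) auto
        then have sum0': "x $ k * tensor_eval x (\<lambda>_. 0) (lincomb e us) = 0" if "x \<in> U" for x
          using sum0[OF that] by (simp add: tensor_eval_0)
        have "tensor_eval x (\<lambda>_. 0) (lincomb e us) = 0" if x: "x \<in> U" for x
        proof -
          have "tensor_eval (x + 0 *s u) (\<lambda>_. 0) (lincomb e us) = 0"
          proof (rule zero_by_continuity[OF _ k, where a = "x $ k" and G = "\<lambda>t. tensor_eval (x + t *s u) (\<lambda>_. 0) (lincomb e us)"])
            show "isCont (\<lambda>t. tensor_eval (x + t *s u) (\<lambda>_. 0) (lincomb e us)) 0"
              by (intro isCont_tensor_eval) (auto intro!: continuous_intros)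
            fix t assume t: "x $ k + t * u $ k \<noteq> 0"
            have "x + t *s u \<in> U" using x u(1) U by (simp add: vec.subspace_add vec.subspace_scale)
            then show "tensor_eval (x + t *s u) (\<lambda>_. 0) (lincomb e us) = 0" using sum0'[of "x + t *s u"] t by simp
          qed
          then show ?thesis by simp
        qed
        then have ue: "\<forall>l<length us. e l = 0" using us(3) unfolding indep_mod_def by blast
        show "e j = 0" using ue ve[of "j - length us"] j by (cases "j < length us") auto
      qed
      ultimately show ?thesis by blast
    qed
  qed
qed

section \<open>Points over linear relations of the forms\<close>

context forms
begin

text \<open>Where no form vanishes, the critical equation of the weights \<open>a\<close> at \<open>x\<close> says that
  \<open>a\<^sub>i = f\<^sub>i(x) y\<^sub>i\<close> for a linear relation \<open>y\<close> of the forms.\<close>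

definition relations :: "(complex ^ 'm) set \<Rightarrow> 'n set \<Rightarrow> ('n \<Rightarrow> complex) set" where
  "relations U E = {y. (\<forall>i. i \<notin> E \<longrightarrow> y i = 0) \<and> (\<forall>x\<in>U. (\<Sum>i\<in>UNIV. y i * f i x) = 0)}"

abbreviation critical_eval :: "complex ^ 'm \<Rightarrow> ('n \<Rightarrow> complex) \<Rightarrow> ('m, 'n) tensor_ring \<Rightarrow> complex" where
  "critical_eval x y \<equiv> tensor_eval x (\<lambda>i. f i x * y i)"

text \<open>The substitution a_i = f_i(x) y_i is polynomial and also defined where forms vanish. The
  test points are thus parametrized by the linear space of all (x, y), in which factors can be
  cancelled along lines.\<close>

definition vanishing_ideal :: "(complex ^ 'm) set \<Rightarrow> 'n set \<Rightarrow> ('m, 'n) tensor_ring set" where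
  "vanishing_ideal U E = {F. \<forall>x\<in>U. \<forall>y\<in>relations U E. critical_eval x y F = 0}"

lemma linform_weighted_sum: "linform (\<lambda>x. \<Sum>i\<in>E. c i * f i x)"
  unfolding linform_def
  by (simp add: linform_add[OF lin] linform_scale[OF lin] distrib_left sum.distrib sum_distrib_left mult_ac)

text \<open>Eliminates one form at a time: on the kernel of \<open>f i\<close> the other forms
  suffice, and the difference is then a multiple of \<open>f i\<close> on U.\<close>

lemma linform_combination_exists:
  assumes "vec.subspace U" "linform g" "\<And>x. x \<in> U \<Longrightarrow> (\<forall>i\<in>E. f i x = 0) \<Longrightarrow> g x = 0"
  shows "\<exists>c. \<forall>x\<in>U. g x = (\<Sum>i\<in>E. c i * f i x)"
  using finite[of E] assms
proof (induction E arbitrary: U rule: finite_induct)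
  case (insert i E)
  have "\<exists>c. \<forall>x\<in>cut_out f U {i}. g x = (\<Sum>j\<in>E. c j * f j x)"
    using insert.prems by (intro insert.IH subspace_cut) (auto simp: cut_out_def)
  then obtain c where c: "\<And>x. x \<in> U \<Longrightarrow> f i x = 0 \<Longrightarrow> g x = (\<Sum>j\<in>E. c j * f j x)" by (auto simp: cut_out_def)
  have "linform (\<lambda>x. g x - 1 * (\<Sum>j\<in>E. c j * f j x))"
    by (intro linform_combination insert.prems linform_weighted_sum)
  then obtain d where d: "\<And>x. x \<in> U \<Longrightarrow> g x - 1 * (\<Sum>j\<in>E. c j * f j x) = d * f i x"
    by (rule linform_multiple[OF insert.prems(1) _ lin[of i]]) (use c in auto)
  have "g x = (\<Sum>j\<in>insert i E. (c(i := d)) j * f j x)" if "x \<in> U" for x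
  proof -
    have "(\<Sum>j\<in>E. (c(i := d)) j * f j x) = (\<Sum>j\<in>E. c j * f j x)"
      using insert.hyps(2) by (intro sum.cong) auto
    then show ?thesis using d[OF that] insert.hyps by (simp add: algebra_simps)
  qed
  then show ?case by blast
qed simp

text \<open>If the other forms already cut out 0, then \<open>f i\<close> is a combination of them
  on U. This is where i must not be a coloop.\<close>

lemma relation_through:
  assumes "vec.subspace U" "i \<in> E" "cut_out f U (E - {i}) = {0}"
  obtains y where "y \<in> relations U E" "y i \<noteq> 0"
proof -
  have "f i x = 0" if "x \<in> U" "\<forall>j\<in>E - {i}. f j x = 0" for x
  proof -
    have "x \<in> cut_out f U (E - {i})" using that by (simp add: cut_out_def)
    then show ?thesis using assms(3) linform_0[OF lin] by simp
  qed
  then obtain c where c: "\<And>x. x \<in> U \<Longrightarrow> f i x = (\<Sum>j\<in>E - {i}. c j * f j x)"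
    using linform_combination_exists[OF assms(1) lin, of "E - {i}" i] by blast
  let ?y = "\<lambda>j. if j = i then -1 else if j \<in> E then c j else 0"
  have "(\<Sum>j\<in>UNIV. ?y j * f j x) = 0" if "x \<in> U" for x
  proof -
    have "(\<Sum>j\<in>UNIV. ?y j * f j x) = (\<Sum>j\<in>E. ?y j * f j x)"
      using assms(2) by (intro sum.mono_neutral_right) auto
    also have "\<dots> = - f i x + (\<Sum>j\<in>E - {i}. ?y j * f j x)"
      by (simp add: sum.remove[OF finite assms(2)])
    also have "(\<Sum>j\<in>E - {i}. ?y j * f j x) = (\<Sum>j\<in>E - {i}. c j * f j x)"
      by (intro sum.cong) auto
    finally show ?thesis using c[OF that] by simp
  qed
  then have "?y \<in> relations U E" using assms(2) by (auto simp: relations_def)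
  then show ?thesis using that by force
qed

lemma relations_add_scale: "y \<in> relations U E \<Longrightarrow> z \<in> relations U E \<Longrightarrow> (\<lambda>i. y i + t * z i) \<in> relations U E"
  unfolding relations_def by (simp add: distrib_right sum.distrib mult.assoc flip: sum_distrib_left)

lemma relations_delete: "relations U (E - {i}) \<subseteq> relations U E"
  unfolding relations_def by auto

text \<open>Only coordinate i has to be corrected, and at points with \<open>f i x = 0\<close> this
  coordinate has no influence on the substituted weights.\<close>

lemma relations_contract:
  assumes "vec.subspace U" "i \<in> E" "y \<in> relations (cut_out f U {i}) (E - {i})"
  obtains z where "z \<in> relations U E" "\<And>j. j \<noteq> i \<Longrightarrow> z j = y j"
proof -
  have yi: "y i = 0" using assms(3) by (simp add: relations_def)
  have "(\<Sum>j\<in>UNIV. y j * f j x) = 0" if "x \<in> U" "f i x = 0" for x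
    using assms(3) that by (simp add: relations_def cut_out_def)
  then obtain d where d: "\<And>x. x \<in> U \<Longrightarrow> (\<Sum>j\<in>UNIV. y j * f j x) = d * f i x"
    using linform_multiple[OF assms(1) linform_weighted_sum lin[of i]] by metis
  have "(\<Sum>j\<in>UNIV. (y(i := - d)) j * f j x) = 0" if "x \<in> U" for x
  proof -
    have "(\<Sum>j\<in>UNIV. (y(i := - d)) j * f j x) = - d * f i x + (\<Sum>j\<in>UNIV - {i}. y j * f j x)"
      by (simp add: sum.remove[of UNIV i])
    also have "(\<Sum>j\<in>UNIV - {i}. y j * f j x) = (\<Sum>j\<in>UNIV. y j * f j x)"
      by (simp add: sum.remove[of UNIV i] yi)
    finally show ?thesis using d[OF that] by simp
  qed
  then have "y(i := - d) \<in> relations U E"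
    using assms(2,3) by (auto simp: relations_def)
  then show ?thesis using that by simp
qed

text \<open>x moves along u, where \<open>f i\<close> is not constant, while y is fixed. The
  constant c leaves room for a factor \<open>y i\<close>, which is cancelled afterwards by moving
  y.\<close>

lemma vanishing_ideal_cancel_form:
  assumes U: "vec.subspace U" "u \<in> U" "f i u \<noteq> 0"
    and zero: "\<And>x. x \<in> U \<Longrightarrow> f i x * (c * critical_eval x y F) = 0" and x: "x \<in> U"
  shows "c * critical_eval x y F = 0"
proof -
  let ?X = "\<lambda>t. x + t *s u"
  have "c * critical_eval (?X 0) y F = 0"
  proof (rule zero_by_continuity[OF _ U(3), where a = "f i x" and G = "\<lambda>t. c * critical_eval (?X t) y F"])
    have "isCont (\<lambda>t. critical_eval (?X t) y F) 0"
      by (intro isCont_tensor_eval) (auto simp: linform_add[OF lin] linform_scale[OF lin] intro!: continuous_intros)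
    then show "isCont (\<lambda>t. c * critical_eval (?X t) y F) 0" by (intro continuous_intros)
    fix t assume t: "f i x + t * f i u \<noteq> 0"
    have "?X t \<in> U" using x U by (simp add: vec.subspace_add vec.subspace_scale)
    from zero[OF this] t show "c * critical_eval (?X t) y F = 0"
      by (simp add: linform_add[OF lin] linform_scale[OF lin])
  qed
  then show ?thesis by simp
qed

lemma vanishing_ideal_cancel_relation:
  assumes z: "z \<in> relations U E" "z i \<noteq> 0"
    and zero: "\<And>y. y \<in> relations U E \<Longrightarrow> y i * critical_eval x y F = 0" and y: "y \<in> relations U E"
  shows "critical_eval x y F = 0"
proof -
  have "critical_eval x (\<lambda>j. y j + 0 * z j) F = 0"
  proof (rule zero_by_continuity[OF _ z(2), where a = "y i" and G = "\<lambda>t. critical_eval x (\<lambda>j. y j + t * z j) F"])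
    show "isCont (\<lambda>t. critical_eval x (\<lambda>j. y j + t * z j) F) 0"
      by (intro isCont_tensor_eval) (auto intro!: continuous_intros)
    fix t assume "y i + t * z i \<noteq> 0"
    then show "critical_eval x (\<lambda>j. y j + t * z j) F = 0"
      using zero[OF relations_add_scale[OF y z(1), of t]] by simp
  qed
  then show ?thesis by simp
qed

text \<open>The blocks are separated in the order of specialization. At \<open>f i x = 0\<close> the
  first two vanish, which leaves ws. At \<open>y i = 0\<close> the first vanishes, and cancelling
  \<open>f i\<close> leaves vs. In general \<open>f i x * y i\<close> is cancelled, which leaves
  us.\<close>

lemma vanishing_ideal_deletion_contraction:
  assumes U: "vec.subspace U" "i \<in> E" "u \<in> U" "f i u \<noteq> 0" "cut_out f U (E - {i}) = {0}"
    and us: "indep_mod (vanishing_ideal U E) us"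
    and vs: "indep_mod (vanishing_ideal U (E - {i})) vs"
    and ws: "indep_mod (vanishing_ideal (cut_out f U {i}) (E - {i})) ws"
  shows "indep_mod (vanishing_ideal U E) (map ((*) (weight_var i)) us @ map ((*) (linpoly (f i))) vs @ ws)"
  unfolding indep_mod_def
proof (intro allI impI)
  let ?l = "map ((*) (weight_var i)) us @ map ((*) (linpoly (f i))) vs @ ws"
  fix e j assume e: "lincomb e ?l \<in> vanishing_ideal U E" and j: "j < length ?l"
  define e1 where "e1 k = e (k + length us)" for k
  define e2 where "e2 k = e1 (k + length vs)" for k
  let ?A = "lincomb e us" and ?B = "lincomb e1 vs" and ?C = "lincomb e2 ws"
  have "lincomb e ?l = weight_var i * ?A + (linpoly (f i) * ?B + ?C)"
    by (simp add: lincomb_append lincomb_map_mult e1_def[abs_def] e2_def[abs_def] add_ac)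
  then have zero: "f i x * y i * critical_eval x y ?A
      + (f i x * critical_eval x y ?B + critical_eval x y ?C) = 0"
    if "x \<in> U" "y \<in> relations U E" for x y
    using e that by (simp add: vanishing_ideal_def tensor_eval_simps tensor_eval_linpoly[OF lin])
  have "?C \<in> vanishing_ideal (cut_out f U {i}) (E - {i})"
    unfolding vanishing_ideal_def
  proof (intro CollectI ballI)
    fix x y assume x: "x \<in> cut_out f U {i}" and y: "y \<in> relations (cut_out f U {i}) (E - {i})"
    obtain z where z: "z \<in> relations U E" "\<And>j. j \<noteq> i \<Longrightarrow> z j = y j" using relations_contract[OF U(1,2) y] by blast
    have fx: "x \<in> U" "f i x = 0" using x by (auto simp: cut_out_def)
    have "(\<lambda>j. f j x * z j) = (\<lambda>j. f j x * y j)" 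
    proof
      fix j show "f j x * z j = f j x * y j" using fx(2) z(2) by (cases "j = i") auto
    qed
    then show "critical_eval x y ?C = 0" using zero[OF fx(1) z(1)] fx(2) by simp
  qed
  then have e2: "\<forall>k<length ws. e2 k = 0" using ws unfolding indep_mod_def by blast
  then have "?C = 0" by (intro lincomb_zero) auto
  then have zero': "f i x * y i * critical_eval x y ?A
      + f i x * critical_eval x y ?B = 0"
    if "x \<in> U" "y \<in> relations U E" for x y
    using zero[OF that] by (simp add: tensor_eval_0)
  have "?B \<in> vanishing_ideal U (E - {i})"
    unfolding vanishing_ideal_def
  proof (intro CollectI ballI)
    fix x y assume x: "x \<in> U" and y: "y \<in> relations U (E - {i})"
    have yi: "y i = 0" using y by (simp add: relations_def)
    have yE: "y \<in> relations U E" using y relations_delete by blast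
    have "1 * critical_eval x y ?B = 0"
      by (rule vanishing_ideal_cancel_form[OF U(1,3,4) _ x]) (use zero'[OF _ yE] yi in simp)
    then show "critical_eval x y ?B = 0" by simp
  qed
  then have e1: "\<forall>k<length vs. e1 k = 0" using vs unfolding indep_mod_def by blast
  then have "?B = 0" by (intro lincomb_zero) auto
  then have zero'': "f i x * (y i * critical_eval x y ?A) = 0"
    if "x \<in> U" "y \<in> relations U E" for x y
    using zero'[OF that] by (simp add: tensor_eval_0)
  have zero3: "y i * critical_eval x y ?A = 0" if "x \<in> U" "y \<in> relations U E" for x y
    by (rule vanishing_ideal_cancel_form[OF U(1,3,4) zero''[OF _ that(2)] that(1)])
  obtain z where z: "z \<in> relations U E" "z i \<noteq> 0" by (rule relation_through[OF U(1,2,5)])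
  have "?A \<in> vanishing_ideal U E"
    unfolding vanishing_ideal_def
  proof (intro CollectI ballI)
    fix x y assume x: "x \<in> U" and y: "y \<in> relations U E"
    show "critical_eval x y ?A = 0"
      by (rule vanishing_ideal_cancel_relation[OF z zero3[OF x] y])
  qed
  then have e0: "\<forall>k<length us. e k = 0" using us unfolding indep_mod_def by blast
  consider "j < length us" | k where "j = k + length us" "k < length vs"
    | k where "j = k + length vs + length us" "k < length ws"
  proof -
    assume a: "j < length us \<Longrightarrow> thesis" "\<And>k. j = k + length us \<Longrightarrow> k < length vs \<Longrightarrow> thesis"
      "\<And>k. j = k + length vs + length us \<Longrightarrow> k < length ws \<Longrightarrow> thesis"
    show thesis using a(1) a(2)[of "j - length us"] a(3)[of "j - length us - length vs"] j by force
  qed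
  then show "e j = 0"
  proof cases
    case 1
    then show ?thesis using e0 by simp
  next
    case 2
    then show ?thesis using e1 by (simp add: e1_def)
  next
    case 3
    then show ?thesis using e2 by (simp add: e1_def e2_def)
  qed
qed

text \<open>The deletion spends one degree of p on the factor \<open>f i\<close> and has one form
  less, so p - card E is unchanged; in the restriction it grows by one, which
  \<open>main_term_mono\<close> allows. Where the leading term vanishes the empty list
  suffices.\<close>

lemma independent_lower_bound:
  assumes "vec.subspace U" "cut_out f U E = {0}"
  shows "card E \<le> p \<Longrightarrow> q > 0 \<Longrightarrow> \<exists>us. set us \<subseteq> gpart (int p) (int q) \<and> indep_mod (vanishing_ideal U E) us \<and>
    main_term (card E) (coeff (tpoly U E)) (p - card E) q \<le> int (length us)"
  using assms
proof (induction arbitrary: p q rule: deletion_contraction_induct)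
  case (regular U E i x)
  define n where "n = card (E - {i})"
  have card: "card E = Suc n" using regular.hyps(3) card_Suc_Diff1[of E i] by (simp add: n_def)
  have "x \<noteq> 0" using regular.hyps(5) linform_0[OF lin] by auto
  then have "E - {i} \<noteq> {}" using regular.hyps(4,6) cut_empty[of U] by (metis singletonD)
  then have n: "n > 0" by (simp add: n_def card_gt_0_iff)
  have p: "Suc n \<le> p" using regular.prems(1) card by simp
  let ?t = "coeff (tpoly U E)" and ?t1 = "coeff (tpoly U (E - {i}))"
    and ?t2 = "coeff (tpoly (cut_out f U {i}) (E - {i}))"
  have t: "?t = (\<lambda>k. ?t1 k + ?t2 k)"
    using tpoly_deletion_contraction[OF regular.hyps(1,3,4,5)] by (simp add: fun_eq_iff)
  have "\<exists>us. set us \<subseteq> gpart (int p) (int q) \<and> indep_mod (vanishing_ideal U E) us \<and>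
    main_term (Suc n) ?t (p - Suc n) q \<le> int (length us)" for q
  proof (induction q)
    case 0
    obtain us :: "('m, 'n) tensor_ring list" where us: "set us \<subseteq> gpart (int p) 0" "length us = monomial_count (vec.dim U) p"
      "indep_mod {F. \<forall>x\<in>U. tensor_eval x (\<lambda>_. 0) F = 0} us"
      using independent_polynomials_on_subspace[OF regular.hyps(1)] by blast
    \<comment> \<open>The relation y = 0 makes all points (x, 0) test points, and polynomials
      without weights are already independent there.\<close>
    have "(\<lambda>_. 0) \<in> relations U E" by (simp add: relations_def)
    then have "vanishing_ideal U E \<subseteq> {F. \<forall>x\<in>U. tensor_eval x (\<lambda>_. 0) F = 0}"
      unfolding vanishing_ideal_def by force
    then have "indep_mod (vanishing_ideal U E) us" using us(3) unfolding indep_mod_def by blast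
    moreover have "main_term (Suc n) ?t (p - Suc n) 0 \<le> int (length us)"
    proof (cases "vec.dim U = n")
      case True
      obtain d where d: "n = Suc d" using n by (cases n) auto
      have "(p - Suc n + d) choose d \<le> (p + d) choose d" by (rule binomial_right_mono) simp
      then show ?thesis
        unfolding main_term_0[OF n] using coeff_tpoly_top[OF regular.hyps(1,6,3,4,5)] True us(2)
        by (simp add: n_def[symmetric] d monomial_count_Suc_left)
    next
      case False
      then show ?thesis
        unfolding main_term_0[OF n] using coeff_tpoly_top[OF regular.hyps(1,6,3,4,5)]
        by (simp add: n_def[symmetric])
    qed
    ultimately show ?case using us(1) by auto
  next
    case (Suc q)
    have p1: "n \<le> p - 1" and p2: "n \<le> p" and eq: "p - 1 - n = p - Suc n" using p by auto
    obtain us where us: "set us \<subseteq> gpart (int p) (int q)" "indep_mod (vanishing_ideal U E) us"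
      "main_term (Suc n) ?t (p - Suc n) q \<le> int (length us)" using Suc.IH by blast
    obtain vs where vs: "set vs \<subseteq> gpart (int (p - 1)) (int (Suc q))" "indep_mod (vanishing_ideal U (E - {i})) vs"
      "main_term n ?t1 (p - 1 - n) (Suc q) \<le> int (length vs)"
      using regular.IH(1)[of "p - 1" "Suc q", folded n_def, OF p1 zero_less_Suc] by blast
    obtain ws where ws: "set ws \<subseteq> gpart (int p) (int (Suc q))"
      "indep_mod (vanishing_ideal (cut_out f U {i}) (E - {i})) ws" "main_term n ?t2 (p - n) (Suc q) \<le> int (length ws)"
      using regular.IH(2)[of p "Suc q", folded n_def, OF p2 zero_less_Suc] by blast
    let ?l = "map ((*) (weight_var i)) us @ map ((*) (linpoly (f i))) vs @ ws"
    have "weight_var i * g \<in> gpart (int p) (int (Suc q))" if "g \<in> set us" for g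
      using gpart_mult[OF weight_var_gpart, of g "int p" "int q" i] us(1) that by auto
    moreover have "linpoly (f i) * g \<in> gpart (int p) (int (Suc q))" if "g \<in> set vs" for g
    proof -
      have "linpoly (f i) * g \<in> gpart (1 + int (p - 1)) (0 + int (Suc q))"
        using vs(1) that by (intro gpart_mult linpoly_gpart) auto
      then show ?thesis using p by simp
    qed
    ultimately have "set ?l \<subseteq> gpart (int p) (int (Suc q))" using ws(1) by auto
    moreover have "indep_mod (vanishing_ideal U E) ?l"
      by (rule vanishing_ideal_deletion_contraction[OF regular.hyps(1,3,4,5,6) us(2) vs(2) ws(2)])
    moreover have "main_term n ?t2 (p - Suc n) (Suc q) \<le> main_term n ?t2 (p - n) (Suc q)"
      by (intro main_term_mono coeff_tpoly_nonneg subspace_cut regular.hyps) auto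
    then have "main_term (Suc n) ?t (p - Suc n) (Suc q) \<le> int (length ?l)"
      using us(3) vs(3)[unfolded eq] ws(3) unfolding main_term_Suc[OF n] by (simp add: t main_term_add)
    ultimately show ?case by blast
  qed
  then show ?case unfolding card .
next
  case (loops U E i j)
  have "tpoly U E = 0" by (rule tpoly_loop[OF loops.hyps(3,5)])
  then show ?case by (intro exI[of _ "[]"]) (auto simp: indep_mod_def main_term_def)
next
  case (coloops U E)
  have "tpoly U E = 0 \<or> tpoly U E = monom 1 (card E)"
    by (rule tpoly_coloops[OF coloops.hyps(1,2)]) (erule (2) coloops.hyps(3))
  then have "main_term (card E) (coeff (tpoly U E)) (p - card E) q = 0"
    by (intro main_term_eq_0) auto
  then show ?case by (intro exI[of _ "[]"]) (auto simp: indep_mod_def)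
qed

end

section \<open>Logarithmic derivations\<close>

interpretation ce: poly_mapping_hom "cst :: complex \<Rightarrow> ('m, 'n) tensor_ring"
  "\<lambda>\<alpha> :: 'm \<Rightarrow>\<^sub>0 nat. Poly_Mapping.single (\<alpha>, 0 :: 'n \<Rightarrow>\<^sub>0 nat) 1"
  by unfold_locales (auto simp: single_add mult_single zero_prod_def simp flip: single_one)

lemma coord_embed_conv_app: "coord_embed P = ce.app P"
  by (simp add: coord_embed_def ce.app_def mult_single)

lemmas coord_embed_0 = ce.app_0[folded coord_embed_conv_app]
  and coord_embed_1 = ce.app_1[folded coord_embed_conv_app]
  and coord_embed_mult = ce.app_mult[folded coord_embed_conv_app]
  and coord_embed_sum = ce.app_sum[folded coord_embed_conv_app]
  and coord_embed_prod = ce.app_prod[folded coord_embed_conv_app]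

lemma coord_embed_single: "coord_embed (Poly_Mapping.single \<alpha> c) = Poly_Mapping.single (\<alpha>, 0) c"
  unfolding coord_embed_conv_app by (simp add: ce.app_single mult_single)

lemma coord_embed_cst: "coord_embed (Poly_Mapping.single 0 c) = cst c"
  by (simp add: coord_embed_single zero_prod_def)

lemma coord_embed_form_poly: "coord_embed (form_poly h) = linpoly h"
  by (simp add: form_poly_def linpoly_def coord_embed_sum coord_embed_single coord_var_def mult_single)

section \<open>Derivations with prescribed values on the coordinates\<close>

definition coord_poly :: "'m \<Rightarrow> 'm coord_ring" where
  "coord_poly k = Poly_Mapping.single (Poly_Mapping.single k 1) 1"

lemma form_poly_expand: "form_poly h = (\<Sum>k\<in>UNIV. Poly_Mapping.single 0 (h (axis k 1)) * coord_poly k)"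
  by (simp add: form_poly_def coord_poly_def mult_single)

context
  fixes \<theta> :: "'m::finite \<Rightarrow> 'm coord_ring"
begin

text \<open>The value of the sum of \<theta>_k d/dx_k on a monomial. The truncated subtraction of
  exponents is harmless: where it truncates, the coefficient is 0.\<close>

definition monomial_derivative :: "('m \<Rightarrow>\<^sub>0 nat) \<Rightarrow> 'm coord_ring" where
  "monomial_derivative \<alpha> = (\<Sum>k\<in>UNIV.
     Poly_Mapping.single (\<alpha> - Poly_Mapping.single k 1) (of_nat (Poly_Mapping.lookup \<alpha> k)) * \<theta> k)"

definition field_derivation :: "'m coord_ring \<Rightarrow> 'm coord_ring" where
  "field_derivation P =
     (\<Sum>\<alpha>\<in>Poly_Mapping.keys P. Poly_Mapping.single 0 (Poly_Mapping.lookup P \<alpha>) * monomial_derivative \<alpha>)"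

lemma field_derivation_superset:
  "finite K \<Longrightarrow> Poly_Mapping.keys P \<subseteq> K \<Longrightarrow> field_derivation P =
     (\<Sum>\<alpha>\<in>K. Poly_Mapping.single 0 (Poly_Mapping.lookup P \<alpha>) * monomial_derivative \<alpha>)"
  unfolding field_derivation_def by (rule sum.mono_neutral_left) (auto simp: in_keys_iff)

lemma field_derivation_0: "field_derivation 0 = 0"
  by (simp add: field_derivation_def)

lemma field_derivation_add: "field_derivation (P + Q) = field_derivation P + field_derivation Q"
proof -
  let ?K = "Poly_Mapping.keys P \<union> Poly_Mapping.keys Q"
  have "field_derivation R = (\<Sum>\<alpha>\<in>?K. Poly_Mapping.single 0 (Poly_Mapping.lookup R \<alpha>) * monomial_derivative \<alpha>)"
    if "Poly_Mapping.keys R \<subseteq> ?K" for R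
    using that by (intro field_derivation_superset) auto
  then show ?thesis using keys_add[of P Q]
    by (simp add: lookup_add single_add distrib_right sum.distrib)
qed

lemma field_derivation_single:
  "field_derivation (Poly_Mapping.single \<alpha> c) = Poly_Mapping.single 0 c * monomial_derivative \<alpha>"
  by (subst field_derivation_superset[of "{\<alpha>}"]) auto

lemma monomial_derivative_add:
  "monomial_derivative (\<alpha> + \<beta>) = monomial_derivative \<alpha> * Poly_Mapping.single \<beta> 1
     + Poly_Mapping.single \<alpha> 1 * monomial_derivative \<beta>"
proof -
  have shift: "Poly_Mapping.single (\<alpha> - Poly_Mapping.single k 1) (of_nat (Poly_Mapping.lookup \<alpha> k)) * Poly_Mapping.single \<beta> 1
      = Poly_Mapping.single (\<alpha> + \<beta> - Poly_Mapping.single k 1) (of_nat (Poly_Mapping.lookup \<alpha> k) :: complex)"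
    for \<alpha> \<beta> :: "'m \<Rightarrow>\<^sub>0 nat" and k
  proof (cases "Poly_Mapping.lookup \<alpha> k = 0")
    case False
    then have "\<alpha> - Poly_Mapping.single k 1 + \<beta> = \<alpha> + \<beta> - Poly_Mapping.single k 1"
      by (intro poly_mapping_eqI) (auto simp: lookup_add lookup_minus lookup_single when_def)
    then show ?thesis by (simp add: mult_single)
  qed simp
  have "Poly_Mapping.single (\<alpha> + \<beta> - Poly_Mapping.single k 1) (of_nat (Poly_Mapping.lookup (\<alpha> + \<beta>) k)) * \<theta> k
      = Poly_Mapping.single (\<alpha> - Poly_Mapping.single k 1) (of_nat (Poly_Mapping.lookup \<alpha> k)) * \<theta> k * Poly_Mapping.single \<beta> 1
      + Poly_Mapping.single \<alpha> 1 * (Poly_Mapping.single (\<beta> - Poly_Mapping.single k 1) (of_nat (Poly_Mapping.lookup \<beta> k)) * \<theta> k)" for k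
    using shift[of \<alpha> k \<beta>] shift[of \<beta> k \<alpha>]
    by (simp add: lookup_add single_add algebra_simps)
  then show ?thesis
    unfolding monomial_derivative_def by (simp add: sum.distrib sum_distrib_left sum_distrib_right)
qed

lemma field_derivation_mult:
  "field_derivation (P * Q) = field_derivation P * Q + P * field_derivation Q"
proof (induction P rule: poly_mapping_single_induct)
  case (single \<alpha> c)
  show ?case
  proof (induction Q rule: poly_mapping_single_induct)
    case (single \<beta> d)
    let ?c = "Poly_Mapping.single 0 c :: 'm coord_ring" and ?d = "Poly_Mapping.single 0 d :: 'm coord_ring"
    let ?a = "Poly_Mapping.single \<alpha> 1 :: 'm coord_ring" and ?b = "Poly_Mapping.single \<beta> 1 :: 'm coord_ring"
    have "field_derivation (Poly_Mapping.single \<alpha> c * Poly_Mapping.single \<beta> d)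
        = ?c * ?d * (monomial_derivative \<alpha> * ?b + ?a * monomial_derivative \<beta>)"
      by (simp add: mult_single field_derivation_single monomial_derivative_add)
    also have "\<dots> = ?c * monomial_derivative \<alpha> * (?d * ?b) + ?c * ?a * (?d * monomial_derivative \<beta>)"
      by (simp only: algebra_simps)
    finally show ?case by (simp add: field_derivation_single mult_single)
  qed (auto simp: field_derivation_0 field_derivation_add distrib_left)
qed (auto simp: field_derivation_0 field_derivation_add distrib_right)

lemma field_derivation_scale:
  "field_derivation (Poly_Mapping.single 0 c * P) = Poly_Mapping.single 0 c * field_derivation P"
  by (simp add: field_derivation_mult field_derivation_single monomial_derivative_def)

lemma derivation_field_derivation: "derivation field_derivation"
  unfolding derivation_def using field_derivation_add field_derivation_scale field_derivation_mult by blast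

lemma field_derivation_sum: "field_derivation (sum P A) = (\<Sum>a\<in>A. field_derivation (P a))"
  by (induction A rule: infinite_finite_induct) (auto simp: field_derivation_0 field_derivation_add)

lemma field_derivation_coord_poly: "field_derivation (coord_poly k) = \<theta> k"
proof -
  have "monomial_derivative (Poly_Mapping.single k 1) = (\<Sum>l\<in>UNIV. if l = k then \<theta> k else 0)"
    unfolding monomial_derivative_def by (intro sum.cong) (auto simp: lookup_single when_def)
  then show ?thesis by (simp add: coord_poly_def field_derivation_single)
qed

lemma field_derivation_form_poly:
  "field_derivation (form_poly h) = (\<Sum>k\<in>UNIV. Poly_Mapping.single 0 (h (axis k 1)) * \<theta> k)"
  by (simp add: form_poly_expand field_derivation_sum field_derivation_scale field_derivation_coord_poly)

lemma field_derivation_prod: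
  assumes "finite A" "\<And>i. i \<in> A \<Longrightarrow> field_derivation (P i) = g i * P i"
  shows "field_derivation (prod P A) = (\<Sum>i\<in>A. g i) * prod P A"
  using assms
proof (induction A rule: finite_induct)
  case empty
  have "field_derivation 1 = field_derivation 1 + field_derivation 1"
    using field_derivation_mult[of 1 1] by simp
  then show ?case by simp
next
  case (insert i A)
  then show ?case by (simp add: field_derivation_mult algebra_simps)
qed

text \<open>By the Leibniz rule, a derivation that multiplies each form by \<open>g i\<close>
  multiplies their product by the sum of the \<open>g i\<close>, so it is logarithmic.\<close>

lemma field_derivation_log_contraction:
  fixes f :: "'n::finite \<Rightarrow> complex ^ 'm \<Rightarrow> complex"
  assumes "\<And>i. field_derivation (form_poly (f i)) = g i * form_poly (f i)"
  shows "(\<Sum>i\<in>UNIV. weight_var i * coord_embed (g i)) \<in> log_contractions f"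
proof -
  have "field_derivation (\<Prod>i\<in>UNIV. form_poly (f i)) = (\<Sum>i\<in>UNIV. g i) * (\<Prod>i\<in>UNIV. form_poly (f i))"
    by (rule field_derivation_prod) (use assms in auto)
  then have "field_derivation \<in> log_derivations f"
    unfolding log_derivations_def using derivation_field_derivation by auto
  then show ?thesis unfolding log_contractions_def using assms by blast
qed

end

lemma derivation_form_poly:
  fixes \<theta> :: "'m::finite coord_ring \<Rightarrow> 'm coord_ring"
  assumes "derivation \<theta>"
  shows "\<theta> (form_poly h) = (\<Sum>k\<in>UNIV. Poly_Mapping.single 0 (h (axis k 1)) * \<theta> (coord_poly k))"
proof -
  have add: "\<theta> (P + Q) = \<theta> P + \<theta> Q" and scale: "\<theta> (Poly_Mapping.single 0 c * P) = Poly_Mapping.single 0 c * \<theta> P" for P Q c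
    using assms unfolding derivation_def by auto
  have "\<theta> 0 = 0" using add[of 0 0] by simp
  then have "\<theta> (sum P A) = (\<Sum>a\<in>A. \<theta> (P a))" for P :: "'m \<Rightarrow> 'm coord_ring" and A
    by (induction A rule: infinite_finite_induct) (auto simp: add)
  then show ?thesis by (simp add: form_poly_expand scale)
qed

section \<open>Graded pieces of the logarithmic ideal\<close>

interpretation ring_module: module "(*) :: ('m, 'n) tensor_ring \<Rightarrow> ('m, 'n) tensor_ring \<Rightarrow> ('m, 'n) tensor_ring"
  by unfold_locales (auto simp: algebra_simps)

text \<open>The quotient dimension of a bigraded piece depends on the ideal only through these
  intersections, as \<open>quotient_dim_log_ideal\<close> records.\<close>

definition log_family :: "('n::finite \<Rightarrow> complex ^ 'm::finite \<Rightarrow> complex) \<Rightarrow> ('m, 'n) graded_family" where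
  "log_family f p q = log_ideal f \<inter> gpart p q"

lemma graded_ideal_log_family: "graded_ideal (log_family f)"
  unfolding graded_ideal_def log_family_def log_ideal_def
  by (auto intro: ring_module.span_zero ring_module.span_add ring_module.span_scale gpart_add gpart_mult)

lemma subspace_log_ideal: "tensor.subspace (log_ideal f)"
  unfolding tensor.subspace_def tensor_scale_def log_ideal_def
  by (auto intro: ring_module.span_zero ring_module.span_add ring_module.span_scale)

context forms
begin

text \<open>The Euler derivation fixes every linear form, so all quotients are 1.\<close>

lemma euler_mem_log_family: "(\<Sum>i\<in>UNIV. weight_var i) \<in> log_family f 0 1"
proof -
  have "field_derivation coord_poly (form_poly (f i)) = 1 * form_poly (f i)" for i
    unfolding field_derivation_form_poly by (simp add: form_poly_expand)
  from field_derivation_log_contraction[where g = "\<lambda>_. 1", OF this]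
  have "(\<Sum>i\<in>UNIV. weight_var i) \<in> log_contractions f" by (simp add: coord_embed_1)
  then show ?thesis
    unfolding log_family_def log_ideal_def by (auto intro: ring_module.span_base gpart_sum)
qed

text \<open>\<theta> is the derivative in direction v times the product of the forms in the support
  of v. It sends \<open>f i\<close> to \<open>f i v\<close> times this product, which contains the
  factor \<open>f i\<close> if i is in the support and is 0 otherwise.\<close>

lemma cocircuit_mem_log_family: "cocircuit UNIV v \<in> log_family f (int (card (support UNIV v)) - 1) 1"
proof -
  let ?S = "support UNIV v"
  define g where "g i = (if i \<in> ?S then Poly_Mapping.single 0 (f i v) * (\<Prod>j\<in>?S - {i}. form_poly (f j)) else 0)" for i
  define \<theta> where "\<theta> k = Poly_Mapping.single 0 (v $ k) * (\<Prod>j\<in>?S. form_poly (f j))" for k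
  have "field_derivation \<theta> (form_poly (f i)) = g i * form_poly (f i)" for i
  proof -
    have "field_derivation \<theta> (form_poly (f i)) =
        (\<Sum>k\<in>UNIV. Poly_Mapping.single 0 (f i (axis k 1) * v $ k)) * (\<Prod>j\<in>?S. form_poly (f j))"
      by (simp add: field_derivation_form_poly \<theta>_def sum_distrib_right mult_single flip: mult.assoc)
    also have "(\<Sum>k\<in>UNIV. Poly_Mapping.single (0 :: 'm \<Rightarrow>\<^sub>0 nat) (f i (axis k 1) * v $ k)) = Poly_Mapping.single 0 (f i v)"
      by (rule poly_mapping_eqI) (simp add: linform_expand[OF lin, of i v] lookup_sum lookup_single when_def)
    finally have *: "field_derivation \<theta> (form_poly (f i)) =
        Poly_Mapping.single 0 (f i v) * (\<Prod>j\<in>?S. form_poly (f j))" .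
    show ?thesis
    proof (cases "i \<in> ?S")
      case True
      have "(\<Prod>j\<in>?S. form_poly (f j)) = form_poly (f i) * (\<Prod>j\<in>?S - {i}. form_poly (f j))"
        by (rule prod.remove[OF finite True])
      then show ?thesis using True * by (simp add: g_def mult_ac)
    next
      case False
      then show ?thesis using * by (simp add: g_def support_def)
    qed
  qed
  from field_derivation_log_contraction[OF this]
  have mem: "(\<Sum>i\<in>UNIV. weight_var i * coord_embed (g i)) \<in> log_contractions f" .
  have "(\<Sum>i\<in>UNIV. weight_var i * coord_embed (g i)) = (\<Sum>i\<in>?S. weight_var i * coord_embed (g i))"
    by (rule sum.mono_neutral_right) (auto simp: g_def coord_embed_0)
  also have "\<dots> = cocircuit UNIV v"
    unfolding cocircuit_def
  proof (rule sum.cong[OF refl])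
    fix i assume "i \<in> ?S"
    then have "coord_embed (g i) = cst (f i v) * (\<Prod>j\<in>?S - {i}. linpoly (f j) :: ('m, 'n) tensor_ring)"
      by (simp add: g_def coord_embed_mult coord_embed_cst coord_embed_prod coord_embed_form_poly)
    then show "weight_var i * coord_embed (g i) = cst (f i v) * (weight_var i * (\<Prod>j\<in>?S - {i}. linpoly (f j)))"
      by (simp only: mult.left_commute)
  qed
  finally have "cocircuit UNIV v \<in> log_contractions f" using mem by simp
  then have "cocircuit UNIV v \<in> log_ideal f" unfolding log_ideal_def by (rule ring_module.span_base)
  then show ?thesis unfolding log_family_def using cocircuit_gpart by blast
qed

lemma admissible_log_family: "admissible (log_family f) UNIV UNIV"
proof -
  have "linpoly h \<in> log_family f 1 0" if "\<forall>x\<in>UNIV. h x = 0" for h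
    using that graded_ideal_0[OF graded_ideal_log_family, of f 1 0] by (simp add: linpoly_def)
  then show ?thesis
    unfolding admissible_def contains_annihilator_def
    using graded_ideal_log_family euler_mem_log_family cocircuit_mem_log_family by auto
qed

text \<open>At x the derivation is a tangent vector w, and f_i(x) g_i(x) = f_i(w) because
  \<open>f i\<close> is linear. After substitution the generator becomes the sum of the y_i f_i(w),
  which is 0 for a relation y.\<close>

lemma log_ideal_subset_vanishing_ideal: "log_ideal f \<subseteq> vanishing_ideal UNIV UNIV"
  unfolding log_ideal_def
proof (rule ring_module.span_minimal)
  show "ring_module.subspace (vanishing_ideal UNIV UNIV)"
    unfolding ring_module.subspace_def vanishing_ideal_def by (auto simp: tensor_eval_simps)
  show "log_contractions f \<subseteq> vanishing_ideal UNIV UNIV"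
  proof
    fix F assume "F \<in> log_contractions f"
    then obtain \<theta> g where F: "F = (\<Sum>i\<in>UNIV. weight_var i * coord_embed (g i))" and \<theta>: "derivation \<theta>"
      and g: "\<And>i. \<theta> (form_poly (f i)) = g i * form_poly (f i)"
      unfolding log_contractions_def log_derivations_def by blast
    show "F \<in> vanishing_ideal UNIV UNIV"
      unfolding vanishing_ideal_def
    proof (intro CollectI ballI)
      fix x y assume y: "y \<in> relations UNIV UNIV"
      let ?E = "\<lambda>P. critical_eval x y (coord_embed P)"
      have "f i x * ?E (g i) = (\<Sum>k\<in>UNIV. f i (axis k 1) * ?E (\<theta> (coord_poly k)))" for i
      proof -
        have "f i x * ?E (g i) = ?E (\<theta> (form_poly (f i)))"
          by (simp add: g coord_embed_mult coord_embed_form_poly tensor_eval_simps tensor_eval_linpoly[OF lin])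
        then show ?thesis
          by (simp add: derivation_form_poly[OF \<theta>] coord_embed_sum coord_embed_mult coord_embed_cst tensor_eval_simps)
      qed
      then have "critical_eval x y F =
          (\<Sum>i\<in>UNIV. y i * (\<Sum>k\<in>UNIV. f i (axis k 1) * ?E (\<theta> (coord_poly k))))"
        by (simp add: F tensor_eval_simps mult_ac)
      also have "\<dots> = (\<Sum>k\<in>UNIV. (\<Sum>i\<in>UNIV. y i * f i (axis k 1)) * ?E (\<theta> (coord_poly k)))"
        by (simp add: sum_distrib_left sum_distrib_right mult.assoc) (rule sum.swap)
      also have "\<dots> = 0" using y by (simp add: relations_def)
      finally show "critical_eval x y F = 0" .
    qed
  qed
qed

end

section \<open>The Tutte polynomial\<close>

text \<open>The substitution y = 0; the factor \<open>0 ^ j\<close> keeps exactly the exponents j =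
  0.\<close>

interpretation y0: poly_mapping_hom "\<lambda>c :: int. [:c:]" "\<lambda>(i, j). monom 1 i * 0 ^ j :: int poly"
  by unfold_locales (auto simp: split_def zero_prod_def plus_prod_def power_add mult_monom mult_ac simp flip: one_pCons)

lemma coeff_y0_app: "coeff (y0.app P) i = Poly_Mapping.lookup P (i, 0)"
proof (induction P rule: poly_mapping_single_induct)
  case (single k c)
  show ?case unfolding y0.app_single by (cases k) (auto simp: lookup_single when_def smult_monom power_0_left)
qed (auto simp: y0.app_0 y0.app_add lookup_add)

context forms
begin

lemma subset_rank_cut: "subset_rank f X = CARD('m) - vec.dim (cut_out f UNIV X)"
proof -
  have "(\<Inter>i\<in>X. hyperplane (f i)) = cut_out f UNIV X" by (auto simp: hyperplane_def cut_out_def)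
  then show ?thesis by (simp add: subset_rank_def)
qed

text \<open>At y = 0 the corank-nullity sum becomes Whitney's sum: the corank of X is the dimension
  of its common kernel, because all forms together cut out 0, and the remaining signs agree up to
  even powers of -1.\<close>

lemma lookup_tutte_polynomial:
  assumes "cut_out f UNIV UNIV = {0}"
  shows "Poly_Mapping.lookup (tutte_polynomial f) (i, 0) = coeff (tpoly UNIV UNIV) i"
proof -
  have x: "y0.app (Poly_Mapping.single (1, 0) 1 - 1) = [:-1, 1:]"
  proof -
    have "y0.app (Poly_Mapping.single (1, 0) 1 - 1) + 1 = monom 1 1"
      using y0.app_add[of "Poly_Mapping.single (1, 0) 1 - 1" 1] by (simp add: y0.app_1 y0.app_single flip: one_pCons)
    then have "y0.app (Poly_Mapping.single (1, 0) 1 - 1) = monom 1 1 - 1" by (simp add: eq_diff_eq)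
    then show ?thesis by (simp add: monom_Suc monom_0 one_pCons)
  qed
  have y: "y0.app (Poly_Mapping.single (0, 1) 1 - 1) = -1"
  proof -
    have "y0.app (Poly_Mapping.single (0, 1) 1 - 1) + 1 = 0"
      using y0.app_add[of "Poly_Mapping.single (0, 1) 1 - 1" 1] by (simp add: y0.app_1 y0.app_single)
    then show ?thesis by (simp add: add_eq_0_iff2)
  qed
  let ?m = "CARD('m)" and ?d = "\<lambda>X. vec.dim (cut_out f UNIV X)"
  have "y0.app (tutte_polynomial f) = (\<Sum>X\<in>Pow UNIV.
      [:-1, 1:] ^ (subset_rank f UNIV - subset_rank f X) * (-1) ^ (card X - subset_rank f X))"
    unfolding tutte_polynomial_def y0.app_sum y0.app_mult y0.app_power x y ..
  also have "\<dots> = (\<Sum>X\<in>Pow UNIV. (-1) ^ ?m * ((-1) ^ card X * [:1, -1:] ^ ?d X))"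
  proof (intro sum.cong refl)
    fix X :: "'n set"
    have "?d X \<le> ?m" by (rule dim_subset_UNIV_cart_gen)
    \<comment> \<open>e is the rank and k below the nullity of X; as natural numbers they show that
      the differences in the definition are not truncated.\<close>
    then obtain e where e: "?m = ?d X + e" using le_Suc_ex by blast
    have "?m \<le> ?d X + card X" using dim_cut_Un_le[OF vec.subspace_UNIV, of "{}" X] unfolding cut_empty vec_dim_card by simp
    then obtain k where k: "card X = e + k" using e le_Suc_ex by (metis nat_add_left_cancel_le)
    have "subset_rank f UNIV = ?m" by (simp add: subset_rank_cut assms)
    moreover have "subset_rank f X = e" by (simp add: subset_rank_cut e)
    moreover have "[:1, -1:] ^ ?d X = (-1) ^ ?d X * [:-1, 1 :: int:] ^ ?d X"
      by (simp flip: power_mult_distrib)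
    moreover have "(-1) ^ k = ((-1) ^ ?m * ((-1) ^ card X * (-1) ^ ?d X) :: int poly)"
    proof -
      have "(-1) ^ ?m * ((-1) ^ card X * (-1) ^ ?d X) = ((-1) ^ (2 * (?d X + e) + k) :: int poly)"
        unfolding e k by (simp only: mult_2 add_ac flip: power_add)
      then show ?thesis by (simp add: power_add power_mult)
    qed
    ultimately show "[:-1, 1:] ^ (subset_rank f UNIV - subset_rank f X) * (-1) ^ (card X - subset_rank f X)
        = (-1) ^ ?m * ((-1) ^ card X * [:1, -1 :: int:] ^ ?d X)"
      by (simp add: e k mult_ac)
  qed
  also have "\<dots> = tpoly UNIV UNIV" unfolding tpoly_def vec_dim_card sum_distrib_left ..
  finally show ?thesis by (simp flip: coeff_y0_app)
qed

end

section \<open>Comparison of leading forms\<close>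

lemma tendsto_if_bounded_difference:
  fixes Y :: "nat \<Rightarrow> nat"
  assumes "\<And>s. \<bar>real (Y s) - real s * x\<bar> \<le> C"
  shows "(\<lambda>s. real (Y s) / real s) \<longlonglongrightarrow> x"
proof -
  have "(\<lambda>s. C / real s) \<longlonglongrightarrow> 0" by (rule lim_const_over_n)
  moreover have "\<forall>\<^sub>F s in sequentially. norm (real (Y s) / real s - x) \<le> C / real s"
    using eventually_gt_at_top[of 0]
  proof eventually_elim
    case (elim s)
    then have "real (Y s) / real s - x = (real (Y s) - real s * x) / real s" by (simp add: field_simps)
    then show ?case using assms[of s] elim by (simp add: divide_right_mono)
  qed
  ultimately have "(\<lambda>s. real (Y s) / real s - x) \<longlonglongrightarrow> 0" by (rule Lim_null_comparison[rotated])
  then show ?thesis by (rule LIM_zero_cancel)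
qed

text \<open>Only a bounded distance from s x is required, so Y may carry constant shifts or be a
  truncated difference such as s a - n.\<close>

lemma binomial_scaled_limit:
  fixes Y :: "nat \<Rightarrow> nat"
  assumes "\<And>s. \<bar>real (Y s) - real s * x\<bar> \<le> C"
  shows "(\<lambda>s. real (Y s choose k) / real s ^ k) \<longlonglongrightarrow> x ^ k / fact k"
proof -
  have "(\<lambda>s. (real (Y s) - real i) / real s) \<longlonglongrightarrow> x" for i
  proof -
    have "(\<lambda>s. real (Y s) / real s - real i / real s) \<longlonglongrightarrow> x - 0"
      by (intro tendsto_diff tendsto_if_bounded_difference[OF assms] lim_const_over_n)
    then show ?thesis by (simp add: diff_divide_distrib)
  qed
  then have "(\<lambda>s. (\<Prod>i = 0..<k. (real (Y s) - real i) / real s) / fact k) \<longlonglongrightarrow> (\<Prod>i = 0..<k. x) / fact k"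
    by (intro tendsto_divide tendsto_prod tendsto_const) auto
  moreover have "(\<Prod>i = 0..<k. (real (Y s) - real i) / real s) / fact k = real (Y s choose k) / real s ^ k" for s
    by (simp add: binomial_gbinomial gbinomial_prod_rev prod_dividef)
  ultimately show ?thesis by simp
qed

text \<open>The part of degree n - 2 of \<open>main_term\<close>; the two factorials combine to the
  binomial coefficient divided by (n - 2)!.\<close>

definition leading_form :: "nat \<Rightarrow> (nat \<Rightarrow> int) \<Rightarrow> nat \<Rightarrow> nat \<Rightarrow> real" where
  "leading_form n t a b =
     (\<Sum>k<n - 1. of_int (t (Suc k)) * (real a ^ k / fact k) * (real b ^ (n - 2 - k) / fact (n - 2 - k)))"

text \<open>Y stays free because the upper bound needs p = s a and the lower bound p - n.\<close>

lemma main_term_scaled_limit: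
  assumes Y: "\<And>s. \<bar>real (Y s) - real s * real a\<bar> \<le> C"
  shows "(\<lambda>s. of_int (main_term n t (Y s) (s * b)) / real s ^ (n - 2)) \<longlonglongrightarrow> leading_form n t a b"
proof -
  have "(\<lambda>s. \<Sum>k<n - 1. of_int (t (Suc k)) * (real ((Y s + k) choose k) / real s ^ k) *
      (real (monomial_count (s * b) (n - 2 - k)) / real s ^ (n - 2 - k))) \<longlonglongrightarrow> leading_form n t a b"
    unfolding leading_form_def
  proof (intro tendsto_sum tendsto_mult tendsto_const)
    fix k
    have "\<bar>real (Y s + k) - real s * real a\<bar> \<le> C + real k" for s using Y[of s] by linarith
    then show "(\<lambda>s. real ((Y s + k) choose k) / real s ^ k) \<longlonglongrightarrow> real a ^ k / fact k"
      by (rule binomial_scaled_limit)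
    have "\<bar>real (n - 2 - k + s * b - 1) - real s * real b\<bar> \<le> real n + 1" for s
    proof -
      have "n - 2 - k + s * b - 1 \<le> s * b + n" "s * b \<le> n - 2 - k + s * b - 1 + 1" by linarith+
      then have "real (n - 2 - k + s * b - 1) \<le> real (s * b + n)" "real (s * b) \<le> real (n - 2 - k + s * b - 1 + 1)"
        by (simp_all only: of_nat_le_iff)
      moreover have "\<bar>y - c\<bar> \<le> m + 1" if "y \<le> c + m" "c \<le> y + 1" "m \<ge> 0" for y c m :: real
        using that by linarith
      ultimately show ?thesis by simp
    qed
    then show "(\<lambda>s. real (monomial_count (s * b) (n - 2 - k)) / real s ^ (n - 2 - k)) \<longlonglongrightarrow> real b ^ (n - 2 - k) / fact (n - 2 - k)"
      unfolding monomial_count_def by (rule binomial_scaled_limit)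
  qed
  moreover have "(\<Sum>k<n - 1. of_int (t (Suc k)) * (real ((Y s + k) choose k) / real s ^ k) *
      (real (monomial_count (s * b) (n - 2 - k)) / real s ^ (n - 2 - k)))
    = of_int (main_term n t (Y s) (s * b)) / real s ^ (n - 2)" for s
  proof -
    have "real s ^ (n - 2) = real s ^ k * real s ^ (n - 2 - k)" if "k < n - 1" for k
      using that by (simp flip: power_add)
    then show ?thesis
      unfolding main_term_def of_int_sum sum_divide_distrib by (intro sum.cong refl) simp
  qed
  ultimately show ?thesis by simp
qed

lemma err_term_scaled_limit:
  "(\<lambda>s. real (err_term n (s * a) (s * b)) / real s ^ (n - 2)) \<longlonglongrightarrow> 0"
proof (cases "n < 3")
  case True
  then show ?thesis by (simp add: err_term_def)
next
  case False
  have "\<bar>real (s * a + s * b + n - 3) - real s * (real a + real b)\<bar> \<le> real n" for s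
    using False by (simp add: of_nat_diff distrib_left)
  then have "(\<lambda>s. real ((s * a + s * b + n - 3) choose (n - 3)) / real s ^ (n - 3)) \<longlonglongrightarrow> (real a + real b) ^ (n - 3) / fact (n - 3)"
    by (rule binomial_scaled_limit)
  from tendsto_mult[OF this lim_const_over_n[of 1]]
  have "(\<lambda>s. real ((s * a + s * b + n - 3) choose (n - 3)) / real s ^ (n - 3) * (1 / real s)) \<longlonglongrightarrow> 0" by simp
  moreover have "real s ^ (n - 2) = real s ^ (n - 3) * real s" for s
  proof -
    have "n - 2 = Suc (n - 3)" using False by simp
    then show ?thesis by simp
  qed
  ultimately show ?thesis using False by (simp add: err_term_def)
qed

text \<open>The top coefficient is the limit after division by its own power of s; if this power is
  at least d the limit is 0, and the next coefficient becomes the top one.\<close>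

lemma polynomial_coeffs_eq_0_if_limit:
  fixes e :: "nat \<Rightarrow> real"
  assumes "(\<lambda>s. (\<Sum>m\<le>M. e m * real s ^ m) / real s ^ d) \<longlonglongrightarrow> 0" "d \<le> m" "m \<le> M"
  shows "e m = 0"
  using assms
proof (induction M arbitrary: m)
  case (0 m)
  then show ?case by simp (metis LIMSEQ_const_iff)
next
  case (Suc M m)
  have top: "e (Suc M) = 0" if "d \<le> Suc M"
  proof -
    let ?f = "\<lambda>s. \<Sum>m\<le>Suc M. e m * real s ^ m"
    have inv: "(\<lambda>s. 1 / real s) \<longlonglongrightarrow> 0" by (rule lim_const_over_n)
    have "(\<lambda>s. \<Sum>m\<le>Suc M. e m * (1 / real s) ^ (Suc M - m)) \<longlonglongrightarrow> (\<Sum>m\<le>Suc M. e m * 0 ^ (Suc M - m))"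
      by (intro tendsto_sum tendsto_mult tendsto_const tendsto_power inv)
    moreover have "(\<Sum>m\<le>Suc M. e m * 0 ^ (Suc M - m)) = (\<Sum>m\<le>Suc M. if m = Suc M then e m else 0)"
      by (intro sum.cong) (auto simp: power_0_left)
    ultimately have lim1: "(\<lambda>s. \<Sum>m\<le>Suc M. e m * (1 / real s) ^ (Suc M - m)) \<longlonglongrightarrow> e (Suc M)" by simp
    have lim0: "(\<lambda>s. ?f s / real s ^ d * (1 / real s) ^ (Suc M - d)) \<longlonglongrightarrow> 0 * 0 ^ (Suc M - d)"
      by (intro tendsto_mult Suc.prems(1) tendsto_power inv)
    have "\<forall>\<^sub>F s in sequentially. (\<Sum>m\<le>Suc M. e m * (1 / real s) ^ (Suc M - m)) = ?f s / real s ^ d * (1 / real s) ^ (Suc M - d)"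
      using eventually_gt_at_top[of 0]
    proof eventually_elim
      case (elim s)
      have pow: "real s ^ Suc M = real s ^ m * real s ^ (Suc M - m)" if "m \<le> Suc M" for m
        using that by (simp flip: power_add)
      have "(\<Sum>m\<le>Suc M. e m * (1 / real s) ^ (Suc M - m)) = ?f s / real s ^ Suc M"
        unfolding sum_divide_distrib
      proof (intro sum.cong refl)
        fix m assume "m \<in> {..Suc M}"
        then show "e m * (1 / real s) ^ (Suc M - m) = e m * real s ^ m / real s ^ Suc M"
          using elim pow[of m] by (simp add: power_one_over field_simps)
      qed
      then show ?case using pow[OF that] by (simp add: power_one_over)
    qed
    with lim1 have "(\<lambda>s. ?f s / real s ^ d * (1 / real s) ^ (Suc M - d)) \<longlonglongrightarrow> e (Suc M)"
      by (rule Lim_transform_eventually)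
    from LIMSEQ_unique[OF this lim0] show ?thesis by simp
  qed
  show ?case
  proof (cases "m = Suc M")
    case True
    then show ?thesis using top Suc.prems(2) by simp
  next
    case False
    then have "d \<le> Suc M" using Suc.prems by simp
    then show ?thesis using Suc.IH[of m] Suc.prems top False by simp
  qed
qed

section \<open>Degree bounds from limits along rays\<close>

definition homogeneous_part :: "'k::comm_monoid_add bipoly \<Rightarrow> nat \<Rightarrow> 'k bipoly" where
  "homogeneous_part D m =
     (\<Sum>k\<in>{k \<in> Poly_Mapping.keys D. fst k + snd k = m}. Poly_Mapping.single k (Poly_Mapping.lookup D k))"

lemma lookup_homogeneous_part:
  "Poly_Mapping.lookup (homogeneous_part D m) k = (if fst k + snd k = m then Poly_Mapping.lookup D k else 0)"
  by (cases "k \<in> Poly_Mapping.keys D")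
    (auto simp: homogeneous_part_def lookup_sum lookup_single when_def in_keys_iff)

lemma bipoly_eval_scaled:
  fixes D :: "'k::comm_ring_1 bipoly"
  obtains M where "\<And>x y z. bipoly_eval D (z * x) (z * y) = (\<Sum>m\<le>M. bipoly_eval (homogeneous_part D m) x y * z ^ m)"
    "\<And>k. k \<in> Poly_Mapping.keys D \<Longrightarrow> fst k + snd k \<le> M"
proof
  define M where "M = (\<Sum>k\<in>Poly_Mapping.keys D. fst k + snd k)"
  show le: "fst k + snd k \<le> M" if "k \<in> Poly_Mapping.keys D" for k
    unfolding M_def using member_le_sum[OF that, of "\<lambda>k. fst k + snd k"] by simp
  fix x y z
  let ?g = "\<lambda>k. Poly_Mapping.lookup D k * (z * x) ^ fst k * (z * y) ^ snd k"
  have "bipoly_eval D (z * x) (z * y) = (\<Sum>k\<in>Poly_Mapping.keys D. ?g k)"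
    by (simp add: bipoly_eval_def split_def)
  also have "\<dots> = (\<Sum>m\<le>M. \<Sum>k\<in>{k \<in> Poly_Mapping.keys D. fst k + snd k = m}. ?g k)"
    by (rule sum.group[symmetric]) (use le in auto)
  also have "\<dots> = (\<Sum>m\<le>M. bipoly_eval (homogeneous_part D m) x y * z ^ m)"
  proof (intro sum.cong refl)
    fix m
    have "bipoly_eval (Poly_Mapping.single k c) x y = c * x ^ fst k * y ^ snd k" for k and c :: 'k
      using bipoly_eval_single[of "fst k" "snd k" c x y] by simp
    then show "(\<Sum>k\<in>{k \<in> Poly_Mapping.keys D. fst k + snd k = m}. ?g k) = bipoly_eval (homogeneous_part D m) x y * z ^ m"
      unfolding homogeneous_part_def bipoly_eval_sum sum_distrib_right
      by (intro sum.cong refl) (auto simp: power_mult_distrib power_add)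
  qed
  finally show "bipoly_eval D (z * x) (z * y) = (\<Sum>m\<le>M. bipoly_eval (homogeneous_part D m) x y * z ^ m)" .
qed

text \<open>On the ray through (a, b) the values are a polynomial in s whose coefficients are the
  homogeneous parts at (a, b). Those of degree at least d vanish at all positive integers and hence
  identically.\<close>

lemma total_degree_less_if_limit:
  fixes D :: "rat bipoly"
  assumes lim: "\<And>a b. a > 0 \<Longrightarrow> b > 0 \<Longrightarrow>
    (\<lambda>s. real_of_rat (bipoly_eval D (of_nat (s * a)) (of_nat (s * b))) / real s ^ d) \<longlonglongrightarrow> 0"
  shows "total_degree_less D d"
proof -
  obtain M where M: "\<And>x y z. bipoly_eval D (z * x) (z * y) = (\<Sum>m\<le>M. bipoly_eval (homogeneous_part D m) x y * z ^ m)"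
    "\<And>k. k \<in> Poly_Mapping.keys D \<Longrightarrow> fst k + snd k \<le> M" by (rule bipoly_eval_scaled[of D]) blast
  have zero: "homogeneous_part D m = 0" if m: "d \<le> m" "m \<le> M" for m
  proof (rule bipoly_eq_0I[of 1])
    fix a b :: nat assume ab: "a \<ge> 1" "b \<ge> 1"
    let ?e = "\<lambda>m. real_of_rat (bipoly_eval (homogeneous_part D m) (of_nat a) (of_nat b))"
    have "real_of_rat (bipoly_eval D (of_nat (s * a)) (of_nat (s * b))) = (\<Sum>m\<le>M. ?e m * real s ^ m)" for s
      by (simp add: M(1) of_rat_sum of_rat_mult of_rat_power)
    then have "(\<lambda>s. (\<Sum>m\<le>M. ?e m * real s ^ m) / real s ^ d) \<longlonglongrightarrow> 0" using lim[of a b] ab by simp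
    from polynomial_coeffs_eq_0_if_limit[OF this m]
    show "bipoly_eval (homogeneous_part D m) (of_nat a) (of_nat b) = 0" by simp
  qed
  show ?thesis
    unfolding total_degree_less_def
  proof safe
    fix i j assume ij: "(i, j) \<in> Poly_Mapping.keys D"
    show "i + j < d"
    proof (rule ccontr)
      assume "\<not> i + j < d"
      then have "Poly_Mapping.lookup (homogeneous_part D (i + j)) (i, j) = 0"
        using zero[of "i + j"] M(2)[OF ij] by simp
      then show False using ij by (simp add: lookup_homogeneous_part in_keys_iff)
    qed
  qed
qed

lemma quotient_dim_log_ideal:
  fixes f :: "'n::finite \<Rightarrow> complex ^ 'm::finite \<Rightarrow> complex"
  shows "quotient_dim tensor_scale (log_ideal f) (bigraded_part p q) = hdim (log_family f) (int p) (int q)"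
proof -
  obtain us where us: "set us \<subseteq> gpart (int p) (int q)" "span_mod (log_family f (int p) (int q)) us (gpart (int p) (int q))"
    "indep_mod (log_family f (int p) (int q)) us" "length us = hdim (log_family f) (int p) (int q)"
    using quotient_dim_basis[OF graded_ideal_subspace[OF graded_ideal_log_family]] unfolding hdim_def by metis
  have "span_mod (log_ideal f) us (gpart (int p) (int q))"
    using us(2) unfolding span_mod_def log_family_def by blast
  moreover have "indep_mod (log_ideal f) us"
    using us(3) lincomb_gpart[OF us(1)] unfolding indep_mod_def log_family_def by blast
  ultimately show ?thesis
    using quotient_dim_eqI[OF subspace_log_ideal us(1)] us(4) by (simp add: bigraded_part_eq)
qed

theorem proposition5p2:
  fixes f :: "'n::finite \<Rightarrow> complex ^ 'm::finite \<Rightarrow> complex"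
    and n l :: nat
  assumes arrangement: "central_arrangement f"
    and n_def: "n = CARD('n)"
    and n_ge_2: "n \<ge> 2"
    and l_def: "l = arrangement_rank f"
    and essential: "l = CARD('m)"
  shows "\<exists>P \<Omega>. is_hilbert_polynomial (log_ideal f) P \<and>
    P = Poly_Mapping.single 0 (1 / fact (n - 2)) *
          (\<Sum>i=1..l. Poly_Mapping.single (i - 1, n - 1 - i)
            (of_int (Poly_Mapping.lookup (tutte_polynomial f) (i, 0)) * of_nat ((n - 2) choose (i - 1))))
        + \<Omega> \<and>
    total_degree_less \<Omega> (n - 2)"
proof -
  interpret forms f
  proof
    fix i
    interpret li: Vector_Spaces.linear "(*s)" "(*)" "f i"
      using arrangement unfolding central_arrangement_def by blast
    show "linform (f i)" unfolding linform_def using li.add li.scale by blast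
  qed
  have "CARD('m) - vec.dim (cut_out f UNIV UNIV) = CARD('m)"
    using essential l_def unfolding arrangement_rank_def subset_rank_cut by simp
  \<comment> \<open>The truncated difference can be undone because \<open>CARD('m)\<close> is
    positive.\<close>
  then have "vec.dim (cut_out f UNIV UNIV) = 0" using zero_less_card_finite[where 'a = 'm] by linarith
  then have "cut_out f UNIV UNIV \<subseteq> {0}" by (simp only: vec.dim_eq_0)
  then have ess: "cut_out f UNIV UNIV = {0}" using vec.subspace_0[OF subspace_cut[OF vec.subspace_UNIV]] by blast
  define t where "t = coeff (tpoly UNIV UNIV)"
  have tutte: "Poly_Mapping.lookup (tutte_polynomial f) (i, 0) = t i" for i
    using lookup_tutte_polynomial[OF ess] by (simp add: t_def)
  have l: "l \<le> n"
    using dim_le_card[OF vec.subspace_UNIV ess] unfolding vec_dim_card n_def essential .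
  have t_large: "t i = 0" if "i > l" for i
    unfolding t_def by (rule coeff_tpoly_eq_0[OF vec.subspace_UNIV]) (use that essential in \<open>simp only: vec_dim_card\<close>)
  define H where "H p q = hdim (log_family f) (int p) (int q)" for p q
  obtain h N where h: "bipoly_fun h" "\<And>p q. p \<ge> N \<Longrightarrow> q \<ge> N \<Longrightarrow>
      of_nat (hdim (log_family f) p q) = h (of_int p) (of_int q)"
    using eventually_bipoly_hdim[OF graded_ideal_log_family[of f]] unfolding eventually_bipoly_def by blast
  obtain P where "\<And>x y. h x y = bipoly_eval P x y" using h(1) unfolding bipoly_fun_def by blast
  note P = h(2)[unfolded this]
  have PH: "bipoly_eval P (of_nat p) (of_nat q) = of_nat (H p q)" if "p \<ge> nat N" "q \<ge> nat N" for p q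
    using P[of "int p" "int q"] that by (simp add: H_def nat_le_iff)
  then have hilbert: "is_hilbert_polynomial (log_ideal f) P"
    unfolding is_hilbert_polynomial_def quotient_dim_log_ideal H_def by blast
  obtain c where "\<And>p q. n \<le> p \<Longrightarrow> q > 0 \<Longrightarrow> int (H p q) \<le> main_term n t p q + int c * int (err_term n p q)"
    using hdim_upper_bound[OF vec.subspace_UNIV ess] admissible_log_family unfolding H_def t_def n_def by blast
  then have bound: "int (H p q) \<le> main_term n t p q + int c * int (err_term n p q)" if "n \<le> p" "q > 0" for p q
    using that by blast
  have upper: "real (H p q) \<le> of_int (main_term n t p q) + real c * real (err_term n p q)"
    if "n \<le> p" "q > 0" for p q
  proof -
    have "real_of_int (int (H p q)) \<le> real_of_int (main_term n t p q + int c * int (err_term n p q))"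
      using bound[OF that] by (simp only: of_int_le_iff)
    then show ?thesis by simp
  qed
  have lower: "of_int (main_term n t (p - n) q) \<le> real (H p q)" if pq: "n \<le> p" "q > 0" for p q
  proof -
    obtain us where us: "set us \<subseteq> gpart (int p) (int q)" "indep_mod (vanishing_ideal UNIV UNIV) us"
      "main_term n t (p - n) q \<le> int (length us)"
      using independent_lower_bound[OF vec.subspace_UNIV ess] pq unfolding n_def t_def by blast
    have "indep_mod (log_family f (int p) (int q)) us"
      using us(2) log_ideal_subset_vanishing_ideal unfolding indep_mod_def log_family_def by blast
    then have "length us \<le> H p q"
      unfolding H_def hdim_def
      by (intro length_indep_le_quotient_dim[OF graded_ideal_subspace[OF graded_ideal_log_family] us(1)])
    then have "main_term n t (p - n) q \<le> int (H p q)" using us(3) by linarith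
    then have "real_of_int (main_term n t (p - n) q) \<le> real_of_int (int (H p q))" by (simp only: of_int_le_iff)
    then show ?thesis by simp
  qed
  define L :: "rat bipoly" where "L = Poly_Mapping.single 0 (1 / fact (n - 2)) *
          (\<Sum>i=1..l. Poly_Mapping.single (i - 1, n - 1 - i) (of_int (t i) * of_nat ((n - 2) choose (i - 1))))"
  have L: "real_of_rat (bipoly_eval L (of_nat (s * a)) (of_nat (s * b))) = real s ^ (n - 2) * leading_form n t a b" for s a b
  proof -
    let ?g = "\<lambda>i. of_int (t i) * real ((n - 2) choose (i - 1)) / fact (n - 2) * real (s * a) ^ (i - 1) * real (s * b) ^ (n - 1 - i)"
    have "bipoly_eval (Poly_Mapping.single 0 (1 / fact (n - 2) :: rat)) x y = 1 / fact (n - 2)" for x y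
      using bipoly_eval_single[of 0 0 "1 / fact (n - 2) :: rat"] by (simp add: zero_prod_def)
    moreover have "real_of_rat (fact (n - 2)) = fact (n - 2)"
      using of_rat_of_nat_eq[of "fact (n - 2)"] by simp
    ultimately have "real_of_rat (bipoly_eval L (of_nat (s * a)) (of_nat (s * b))) = (\<Sum>i=1..l. ?g i)"
      unfolding L_def bipoly_eval_mult bipoly_eval_sum bipoly_eval_single
      by (simp add: of_rat_mult of_rat_sum of_rat_power of_rat_divide sum_distrib_left mult_ac)
    \<comment> \<open>Coefficients above the rank vanish, so the range can be made independent of
      l.\<close>
    also have "\<dots> = (\<Sum>i=1..n. ?g i)"
      using l t_large by (intro sum.mono_neutral_left) auto
    also have "\<dots> = (\<Sum>i\<in>Suc ` {..<n - 1}. ?g i)"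
    proof (intro sum.mono_neutral_right)
      show "\<forall>i\<in>{1..n} - Suc ` {..<n - 1}. ?g i = 0"
      proof
        fix i assume "i \<in> {1..n} - Suc ` {..<n - 1}"
        \<comment> \<open>At i = n the exponent n - 1 - i is truncated, but there the binomial
          coefficient (n - 2 choose n - 1) is 0.\<close>
        then have "i = n" using n_ge_2 by (cases i) (auto simp: image_iff)
        then show "?g i = 0" using n_ge_2 by (simp add: binomial_eq_0)
      qed
    qed auto
    also have "\<dots> = (\<Sum>k<n - 1. ?g (Suc k))" by (simp add: sum.reindex)
    also have "\<dots> = real s ^ (n - 2) * leading_form n t a b"
      unfolding leading_form_def sum_distrib_left
    proof (intro sum.cong refl)
      fix k assume "k \<in> {..<n - 1}"
      then have k: "k \<le> n - 2" by auto
      have "real ((n - 2) choose k) = fact (n - 2) / (fact k * fact (n - 2 - k))" using k by (rule binomial_fact)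
      moreover have "real s ^ (n - 2) = real s ^ k * real s ^ (n - 2 - k)"
        unfolding power_add[symmetric] le_add_diff_inverse[OF k] ..
      moreover have "n - 1 - Suc k = n - 2 - k" by simp
      ultimately show "?g (Suc k) = real s ^ (n - 2) *
          (of_int (t (Suc k)) * (real a ^ k / fact k) * (real b ^ (n - 2 - k) / fact (n - 2 - k)))"
        by (simp add: power_mult_distrib)
    qed
    finally show ?thesis .
  qed
  have "total_degree_less (P - L) (n - 2)"
  proof (rule total_degree_less_if_limit)
    fix a b :: nat assume ab: "a > 0" "b > 0"
    have up: "(\<lambda>s. of_int (main_term n t (s * a) (s * b)) / real s ^ (n - 2)
        + real c * (real (err_term n (s * a) (s * b)) / real s ^ (n - 2))) \<longlonglongrightarrow> leading_form n t a b + real c * 0"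
      by (intro tendsto_add tendsto_mult tendsto_const err_term_scaled_limit
          main_term_scaled_limit[where C = 0]) simp
    \<comment> \<open>Lowering p by the constant n, even truncated, does not change the limit on the
      ray.\<close>
    have lo: "(\<lambda>s. of_int (main_term n t (s * a - n) (s * b)) / real s ^ (n - 2)) \<longlonglongrightarrow> leading_form n t a b"
    proof (rule main_term_scaled_limit[where C = "real n"])
      fix s
      have "real (s * a - n) - real (s * a) \<le> 0" "real (s * a) - real (s * a - n) \<le> real n" by linarith+
      then show "\<bar>real (s * a - n) - real s * real a\<bar> \<le> real n" by simp
    qed
    \<comment> \<open>Beyond this s both bounds apply and the Hilbert function agrees with
      P.\<close>
    have large: "\<forall>\<^sub>F s in sequentially. n + nat N + 1 \<le> s" by (rule eventually_ge_at_top)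
    have big: "n + nat N + 1 \<le> s * a" "n + nat N + 1 \<le> s * b" if "n + nat N + 1 \<le> s" for s
      using that ab mult_le_mono[of "n + nat N + 1" s 1 a] mult_le_mono[of "n + nat N + 1" s 1 b] by auto
    have "(\<lambda>s. real (H (s * a) (s * b)) / real s ^ (n - 2)) \<longlonglongrightarrow> leading_form n t a b"
    proof (rule tendsto_sandwich[OF _ _ lo])
      show "(\<lambda>s. of_int (main_term n t (s * a) (s * b)) / real s ^ (n - 2)
        + real c * (real (err_term n (s * a) (s * b)) / real s ^ (n - 2))) \<longlonglongrightarrow> leading_form n t a b"
        using up by simp
      show "\<forall>\<^sub>F s in sequentially. of_int (main_term n t (s * a - n) (s * b)) / real s ^ (n - 2)
          \<le> real (H (s * a) (s * b)) / real s ^ (n - 2)"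
        using large
      proof eventually_elim
        case (elim s)
        show ?case using big[OF elim] elim ab by (intro divide_right_mono lower) auto
      qed
      show "\<forall>\<^sub>F s in sequentially. real (H (s * a) (s * b)) / real s ^ (n - 2)
          \<le> of_int (main_term n t (s * a) (s * b)) / real s ^ (n - 2)
            + real c * (real (err_term n (s * a) (s * b)) / real s ^ (n - 2))"
        using large
      proof eventually_elim
        case (elim s)
        have "real (H (s * a) (s * b)) / real s ^ (n - 2)
          \<le> (of_int (main_term n t (s * a) (s * b)) + real c * real (err_term n (s * a) (s * b))) / real s ^ (n - 2)"
          using big[OF elim] elim ab by (intro divide_right_mono upper) auto
        then show ?case by (simp add: add_divide_distrib)
      qed
    qed
    then have "(\<lambda>s. real (H (s * a) (s * b)) / real s ^ (n - 2) - leading_form n t a b) \<longlonglongrightarrow> 0"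
      by (rule LIM_zero)
    moreover have "\<forall>\<^sub>F s in sequentially. real (H (s * a) (s * b)) / real s ^ (n - 2) - leading_form n t a b
        = real_of_rat (bipoly_eval (P - L) (of_nat (s * a)) (of_nat (s * b))) / real s ^ (n - 2)"
      using large
    proof eventually_elim
      case (elim s)
      have "s > 0" using elim by simp
      then show ?case
        using PH[of "s * a" "s * b"] big[OF elim] L[of s a b]
        by (simp add: bipoly_eval_diff of_rat_diff diff_divide_distrib del: of_nat_mult)
    qed
    ultimately show "(\<lambda>s. real_of_rat (bipoly_eval (P - L) (of_nat (s * a)) (of_nat (s * b))) / real s ^ (n - 2)) \<longlonglongrightarrow> 0"
      by (rule Lim_transform_eventually)
  qed
  then show ?thesis
    using hilbert by (intro exI[of _ P] exI[of _ "P - L"]) (simp add: L_def tutte)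
qed

end
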